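(* Let $\mathbb{E}=(\mathbb{E}_\alpha)_{\alpha>\alpha_*}$ be a scale of Banach spaces. Let $(A(t))_{t\ge0}\subset L(\mathbb{E})$ satisfy (A1), let $(V(t,s))_{t\ge s\ge0}$ satisfy (A2), (A3), (A4), and let $(B(t))_{t\ge0}\subset L(\mathbb{E})$ satisfy (B1), (B2). Let $W(t,s)$ be the perturbed forward family associated with $V$ and $B$, and $T(\alpha',\alpha)=\frac{\alpha-\alpha'}{2KeM(\alpha)}$ (conditions and definitions are in the context). Then: (a) For all $\alpha'<\alpha''<\alpha$, $k\in\mathbb{E}_\alpha$ and $s\ge 0$, the map $$[s,s+\min\{T(\alpha',\alpha),T(\alpha'',\alpha)\})\ni t\mapsto W_{\alpha\alpha'}(t,s)k\in\mathbb{E}_{\alpha'}$$ is continuously differentiable with $\frac{\partial}{\partial t}W_{\alpha\alpha'}(t,s)k=(A_{\alpha''\alpha'}(t)+B_{\alpha''\alpha'}(t))W_{\alpha\alpha''}(t,s)k$. (b) For all $\alpha'<\alpha''<\alpha$, $k\in\mathbb{E}_\alpha$ and $t\ge 0$, the map $$(t-\min\{T(\alpha',\alpha),T(\alpha',\alpha'')\},t]\cap[0,\infty)\ni s\mapsto W_{\alpha\alpha'}(t,s)k\in\mathbb{E}_{\alpha'}$$ is continuously differentiable with $\frac{\partial}{\partial s}W_{\alpha\alpha'}(t,s)k=-W_{\alpha''\alpha'}(t,s)(A_{\alpha\alpha''}(s)+B_{\alpha\alpha''}(s))k$. (c) Fix $s\ge0$, $\alpha'<\alpha$ and $k\in\mathbb{E}_\alpha$.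 Suppose that there exist $T>0$ and a function $u\in C([s,s+T];\mathbb{E}_{\alpha'})$ which is a solution on $[s,s+T]$ to the forward evolution equation $$\frac{d}{dt}i_{\alpha'\alpha''}u(t)=(A_{\alpha'\alpha''}(t)+B_{\alpha'\alpha''}(t))u(t),\quad u(s)=k,\quad t\in[s,s+T].$$ Then $u(t)=W_{\alpha\alpha'}(t,s)k$ for any $t$ with $s\le t<s+\min\{T,T(\alpha',\alpha)\}$.
   Context: Scale of Banach spaces: $\alpha_*\in\mathbb{R}$ is fixed and $\mathbb{E}=(\mathbb{E}_\alpha)_{\alpha>\alpha_*}$ is a family of Banach spaces with $\mathbb{E}_\alpha\subset\mathbb{E}_{\alpha'}$ and $\|\cdot\|_{\alpha'}\le\|\cdot\|_\alpha$ for $\alpha'<\alpha$. Writing $\alpha'<\alpha$ always includes $\alpha'>\alpha_*$. $i_{\alpha\alpha'}\in L(\mathbb{E}_\alpha,\mathbb{E}_{\alpha'})$ denotes the embedding; $\|\cdot\|_{\alpha\alpha'}$ is the operator norm on $L(\mathbb{E}_\alpha,\mathbb{E}_{\alpha'})$. $L(\mathbb{E})$ is the set of collections $A=(A_{\alpha\alpha'})_{\alpha'<\alpha}$, $A_{\alpha\alpha'}\in L(\mathbb{E}_\alpha,\mathbb{E}_{\alpha'})$, with $A_{\alpha''\alpha'}=i_{\alpha\alpha'}A_{\alpha''\alpha}=A_{\alpha\alpha'}i_{\alpha''\alpha}$ for all $\alpha'<\alpha<\alpha''$. Composition in $L(\mathbb{E})$: $(AB)_{\alpha\alpha'}:=A_{\beta\alpha'}B_{\alpha\beta}$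 for any $\beta\in(\alpha',\alpha)$ (independent of $\beta$). (A1) For all $\alpha'<\alpha$, $t\mapsto A_{\alpha\alpha'}(t)\in L(\mathbb{E}_\alpha,\mathbb{E}_{\alpha'})$ is continuous in the operator norm on $[0,\infty)$. (A2) $V(t,s)\in L(\mathbb{E})$ for all $t\ge s\ge 0$, $V_{\alpha\alpha'}(t,t)=i_{\alpha\alpha'}$ for all $\alpha'<\alpha$, $t\ge 0$, and for any $\alpha'<\alpha$, $k\in\mathbb{E}_\alpha$ the map $(t,s)\mapsto V_{\alpha\alpha'}(t,s)k$ is continuous in $\mathbb{E}_{\alpha'}$. (A3) For any $\alpha'<\alpha''<\alpha$, $k\in\mathbb{E}_\alpha$, $0\le s\le t$: $V_{\alpha\alpha'}(t,s)k=k+\int_s^tA_{\alpha''\alpha'}(r)V_{\alpha\alpha''}(r,s)k\,dr$ and $V_{\alpha\alpha'}(t,s)k=k-\int_s^tV_{\alpha''\alpha'}(t,r)A_{\alpha\alpha''}(r)k\,dr$ in the printed form of the paper's conditions, i.e. the forward and backward integral equations whose integrals exist in $\mathbb{E}_{\alpha'}$, with the sign in the second equation being the one for which $\frac{\partial}{\partial s}V_{\alpha\alpha'}(t,s)k=-V_{\alpha''\alpha'}(t,s)A_{\alpha\alpha''}(s)k$, namely $V_{\alpha\alpha'}(t,s)k=k+\int_s^tV_{\alpha''\alpha'}(t,r)A_{\alpha\alpha''}(r)k\,dr$ (this latter form is the one to be used). (A4) There is a constant $K\ge 1$ with $\|V_{\alpha\alpha'}(t,s)\|_{\alpha\alpha'}\le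 K$ for all $0\le s\le t$ and $\alpha'<\alpha$. (B1) For all $\alpha'<\alpha$ and $k\in\mathbb{E}_\alpha$, $t\mapsto B_{\alpha\alpha'}(t)k\in\mathbb{E}_{\alpha'}$ is continuous on $[0,\infty)$. (B2) There is an increasing continuous function $M:(\alpha_*,\infty)\to[0,\infty)$ with $\|B_{\alpha\alpha'}(t)\|_{\alpha\alpha'}\le\frac{M(\alpha)}{\alpha-\alpha'}$ for all $t\ge 0$, $\alpha'<\alpha$. Perturbed forward family: put $T(\alpha',\alpha):=\frac{\alpha-\alpha'}{2KeM(\alpha)}$ with $1/0:=+\infty$. $W$ is the family $\{W_{\alpha\alpha'}(t,s)\in L(\mathbb{E}_\alpha,\mathbb{E}_{\alpha'}):\alpha'<\alpha,\ 0\le s\le t,\ t-s<T(\alpha',\alpha)\}$ with the following properties (under (A2), (A4), (B1), (B2) it exists and is unique): (i) $(t,s)\mapsto W_{\alpha\alpha'}(t,s)$ is strongly continuous, $W_{\alpha\alpha'}(t,t)=i_{\alpha\alpha'}$, $\|W_{\alpha\alpha'}(t,s)\|_{\alpha\alpha'}\le\frac{T(\alpha',\alpha)}{T(\alpha',\alpha)-(t-s)}K$; (ii) for $\alpha'<\alpha''<\alpha$, $W_{\alpha\alpha'}(t,s)=i_{\alpha''\alpha'}W_{\alpha\alpha''}(t,s)$ if $t-s<\min\{T(\alpha',\alpha),T(\alpha'',\alpha)\}$ and $W_{\alpha\alpha'}(t,s)=W_{\alpha''\alpha'}(t,s)i_{\alpha\alpha''}$ if $t-s<\min\{T(\alpha',\alpha),T(\alpha',\alpha'')\}$;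 (iii) $W_{\alpha\alpha'}(t,s)k=V_{\alpha\alpha'}(t,s)k+\int_s^t(V(t,r)B(r))_{\alpha''\alpha'}W_{\alpha\alpha''}(r,s)k\,dr$ for $k\in\mathbb{E}_\alpha$, $\alpha'<\alpha''<\alpha$, $t-s<\min\{T(\alpha',\alpha),T(\alpha'',\alpha)\}$; (iv) $W_{\alpha\alpha'}(t,s)k=V_{\alpha\alpha'}(t,s)k+\int_s^tW_{\alpha''\alpha'}(t,r)(B(r)V(r,s))_{\alpha\alpha''}k\,dr$ for $k\in\mathbb{E}_\alpha$, $\alpha'<\alpha''<\alpha$, $t-s<\min\{T(\alpha',\alpha),T(\alpha',\alpha'')\}$. Solution to the forward evolution equation: for $\alpha_*<\alpha'<\alpha$, $k\in\mathbb{E}_\alpha$, $s\ge0$, $T>0$, a solution on $[s,s+T]$ is a function $u\in C([s,s+T];\mathbb{E}_{\alpha'})$ with $u(s)=k$ (in $\mathbb{E}_{\alpha'}$) such that for all $\alpha''\in(\alpha_*,\alpha')$: $i_{\alpha'\alpha''}u\in C^1([s,s+T];\mathbb{E}_{\alpha''})$ and $\frac{d}{dt}i_{\alpha'\alpha''}u(t)=(A_{\alpha'\alpha''}(t)+B_{\alpha'\alpha''}(t))u(t)$ for $t\in[s,s+T]$. *)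

theory Defs
  imports "HOL-Analysis.Analysis"
begin

text \<open>
  The spaces \<open>E\<^sub>\<alpha>\<close> of a scale are nested and carry different norms, so they are modelled as
  subspaces \<open>E \<alpha>\<close> of one ambient real vector space (for instance their union), each with its
  own norm function \<open>N \<alpha>\<close>; the ambient space has no topology. The embeddings are then
  inclusions and do not appear in the formulas. Only the values of \<open>N \<alpha>\<close>, and of operators
  defined on \<open>E \<alpha>\<close>, at points of \<open>E \<alpha>\<close> matter.
\<close>

section \<open>Analysis in a normed space given by a carrier and a norm\<close>

text \<open>The locale \<open>Metric_space\<close> asks for nonnegativity and symmetry on the whole type, hence the
  default value outside the carrier.\<close>

definition norm_dist :: "'a::real_vector set \<Rightarrow> ('a \<Rightarrow> real) \<Rightarrow> 'a \<Rightarrow> 'a \<Rightarrow> real" where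
  "norm_dist S n x y = (if x \<in> S \<and> y \<in> S then n (x - y) else 0)"

definition norm_topology :: "'a::real_vector set \<Rightarrow> ('a \<Rightarrow> real) \<Rightarrow> 'a topology" where
  "norm_topology S n = Metric_space.mtopology S (norm_dist S n)"

definition normed_on :: "'a::real_vector set \<Rightarrow> ('a \<Rightarrow> real) \<Rightarrow> bool" where
  "normed_on S n \<longleftrightarrow> subspace S \<and>
     (\<forall>x\<in>S. 0 \<le> n x \<and> (n x = 0 \<longleftrightarrow> x = 0)) \<and>
     (\<forall>x\<in>S. \<forall>c. n (c *\<^sub>R x) = \<bar>c\<bar> * n x) \<and>
     (\<forall>x\<in>S. \<forall>y\<in>S. n (x + y) \<le> n x + n y)"

definition banach_on :: "'a::real_vector set \<Rightarrow> ('a \<Rightarrow> real) \<Rightarrow> bool" where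
  "banach_on S n \<longleftrightarrow> normed_on S n \<and> Metric_space.mcomplete S (norm_dist S n)"

lemma Metric_space_norm_dist:
  assumes "normed_on S n"
  shows "Metric_space S (norm_dist S n)"
proof
  have sub: "x - y \<in> S" if "x \<in> S" "y \<in> S" for x y
    using assms that by (simp add: normed_on_def subspace_diff)
  have pos: "0 \<le> n x" and zero: "n x = 0 \<longleftrightarrow> x = 0" and scale: "n (c *\<^sub>R x) = \<bar>c\<bar> * n x"
    if "x \<in> S" for x c
    using assms that by (simp_all add: normed_on_def)
  have tri: "n (x + y) \<le> n x + n y" if "x \<in> S" "y \<in> S" for x y
    using assms that by (simp add: normed_on_def)
  fix x y z
  show "0 \<le> norm_dist S n x y"
    by (simp add: norm_dist_def pos sub)
  show "norm_dist S n x y = norm_dist S n y x"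
    using scale[OF sub, of x y "-1"] by (simp add: norm_dist_def)
  show "norm_dist S n x y = 0 \<longleftrightarrow> x = y" if "x \<in> S" "y \<in> S"
    using that zero[OF sub, of x y] by (simp add: norm_dist_def)
  show "norm_dist S n x z \<le> norm_dist S n x y + norm_dist S n y z"
    if "x \<in> S" "y \<in> S" "z \<in> S"
    using that tri[OF sub sub, of x y y z] by (simp add: norm_dist_def)
qed

definition cont_in :: "'a::real_vector set \<Rightarrow> ('a \<Rightarrow> real) \<Rightarrow> 'b::topological_space set \<Rightarrow> ('b \<Rightarrow> 'a) \<Rightarrow> bool" where
  "cont_in S n I f \<longleftrightarrow> continuous_map (top_of_set I) (norm_topology S n) f"

definition has_deriv_in ::
    "'a::real_vector set \<Rightarrow> ('a \<Rightarrow> real) \<Rightarrow> (real \<Rightarrow> 'a) \<Rightarrow> 'a \<Rightarrow> real \<Rightarrow> real set \<Rightarrow> bool" where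
  "has_deriv_in S n f D t I \<longleftrightarrow>
     limitin (norm_topology S n) (\<lambda>r. (1 / (r - t)) *\<^sub>R (f r - f t)) D (at t within I)"

text \<open>Derivatives at end points belonging to \<open>I\<close> are one-sided.\<close>

definition C1_with_deriv ::
    "'a::real_vector set \<Rightarrow> ('a \<Rightarrow> real) \<Rightarrow> real set \<Rightarrow> (real \<Rightarrow> 'a) \<Rightarrow> (real \<Rightarrow> 'a) \<Rightarrow> bool" where
  "C1_with_deriv S n I f f' \<longleftrightarrow>
     f \<in> I \<rightarrow> S \<and> (\<forall>t\<in>I. has_deriv_in S n f (f' t) t I) \<and> cont_in S n I f'"

text \<open>The Riemann integral over \<open>{a..b}\<close> with respect to the norm \<open>n\<close>, i.e. the library's
  \<open>has_integral\<close> with constant gauges. All integrands below are continuous.\<close>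

definition has_integral_in ::
    "'a::real_vector set \<Rightarrow> ('a \<Rightarrow> real) \<Rightarrow> (real \<Rightarrow> 'a) \<Rightarrow> 'a \<Rightarrow> real \<Rightarrow> real \<Rightarrow> bool" where
  "has_integral_in S n f y a b \<longleftrightarrow> f \<in> {a..b} \<rightarrow> S \<and> y \<in> S \<and>
     (\<forall>e>0. \<exists>d>0. \<forall>p. p tagged_division_of {a..b} \<and> (\<lambda>x. ball x d) fine p \<longrightarrow>
        n ((\<Sum>(x, J)\<in>p. measure lborel J *\<^sub>R f x) - y) < e)"

definition bounded_linear_in ::
    "'a::real_vector set \<Rightarrow> ('a \<Rightarrow> real) \<Rightarrow> 'a set \<Rightarrow> ('a \<Rightarrow> real) \<Rightarrow> ('a \<Rightarrow> 'a) \<Rightarrow> bool" where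
  "bounded_linear_in S n S' n' f \<longleftrightarrow> f \<in> S \<rightarrow> S' \<and>
     (\<forall>x\<in>S. \<forall>y\<in>S. f (x + y) = f x + f y) \<and>
     (\<forall>x\<in>S. \<forall>c. f (c *\<^sub>R x) = c *\<^sub>R f x) \<and>
     (\<exists>C. \<forall>x\<in>S. n' (f x) \<le> C * n x)"

text \<open>Compare \<open>onorm\<close>; the point \<open>0\<close> contributes \<open>0 / 0 = 0\<close>.\<close>

definition opnorm_in ::
    "'a::real_vector set \<Rightarrow> ('a \<Rightarrow> real) \<Rightarrow> ('a \<Rightarrow> real) \<Rightarrow> ('a \<Rightarrow> 'a) \<Rightarrow> real" where
  "opnorm_in S n n' f = (SUP x\<in>S. n' (f x) / n x)"

section \<open>Scales of Banach spaces and their operators\<close>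

definition banach_scale ::
    "real \<Rightarrow> (real \<Rightarrow> 'a::real_vector set) \<Rightarrow> (real \<Rightarrow> 'a \<Rightarrow> real) \<Rightarrow> bool" where
  "banach_scale astar E N \<longleftrightarrow>
     (\<forall>\<alpha>>astar. banach_on (E \<alpha>) (N \<alpha>)) \<and>
     (\<forall>\<alpha>' \<alpha>. astar < \<alpha>' \<and> \<alpha>' < \<alpha> \<longrightarrow> E \<alpha> \<subseteq> E \<alpha>' \<and> (\<forall>k\<in>E \<alpha>. N \<alpha>' k \<le> N \<alpha> k))"

text \<open>\<open>A \<alpha> \<alpha>'\<close> is the component \<open>A\<^bsub>\<alpha>\<alpha>'\<^esub>\<close>, an operator from \<open>E \<alpha>\<close> to the larger space \<open>E \<alpha>'\<close>.\<close>

type_synonym 'a scale_op = "real \<Rightarrow> real \<Rightarrow> 'a \<Rightarrow> 'a"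

definition scale_ops ::
    "real \<Rightarrow> (real \<Rightarrow> 'a::real_vector set) \<Rightarrow> (real \<Rightarrow> 'a \<Rightarrow> real) \<Rightarrow> 'a scale_op set" where
  "scale_ops astar E N = {A.
     (\<forall>\<alpha>' \<alpha>. astar < \<alpha>' \<and> \<alpha>' < \<alpha> \<longrightarrow>
        bounded_linear_in (E \<alpha>) (N \<alpha>) (E \<alpha>') (N \<alpha>') (A \<alpha> \<alpha>')) \<and>
     (\<forall>\<alpha>' \<alpha> \<alpha>''. astar < \<alpha>' \<and> \<alpha>' < \<alpha> \<and> \<alpha> < \<alpha>'' \<longrightarrow>
        (\<forall>k\<in>E \<alpha>''. A \<alpha>'' \<alpha>' k = A \<alpha>'' \<alpha> k \<and> A \<alpha>'' \<alpha>' k = A \<alpha> \<alpha>' k))}"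

text \<open>The product goes through the midpoint; by the lemma below, any other intermediate index
  gives the same operator.\<close>

definition scale_comp :: "'a scale_op \<Rightarrow> 'a scale_op \<Rightarrow> 'a scale_op" where
  "scale_comp A B \<alpha> \<alpha>' k = A ((\<alpha> + \<alpha>') / 2) \<alpha>' (B \<alpha> ((\<alpha> + \<alpha>') / 2) k)"

lemma scale_comp_eq:
  assumes A: "A \<in> scale_ops astar E N" and B: "B \<in> scale_ops astar E N"
    and "astar < \<alpha>'" "\<alpha>' < \<beta>" "\<beta> < \<alpha>" "k \<in> E \<alpha>"
  shows "scale_comp A B \<alpha> \<alpha>' k = A \<beta> \<alpha>' (B \<alpha> \<beta> k)"
proof -
  have *: "A \<gamma> \<alpha>' (B \<alpha> \<gamma> k) = A \<delta> \<alpha>' (B \<alpha> \<delta> k)"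
    if "\<alpha>' < \<gamma>" "\<gamma> < \<delta>" "\<delta> < \<alpha>" for \<gamma> \<delta>
  proof -
    have o: "astar < \<gamma>" "astar < \<delta>" using that assms by auto
    have "B \<alpha> \<gamma> k = B \<alpha> \<delta> k"
      using B o that assms(6) by (simp add: scale_ops_def)
    moreover have "B \<alpha> \<delta> \<in> E \<alpha> \<rightarrow> E \<delta>"
      using B o that by (simp add: scale_ops_def bounded_linear_in_def)
    then have "B \<alpha> \<delta> k \<in> E \<delta>" using assms(6) by (rule funcset_mem)
    then have "A \<delta> \<alpha>' (B \<alpha> \<delta> k) = A \<gamma> \<alpha>' (B \<alpha> \<delta> k)"
      using A o that assms(3) unfolding scale_ops_def mem_Collect_eq by metis
    ultimately show ?thesis by simp
  qed
  have mid: "\<alpha>' < (\<alpha> + \<alpha>') / 2" "(\<alpha> + \<alpha>') / 2 < \<alpha>" using assms(4,5) by auto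
  consider "(\<alpha> + \<alpha>') / 2 < \<beta>" | "(\<alpha> + \<alpha>') / 2 = \<beta>" | "\<beta> < (\<alpha> + \<alpha>') / 2"
    by linarith
  then show ?thesis
  proof cases
    case 1
    show ?thesis unfolding scale_comp_def by (rule *[OF mid(1) 1 assms(5)])
  next
    case 2
    show ?thesis unfolding scale_comp_def 2 ..
  next
    case 3
    show ?thesis unfolding scale_comp_def by (rule *[OF assms(4) 3 mid(2), symmetric])
  qed
qed

section \<open>Conditions on the generator, the unperturbed propagator and the perturbation\<close>

definition condA1 ::
    "real \<Rightarrow> (real \<Rightarrow> 'a::real_vector set) \<Rightarrow> (real \<Rightarrow> 'a \<Rightarrow> real) \<Rightarrow> (real \<Rightarrow> 'a scale_op) \<Rightarrow> bool" where
  "condA1 astar E N A \<longleftrightarrow>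
     (\<forall>\<alpha>' \<alpha>. astar < \<alpha>' \<and> \<alpha>' < \<alpha> \<longrightarrow>
        (\<forall>t\<ge>0. ((\<lambda>r. opnorm_in (E \<alpha>) (N \<alpha>) (N \<alpha>') (\<lambda>k. A r \<alpha> \<alpha>' k - A t \<alpha> \<alpha>' k)) \<longlongrightarrow> 0)
           (at t within {0..})))"

text \<open>\<open>V t s \<alpha> \<alpha>'\<close> is \<open>V\<^bsub>\<alpha>\<alpha>'\<^esub>(t, s)\<close>.\<close>

definition condA2 ::
    "real \<Rightarrow> (real \<Rightarrow> 'a::real_vector set) \<Rightarrow> (real \<Rightarrow> 'a \<Rightarrow> real) \<Rightarrow> (real \<Rightarrow> real \<Rightarrow> 'a scale_op) \<Rightarrow> bool" where
  "condA2 astar E N V \<longleftrightarrow>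
     (\<forall>s t. 0 \<le> s \<and> s \<le> t \<longrightarrow> V t s \<in> scale_ops astar E N) \<and>
     (\<forall>\<alpha>' \<alpha>. astar < \<alpha>' \<and> \<alpha>' < \<alpha> \<longrightarrow> (\<forall>k\<in>E \<alpha>.
        (\<forall>t\<ge>0. V t t \<alpha> \<alpha>' k = k) \<and>
        cont_in (E \<alpha>') (N \<alpha>') {(t, s). 0 \<le> s \<and> s \<le> t} (\<lambda>(t, s). V t s \<alpha> \<alpha>' k)))"

definition condA3 ::
    "real \<Rightarrow> (real \<Rightarrow> 'a::real_vector set) \<Rightarrow> (real \<Rightarrow> 'a \<Rightarrow> real) \<Rightarrow>
     (real \<Rightarrow> 'a scale_op) \<Rightarrow> (real \<Rightarrow> real \<Rightarrow> 'a scale_op) \<Rightarrow> bool" where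
  "condA3 astar E N A V \<longleftrightarrow>
     (\<forall>\<alpha>' \<alpha>'' \<alpha> s t. astar < \<alpha>' \<and> \<alpha>' < \<alpha>'' \<and> \<alpha>'' < \<alpha> \<and> 0 \<le> s \<and> s \<le> t \<longrightarrow> (\<forall>k\<in>E \<alpha>.
        has_integral_in (E \<alpha>') (N \<alpha>') (\<lambda>r. A r \<alpha>'' \<alpha>' (V r s \<alpha> \<alpha>'' k)) (V t s \<alpha> \<alpha>' k - k) s t \<and>
        has_integral_in (E \<alpha>') (N \<alpha>') (\<lambda>r. V t r \<alpha>'' \<alpha>' (A r \<alpha> \<alpha>'' k)) (V t s \<alpha> \<alpha>' k - k) s t))"

definition condA4 ::
    "real \<Rightarrow> (real \<Rightarrow> 'a::real_vector set) \<Rightarrow> (real \<Rightarrow> 'a \<Rightarrow> real) \<Rightarrow>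
     (real \<Rightarrow> real \<Rightarrow> 'a scale_op) \<Rightarrow> real \<Rightarrow> bool" where
  "condA4 astar E N V K \<longleftrightarrow> 1 \<le> K \<and>
     (\<forall>\<alpha>' \<alpha> s t. astar < \<alpha>' \<and> \<alpha>' < \<alpha> \<and> 0 \<le> s \<and> s \<le> t \<longrightarrow>
        opnorm_in (E \<alpha>) (N \<alpha>) (N \<alpha>') (V t s \<alpha> \<alpha>') \<le> K)"

definition condB1 ::
    "real \<Rightarrow> (real \<Rightarrow> 'a::real_vector set) \<Rightarrow> (real \<Rightarrow> 'a \<Rightarrow> real) \<Rightarrow> (real \<Rightarrow> 'a scale_op) \<Rightarrow> bool" where
  "condB1 astar E N B \<longleftrightarrow>
     (\<forall>\<alpha>' \<alpha>. astar < \<alpha>' \<and> \<alpha>' < \<alpha> \<longrightarrow> (\<forall>k\<in>E \<alpha>.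
        cont_in (E \<alpha>') (N \<alpha>') {0..} (\<lambda>t. B t \<alpha> \<alpha>' k)))"

definition condB2 ::
    "real \<Rightarrow> (real \<Rightarrow> 'a::real_vector set) \<Rightarrow> (real \<Rightarrow> 'a \<Rightarrow> real) \<Rightarrow>
     (real \<Rightarrow> 'a scale_op) \<Rightarrow> (real \<Rightarrow> real) \<Rightarrow> bool" where
  "condB2 astar E N B M \<longleftrightarrow>
     (\<forall>\<alpha>>astar. 0 \<le> M \<alpha>) \<and> mono_on {astar<..} M \<and> continuous_on {astar<..} M \<and>
     (\<forall>\<alpha>' \<alpha> t. astar < \<alpha>' \<and> \<alpha>' < \<alpha> \<and> 0 \<le> t \<longrightarrow>
        opnorm_in (E \<alpha>) (N \<alpha>) (N \<alpha>') (B t \<alpha> \<alpha>') \<le> M \<alpha> / (\<alpha> - \<alpha>'))"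

section \<open>The perturbed family and solutions\<close>

definition lifetime :: "real \<Rightarrow> (real \<Rightarrow> real) \<Rightarrow> real \<Rightarrow> real \<Rightarrow> ereal" where
  "lifetime K M \<alpha>' \<alpha> =
     (if M \<alpha> = 0 then \<infinity> else ereal ((\<alpha> - \<alpha>') / (2 * K * exp 1 * M \<alpha>)))"

text \<open>The bound \<open>T / (T - \<tau>) * K\<close>, read as its limit \<open>K\<close> for \<open>T = \<infinity>\<close> (where the library's
  \<open>\<infinity> / \<infinity>\<close> would be \<open>0\<close>).\<close>

definition growth_bound :: "real \<Rightarrow> ereal \<Rightarrow> real \<Rightarrow> real" where
  "growth_bound K T \<tau> =
     (if T = \<infinity> then K else real_of_ereal T / (real_of_ereal T - \<tau>) * K)"

definition perturbed_family ::
    "real \<Rightarrow> (real \<Rightarrow> 'a::real_vector set) \<Rightarrow> (real \<Rightarrow> 'a \<Rightarrow> real) \<Rightarrow>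
     (real \<Rightarrow> real \<Rightarrow> 'a scale_op) \<Rightarrow> (real \<Rightarrow> 'a scale_op) \<Rightarrow> real \<Rightarrow> (real \<Rightarrow> real) \<Rightarrow>
     (real \<Rightarrow> real \<Rightarrow> 'a scale_op) \<Rightarrow> bool" where
  "perturbed_family astar E N V B K M W \<longleftrightarrow> (let T = lifetime K M in
     (\<forall>\<alpha>' \<alpha>. astar < \<alpha>' \<and> \<alpha>' < \<alpha> \<longrightarrow>
        (\<forall>s t. 0 \<le> s \<and> s \<le> t \<and> ereal (t - s) < T \<alpha>' \<alpha> \<longrightarrow>
           bounded_linear_in (E \<alpha>) (N \<alpha>) (E \<alpha>') (N \<alpha>') (W t s \<alpha> \<alpha>') \<and>
           opnorm_in (E \<alpha>) (N \<alpha>) (N \<alpha>') (W t s \<alpha> \<alpha>') \<le> growth_bound K (T \<alpha>' \<alpha>) (t - s)) \<and>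
        (\<forall>k\<in>E \<alpha>.
           cont_in (E \<alpha>') (N \<alpha>') {(t, s). 0 \<le> s \<and> s \<le> t \<and> ereal (t - s) < T \<alpha>' \<alpha>}
             (\<lambda>(t, s). W t s \<alpha> \<alpha>' k) \<and>
           (\<forall>t\<ge>0. W t t \<alpha> \<alpha>' k = k))) \<and>
     (\<forall>\<alpha>' \<alpha>'' \<alpha> s t. astar < \<alpha>' \<and> \<alpha>' < \<alpha>'' \<and> \<alpha>'' < \<alpha> \<and> 0 \<le> s \<and> s \<le> t \<longrightarrow> (\<forall>k\<in>E \<alpha>.
        (ereal (t - s) < min (T \<alpha>' \<alpha>) (T \<alpha>'' \<alpha>) \<longrightarrow>
           W t s \<alpha> \<alpha>' k = W t s \<alpha> \<alpha>'' k \<and>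
           has_integral_in (E \<alpha>') (N \<alpha>')
             (\<lambda>r. scale_comp (V t r) (B r) \<alpha>'' \<alpha>' (W r s \<alpha> \<alpha>'' k))
             (W t s \<alpha> \<alpha>' k - V t s \<alpha> \<alpha>' k) s t) \<and>
        (ereal (t - s) < min (T \<alpha>' \<alpha>) (T \<alpha>' \<alpha>'') \<longrightarrow>
           W t s \<alpha> \<alpha>' k = W t s \<alpha>'' \<alpha>' k \<and>
           has_integral_in (E \<alpha>') (N \<alpha>')
             (\<lambda>r. W t r \<alpha>'' \<alpha>' (scale_comp (B r) (V r s) \<alpha> \<alpha>'' k))
             (W t s \<alpha> \<alpha>' k - V t s \<alpha> \<alpha>' k) s t))))"

definition forward_solution ::
    "real \<Rightarrow> (real \<Rightarrow> 'a::real_vector set) \<Rightarrow> (real \<Rightarrow> 'a \<Rightarrow> real) \<Rightarrow>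
     (real \<Rightarrow> 'a scale_op) \<Rightarrow> (real \<Rightarrow> 'a scale_op) \<Rightarrow>
     real \<Rightarrow> real \<Rightarrow> real \<Rightarrow> 'a \<Rightarrow> (real \<Rightarrow> 'a) \<Rightarrow> bool" where
  "forward_solution astar E N A B \<alpha>' s T k u \<longleftrightarrow>
     cont_in (E \<alpha>') (N \<alpha>') {s..s + T} u \<and> u s = k \<and>
     (\<forall>\<alpha>''. astar < \<alpha>'' \<and> \<alpha>'' < \<alpha>' \<longrightarrow>
        C1_with_deriv (E \<alpha>'') (N \<alpha>'') {s..s + T} u
          (\<lambda>t. A t \<alpha>' \<alpha>'' (u t) + B t \<alpha>' \<alpha>'' (u t)))"

end

theory Submission
  imports Defs
begin

text \<open>
Parts (a) and (b) are Leibniz' rule for the two Duhamel formulas that characterise \<open>W\<close>.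
  Consider \<open>W(t,s)k - V(t,s)k = \<integral>\<^sub>s\<^sup>t V(t,r)B(r)W(r,s)k dr\<close> as a function of \<open>t\<close>. The moving end point
  contributes \<open>V(t,t)B(t)W(t,s)k = B(t)W(t,s)k\<close>. Differentiating under the integral contributes
  \<open>\<integral>\<^sub>s\<^sup>t A(t)V(t,r)B(r)W(r,s)k dr\<close>; here the bounded operator \<open>A(t)\<close> can be pulled out, and the
  same Duhamel formula, read in a smaller space of the scale, turns the rest into
  \<open>A(t)(W(t,s)k - V(t,s)k)\<close>. Adding \<open>\<partial>\<^sub>t V(t,s)k = A(t)V(t,s)k\<close> gives (a) (\<open>W_forward_C1\<close>).
  For (b) (\<open>W_backward_C1\<close>) the dual formula is differentiated in \<open>s\<close>, using
  \<open>\<partial>\<^sub>s V(r,s)k = - V(r,s)A(s)k\<close>; what remains under the integral is the Duhamel formula for the vector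
  \<open>A(s)k\<close>, which lies in \<open>E \<alpha>''\<close> only. That formula involves \<open>W\<close> on some \<open>E \<beta>\<close> with
  \<open>\<alpha>' < \<beta> < \<alpha>''\<close>, and its lifetime must still exceed \<open>t - s\<close>: since \<open>M\<close> is increasing, every \<open>\<beta>\<close>
  close enough to \<open>\<alpha>''\<close> will do (\<open>lifetime_shrink_start\<close>).

  Both derivatives are obtained from Riemann sums. If a division of \<open>{a..c}\<close> is split at \<open>b\<close>,
  an integral over \<open>{a..c}\<close> can be compared with two different integrals over \<open>{a..b}\<close> and
  \<open>{b..c}\<close> as soon as the integrands are uniformly close (\<open>has_integral_in_split_estimate\<close>). With
  the old integrand plus its first-order correction on one part and a constant on the other, this is
  Leibniz' rule. Uniform closeness comes from joint continuity on the compact time triangle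
  \<open>{(t,r). a \<le> r \<le> t \<le> b}\<close>, and joint continuity from strong continuity together with local bounds of
  the operator norms (\<open>cont_in_apply\<close>). The increment estimates obtained in this way are uniform over
  compact time intervals, and such estimates with a continuous candidate derivative yield
  continuous differentiability, two-sided in the interior (\<open>C1_with_derivI\<close>).

  For (c) let \<open>v(r) = u(r) - W(r,s)k\<close>. By (a), \<open>v\<close> solves the homogeneous equation, and \<open>v(s) = 0\<close>.
  By (b) and the product rule, \<open>r \<mapsto> W(t,r)v(r)\<close> has derivative
  \<open>- W(t,r)(A(r)+B(r))v(r) + W(t,r)(A(r)+B(r))v(r) = 0\<close> in a larger space, so it is constant; its value
  is \<open>v(t)\<close> at \<open>r = t\<close> and \<open>W(t,r\<^sub>0)v(r\<^sub>0)\<close> at \<open>r = r\<^sub>0\<close>. Hence a zero of \<open>v\<close> at \<open>r\<^sub>0\<close> propagates for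
  as long as \<open>W\<close> lives below \<open>E \<alpha>'\<close>. This may be shorter than \<open>T(\<alpha>',\<alpha>)\<close>, but it does not
  depend on \<open>r\<^sub>0\<close>, so finitely many steps of fixed length reach every \<open>t\<close>.
\<close>

section \<open>Normed carriers\<close>

lemma normed_on_subspace: "normed_on S n \<Longrightarrow> subspace S"
  by (simp add: normed_on_def)

lemma normed_on_nonneg: "normed_on S n \<Longrightarrow> x \<in> S \<Longrightarrow> 0 \<le> n x"
  by (simp add: normed_on_def)

lemma normed_on_zero: "normed_on S n \<Longrightarrow> n 0 = 0"
  by (simp add: normed_on_def subspace_0)

lemma normed_on_eq_0: "normed_on S n \<Longrightarrow> x \<in> S \<Longrightarrow> n x = 0 \<longleftrightarrow> x = 0"
  by (simp add: normed_on_def)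

lemma normed_on_scale: "normed_on S n \<Longrightarrow> x \<in> S \<Longrightarrow> n (c *\<^sub>R x) = \<bar>c\<bar> * n x"
  by (simp add: normed_on_def)

lemma normed_on_triangle: "normed_on S n \<Longrightarrow> x \<in> S \<Longrightarrow> y \<in> S \<Longrightarrow> n (x + y) \<le> n x + n y"
  by (simp add: normed_on_def)

lemma normed_on_minus: "normed_on S n \<Longrightarrow> x \<in> S \<Longrightarrow> n (- x) = n x"
  using normed_on_scale[of S n x "-1"] by simp

lemma normed_on_minus_commute:
  "normed_on S n \<Longrightarrow> x \<in> S \<Longrightarrow> y \<in> S \<Longrightarrow> n (x - y) = n (y - x)"
  using normed_on_minus[of S n "x - y"] by (simp add: normed_on_subspace subspace_diff)

lemma normed_on_le_add:
  assumes "normed_on S n" "x = a + b" "a \<in> S" "b \<in> S" "n a \<le> p" "n b \<le> q"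
  shows "n x \<le> p + q"
  using normed_on_triangle[OF assms(1,3,4)] assms(2,5,6) by simp

lemma normed_on_abs_diff:
  assumes "normed_on S n" "a \<in> S" "b \<in> S"
  shows "\<bar>n a - n b\<bar> \<le> n (a - b)"
  using normed_on_triangle[OF assms(1), of "a - b" b] normed_on_triangle[OF assms(1), of "b - a" a]
    normed_on_minus_commute[OF assms] assms by (simp add: normed_on_subspace subspace_diff)

lemma normed_on_sum:
  assumes "normed_on S n" "\<And>i. i \<in> I \<Longrightarrow> f i \<in> S"
  shows "n (\<Sum>i\<in>I. f i) \<le> (\<Sum>i\<in>I. n (f i))"
  using assms(2)
proof (induction I rule: infinite_finite_induct)
  case (insert i I)
  have "n (f i + (\<Sum>i\<in>I. f i)) \<le> n (f i) + n (\<Sum>i\<in>I. f i)"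
    using insert by (intro normed_on_triangle[OF assms(1)])
      (auto intro!: subspace_sum normed_on_subspace[OF assms(1)])
  then show ?case using insert by force
qed (simp_all add: normed_on_zero[OF assms(1)])

lemma bounded_linear_inD:
  assumes "bounded_linear_in S n S' n' P"
  shows "x \<in> S \<Longrightarrow> P x \<in> S'"
    and "x \<in> S \<Longrightarrow> y \<in> S \<Longrightarrow> P (x + y) = P x + P y"
    and "x \<in> S \<Longrightarrow> P (c *\<^sub>R x) = c *\<^sub>R P x"
    and "normed_on S n \<Longrightarrow> \<exists>C\<ge>0. \<forall>x\<in>S. n' (P x) \<le> C * n x"
proof -
  show "x \<in> S \<Longrightarrow> P x \<in> S'" "x \<in> S \<Longrightarrow> y \<in> S \<Longrightarrow> P (x + y) = P x + P y"
    "x \<in> S \<Longrightarrow> P (c *\<^sub>R x) = c *\<^sub>R P x"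
    using assms by (auto simp: bounded_linear_in_def)
  obtain C where C: "\<forall>x\<in>S. n' (P x) \<le> C * n x" using assms by (auto simp: bounded_linear_in_def)
  assume n: "normed_on S n"
  have "n' (P x) \<le> max 0 C * n x" if "x \<in> S" for x
    using C that mult_right_mono[of C "max 0 C" "n x"] normed_on_nonneg[OF n that]
    by force
  then show "\<exists>C\<ge>0. \<forall>x\<in>S. n' (P x) \<le> C * n x" by (intro exI[of _ "max 0 C"]) auto
qed

lemma bounded_linear_in_zero:
  assumes "bounded_linear_in S n S' n' P" "subspace S"
  shows "P 0 = 0"
  using bounded_linear_inD(3)[OF assms(1), of 0 0] subspace_0[OF assms(2)] by simp

lemma bounded_linear_in_diff:
  assumes "bounded_linear_in S n S' n' P" "subspace S" "x \<in> S" "y \<in> S"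
  shows "P (x - y) = P x - P y"
  using bounded_linear_inD(2)[OF assms(1), of x "- y"] bounded_linear_inD(3)[OF assms(1), of y "-1"]
    assms by (simp add: subspace_neg)

lemma bounded_linear_in_sum:
  assumes P: "bounded_linear_in S n S' n' P" and S: "subspace S" and f: "\<And>i. i \<in> I \<Longrightarrow> f i \<in> S"
  shows "P (\<Sum>i\<in>I. f i) = (\<Sum>i\<in>I. P (f i))"
  using f
proof (induction I rule: infinite_finite_induct)
  case (insert i I)
  then show ?case
    using bounded_linear_inD(2)[OF P, of "f i" "\<Sum>i\<in>I. f i"] by (simp add: subspace_sum[OF S])
qed (simp_all add: bounded_linear_in_zero[OF P S])

lemma bounded_linear_in_diff_op:
  assumes P: "bounded_linear_in S n S' n' P" and Q: "bounded_linear_in S n S' n' Q"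
    and n: "normed_on S n" and n': "normed_on S' n'"
  shows "bounded_linear_in S n S' n' (\<lambda>x. P x - Q x)"
proof -
  note S' = normed_on_subspace[OF n']
  obtain C D where C: "\<forall>x\<in>S. n' (P x) \<le> C * n x" and D: "\<forall>x\<in>S. n' (Q x) \<le> D * n x"
    using bounded_linear_inD(4)[OF P n] bounded_linear_inD(4)[OF Q n] by blast
  have "n' (P x - Q x) \<le> (C + D) * n x" if "x \<in> S" for x
    unfolding distrib_right
    using that C D n' bounded_linear_inD(1)[OF P that] bounded_linear_inD(1)[OF Q that]
    by (intro normed_on_le_add[OF n', of _ "P x" "- Q x"]) (auto simp: normed_on_minus subspace_neg[OF S'])
  then show ?thesis
    using bounded_linear_inD(1-3)[OF P] bounded_linear_inD(1-3)[OF Q]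
    unfolding bounded_linear_in_def
    by (intro conjI ballI allI exI[of _ "C + D"]) (auto simp: subspace_diff[OF S'] algebra_simps)
qed

lemma bounded_linear_in_scaleR:
  assumes P: "bounded_linear_in S n S' n' P" and n: "normed_on S n" and n': "normed_on S' n'"
  shows "bounded_linear_in S n S' n' (\<lambda>x. c *\<^sub>R P x)"
proof -
  obtain C where C: "\<And>x. x \<in> S \<Longrightarrow> n' (P x) \<le> C * n x" using bounded_linear_inD(4)[OF P n] by blast
  have "n' (c *\<^sub>R P x) \<le> \<bar>c\<bar> * C * n x" if "x \<in> S" for x
    using normed_on_scale[OF n' bounded_linear_inD(1)[OF P that], of c]
      mult_left_mono[OF C[OF that], of "\<bar>c\<bar>"] by (simp add: mult.assoc)
  then show ?thesis
    using bounded_linear_inD(1-3)[OF P] normed_on_subspace[OF n'] unfolding bounded_linear_in_def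
    by (intro conjI ballI allI exI[of _ "\<bar>c\<bar> * C"]) (auto simp: subspace_scale scaleR_add_right)
qed

lemma bounded_linear_in_id: "normed_on S n \<Longrightarrow> bounded_linear_in S n S n (\<lambda>x. x)"
  unfolding bounded_linear_in_def by (auto intro: exI[of _ 1])

lemma opnorm_in_bound:
  assumes P: "bounded_linear_in S n S' n' P" and n: "normed_on S n" and n': "normed_on S' n'"
    and x: "x \<in> S"
  shows "n' (P x) \<le> opnorm_in S n n' P * n x"
proof (cases "x = 0")
  case True
  then show ?thesis
    using bounded_linear_in_zero[OF P normed_on_subspace[OF n]] by (simp add: normed_on_zero[OF n] normed_on_zero[OF n'])
next
  case False
  then have pos: "n x > 0" using normed_on_eq_0[OF n x] normed_on_nonneg[OF n x] by simp
  obtain C where C: "C \<ge> 0" "\<forall>x\<in>S. n' (P x) \<le> C * n x" using bounded_linear_inD(4)[OF P n] by blast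
  have "n' (P y) / n y \<le> C" if "y \<in> S" for y
    using C that normed_on_nonneg[OF n that] by (cases "n y = 0") (auto simp: divide_simps)
  then have "bdd_above ((\<lambda>x. n' (P x) / n x) ` S)" by (intro bdd_aboveI[of _ C]) auto
  then have "n' (P x) / n x \<le> opnorm_in S n n' P"
    unfolding opnorm_in_def using x by (intro cSUP_upper)
  then show ?thesis using pos by (simp add: divide_simps)
qed

lemma opnorm_in_le:
  assumes "bounded_linear_in S n S' n' P" "normed_on S n" "normed_on S' n'"
    and "opnorm_in S n n' P \<le> C" "x \<in> S"
  shows "n' (P x) \<le> C * n x"
  using opnorm_in_bound[OF assms(1-3,5)] mult_right_mono[OF assms(4), of "n x"]
    normed_on_nonneg[OF assms(2,5)] by simp

section \<open>Continuity and derivatives\<close>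

lemma cont_in_iff:
  fixes I :: "'b::metric_space set"
  assumes n: "normed_on S n"
  shows "cont_in S n I f \<longleftrightarrow> f \<in> I \<rightarrow> S \<and>
    (\<forall>x\<in>I. \<forall>e>0. \<exists>d>0. \<forall>y\<in>I. dist y x < d \<longrightarrow> n (f y - f x) < e)"
    (is "?L \<longleftrightarrow> ?R")
proof -
  interpret Metric_space S "norm_dist S n" by (rule Metric_space_norm_dist[OF n])
  have L: "?L \<longleftrightarrow> (\<forall>x\<in>I. \<forall>e>0. \<exists>U. openin (top_of_set I) U \<and> x \<in> U \<and> (\<forall>y\<in>U. f y \<in> mball (f x) e))"
    unfolding cont_in_def norm_topology_def continuous_map_to_metric by simp
  have ball: "f y \<in> mball (f x) e \<longleftrightarrow> f x \<in> S \<and> f y \<in> S \<and> n (f y - f x) < e" for x y e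
    using normed_on_minus_commute[OF n, of "f x" "f y"] by (auto simp: norm_dist_def)
  show ?thesis
  proof
    assume ?L
    show ?R
    proof (intro conjI ballI allI impI)
      show "f \<in> I \<rightarrow> S"
        using \<open>?L\<close> unfolding cont_in_def norm_topology_def continuous_map_def by auto
      fix x and e :: real assume "x \<in> I" "e > 0"
      then obtain U where U: "openin (top_of_set I) U" "x \<in> U" "\<And>y. y \<in> U \<Longrightarrow> n (f y - f x) < e"
        using \<open>?L\<close> unfolding L ball by meson
      then obtain d where "d > 0" "ball x d \<inter> I \<subseteq> U"
        unfolding openin_contains_ball by blast
      then show "\<exists>d>0. \<forall>y\<in>I. dist y x < d \<longrightarrow> n (f y - f x) < e"
        using U(3) by (intro exI[of _ d]) (auto simp: subset_iff dist_commute)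
    qed
  next
    assume R: ?R
    show ?L unfolding L
    proof (intro ballI allI impI)
      fix x and e :: real assume x: "x \<in> I" "e > 0"
      then obtain d where d: "d > 0" "\<And>y. y \<in> I \<Longrightarrow> dist y x < d \<Longrightarrow> n (f y - f x) < e"
        using R by blast
      show "\<exists>U. openin (top_of_set I) U \<and> x \<in> U \<and> (\<forall>y\<in>U. f y \<in> mball (f x) e)"
        unfolding ball using d x R
        by (intro exI[of _ "I \<inter> ball x d"]) (auto simp: dist_commute)
    qed
  qed
qed

lemma cont_inD:
  fixes I :: "'b::metric_space set"
  assumes "cont_in S n I f" "normed_on S n"
  shows "x \<in> I \<Longrightarrow> f x \<in> S"
    and "x \<in> I \<Longrightarrow> e > 0 \<Longrightarrow> \<exists>d>0. \<forall>y\<in>I. dist y x < d \<longrightarrow> n (f y - f x) < e"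
  using assms(1) unfolding cont_in_iff[OF assms(2)] by auto

lemma cont_in_subset: "cont_in S n I f \<Longrightarrow> J \<subseteq> I \<Longrightarrow> cont_in S n J f"
  unfolding cont_in_def by (rule continuous_map_from_subtopology_mono)

lemma cont_in_compose:
  assumes "cont_in S n Q f" "continuous_on I g" "\<And>p. p \<in> I \<Longrightarrow> g p \<in> Q"
  shows "cont_in S n I (\<lambda>p. f (g p))"
proof -
  have "continuous_map (top_of_set I) (top_of_set Q) g"
    using assms(2,3) by (auto simp: continuous_map_in_subtopology)
  then show ?thesis
    using continuous_map_compose assms(1) unfolding cont_in_def o_def by blast
qed

lemma cont_in_add:
  fixes I :: "'b::metric_space set"
  assumes n: "normed_on S n" and f: "cont_in S n I f" and g: "cont_in S n I g"
  shows "cont_in S n I (\<lambda>p. f p + g p)"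
  unfolding cont_in_iff[OF n]
proof (intro conjI ballI allI impI)
  note S = normed_on_subspace[OF n]
  show "(\<lambda>p. f p + g p) \<in> I \<rightarrow> S"
    using cont_inD(1)[OF f n] cont_inD(1)[OF g n] by (auto intro: subspace_add[OF S])
  fix x and e :: real assume x: "x \<in> I" "e > 0"
  obtain d1 where d1: "d1 > 0" "\<And>y. y \<in> I \<Longrightarrow> dist y x < d1 \<Longrightarrow> n (f y - f x) < e/2"
    using cont_inD(2)[OF f n x(1), of "e/2"] x by auto
  obtain d2 where d2: "d2 > 0" "\<And>y. y \<in> I \<Longrightarrow> dist y x < d2 \<Longrightarrow> n (g y - g x) < e/2"
    using cont_inD(2)[OF g n x(1), of "e/2"] x by auto
  show "\<exists>d>0. \<forall>y\<in>I. dist y x < d \<longrightarrow> n (f y + g y - (f x + g x)) < e"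
  proof (intro exI[of _ "min d1 d2"] conjI ballI impI)
    fix y assume y: "y \<in> I" "dist y x < min d1 d2"
    have "n ((f y - f x) + (g y - g x)) \<le> n (f y - f x) + n (g y - g x)"
      using x y cont_inD(1)[OF f n] cont_inD(1)[OF g n]
      by (intro normed_on_triangle[OF n]) (auto intro: subspace_diff[OF S])
    then show "n (f y + g y - (f x + g x)) < e"
      using d1(2)[of y] d2(2)[of y] y by (simp add: algebra_simps)
  qed (use d1 d2 in auto)
qed

lemma cont_in_scaleR:
  fixes I :: "'b::metric_space set"
  assumes n: "normed_on S n" and f: "cont_in S n I f"
  shows "cont_in S n I (\<lambda>p. c *\<^sub>R f p)"
  unfolding cont_in_iff[OF n]
proof (intro conjI ballI allI impI)
  note S = normed_on_subspace[OF n]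
  show "(\<lambda>p. c *\<^sub>R f p) \<in> I \<rightarrow> S"
    using cont_inD(1)[OF f n] by (auto intro: subspace_scale[OF S])
  fix x and e :: real assume x: "x \<in> I" "e > 0"
  obtain d where d: "d > 0" "\<And>y. y \<in> I \<Longrightarrow> dist y x < d \<Longrightarrow> n (f y - f x) < e/(\<bar>c\<bar> + 1)"
    using cont_inD(2)[OF f n x(1), of "e/(\<bar>c\<bar> + 1)"] x by auto
  show "\<exists>d>0. \<forall>y\<in>I. dist y x < d \<longrightarrow> n (c *\<^sub>R f y - c *\<^sub>R f x) < e"
  proof (intro exI[of _ d] conjI ballI impI)
    fix y assume y: "y \<in> I" "dist y x < d"
    have S': "f y - f x \<in> S" using x y cont_inD(1)[OF f n] by (auto intro: subspace_diff[OF S])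
    have "n (c *\<^sub>R f y - c *\<^sub>R f x) = \<bar>c\<bar> * n (f y - f x)"
      using normed_on_scale[OF n S', of c] by (simp add: scaleR_diff_right)
    also have "\<dots> \<le> (\<bar>c\<bar> + 1) * n (f y - f x)"
      using normed_on_nonneg[OF n S'] by (simp add: distrib_right)
    also have "\<dots> < e" using d(2)[OF y] by (simp add: field_simps)
    finally show "n (c *\<^sub>R f y - c *\<^sub>R f x) < e" .
  qed (use d in auto)
qed

text \<open>In \<open>P(q)f(q) - P(q\<^sub>0)f(q\<^sub>0) = P(q)(f(q) - f(q\<^sub>0)) + (P(q) - P(q\<^sub>0))f(q\<^sub>0)\<close> the local bound on the
operator norms controls the first term and strong continuity the second. The reparametrisation \<open>g\<close> lets the same lemma serve
operators that depend on one or on two times.\<close>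

lemma cont_in_apply:
  fixes I :: "'b::metric_space set" and Q :: "'c::metric_space set"
  assumes n: "normed_on S n" and n': "normed_on S' n'"
    and P: "\<And>q. q \<in> Q \<Longrightarrow> bounded_linear_in S n S' n' (P q)"
    and strong: "\<And>x. x \<in> S \<Longrightarrow> cont_in S' n' Q (\<lambda>q. P q x)"
    and bound: "\<And>q0. q0 \<in> Q \<Longrightarrow> \<exists>C. \<exists>d>0. \<forall>q\<in>Q. dist q q0 < d \<longrightarrow> (\<forall>x\<in>S. n' (P q x) \<le> C * n x)"
    and g: "continuous_on I g" "\<And>p. p \<in> I \<Longrightarrow> g p \<in> Q"
    and f: "cont_in S n I f"
  shows "cont_in S' n' I (\<lambda>p. P (g p) (f p))"
  unfolding cont_in_iff[OF n']
proof (intro conjI ballI allI impI)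
  note S = normed_on_subspace[OF n] and S' = normed_on_subspace[OF n']
  note fS = cont_inD(1)[OF f n] and PS = bounded_linear_inD(1)[OF P]
  show "(\<lambda>p. P (g p) (f p)) \<in> I \<rightarrow> S'"
    using fS PS g(2) by auto
  fix x and e :: real assume x: "x \<in> I" "e > 0"
  obtain C0 d0 where d0: "d0 > 0"
    and C0: "\<And>q y. q \<in> Q \<Longrightarrow> dist q (g x) < d0 \<Longrightarrow> y \<in> S \<Longrightarrow> n' (P q y) \<le> C0 * n y"
    using bound[OF g(2)[OF x(1)]] by blast
  define C where "C = max 0 C0 + 1"
  have C: "n' (P q y) \<le> C * n y" if "q \<in> Q" "dist q (g x) < d0" "y \<in> S" for q y
    by (rule order_trans[OF C0[OF that] mult_right_mono[OF _ normed_on_nonneg[OF n that(3)]]])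
      (simp add: C_def)
  have Cpos: "C > 0" by (simp add: C_def add_nonneg_pos)
  obtain d1 where d1: "d1 > 0" "\<And>y. y \<in> I \<Longrightarrow> dist y x < d1 \<Longrightarrow> dist (g y) (g x) < d0"
    using g(1) x(1) d0 unfolding continuous_on_iff by blast
  obtain d2 where d2: "d2 > 0" "\<And>y. y \<in> I \<Longrightarrow> dist y x < d2 \<Longrightarrow> n (f y - f x) < e/2/C"
    using cont_inD(2)[OF f n x(1), of "e/2/C"] x Cpos by auto
  have "cont_in S' n' I (\<lambda>p. P (g p) (f x))"
    by (rule cont_in_compose[OF strong[OF fS[OF x(1)]] g])
  then obtain d3 where d3: "d3 > 0"
    "\<And>y. y \<in> I \<Longrightarrow> dist y x < d3 \<Longrightarrow> n' (P (g y) (f x) - P (g x) (f x)) < e/2"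
    using cont_inD(2)[OF _ n' x(1), of _ "e/2"] x by (metis half_gt_zero)
  show "\<exists>d>0. \<forall>y\<in>I. dist y x < d \<longrightarrow> n' (P (g y) (f y) - P (g x) (f x)) < e"
  proof (intro exI[of _ "Min {d1,d2,d3}"] conjI ballI impI)
    fix y assume y: "y \<in> I" "dist y x < Min {d1,d2,d3}"
    have eq: "P (g y) (f y) - P (g x) (f x) = P (g y) (f y - f x) + (P (g y) (f x) - P (g x) (f x))"
      using bounded_linear_in_diff[OF P[OF g(2)[OF y(1)]] S fS[OF y(1)] fS[OF x(1)]] by simp
    have "n' (P (g y) (f y - f x)) \<le> C * n (f y - f x)"
      using y x fS g(2) d1(2)[of y] by (intro C) (auto intro: subspace_diff[OF S])
    also have "\<dots> < e/2" using d2(2)[of y] y Cpos by (simp add: field_simps)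
    finally have "n' (P (g y) (f y - f x)) < e/2" .
    moreover have "P (g y) (f y - f x) \<in> S'"
      by (rule PS[OF g(2)[OF y(1)] subspace_diff[OF S fS[OF y(1)] fS[OF x(1)]]])
    ultimately have "n' (P (g y) (f y) - P (g x) (f x)) \<le> n' (P (g y) (f y - f x)) + e/2"
      using y x fS g(2) PS d3(2)[of y]
      by (intro normed_on_le_add[OF n' eq]) (auto intro!: subspace_diff[OF S'])
    then show "n' (P (g y) (f y) - P (g x) (f x)) < e"
      using \<open>n' (P (g y) (f y - f x)) < e/2\<close> by linarith
  qed (use d1 d2 d3 in auto)
qed

text \<open>The real function \<open>(x, y) \<mapsto> n (f x - f y)\<close> is continuous on the compact set \<open>I \<times> I\<close> and
vanishes on the diagonal, so the Heine--Cantor theorem for real functions suffices.\<close>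

lemma cont_in_uniformly:
  fixes I :: "'b::metric_space set"
  assumes n: "normed_on S n" and f: "cont_in S n I f" and I: "compact I" and "e > 0"
  obtains d where "d > 0" "\<And>x y. x \<in> I \<Longrightarrow> y \<in> I \<Longrightarrow> dist x y < d \<Longrightarrow> n (f x - f y) < e"
proof -
  note S = normed_on_subspace[OF n] and fS = cont_inD(1)[OF f n]
  define h where "h = (\<lambda>(x, y). n (f x - f y))"
  have "continuous_on (I \<times> I) h"
    unfolding continuous_on_iff
  proof (intro ballI allI impI)
    fix p and e :: real assume p: "p \<in> I \<times> I" and e: "e > 0"
    obtain x y where xy: "p = (x, y)" "x \<in> I" "y \<in> I" using p by auto
    obtain d1 where d1: "d1 > 0" "\<And>x'. x' \<in> I \<Longrightarrow> dist x' x < d1 \<Longrightarrow> n (f x' - f x) < e/2"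
      using cont_inD(2)[OF f n xy(2), of "e/2"] e by auto
    obtain d2 where d2: "d2 > 0" "\<And>x'. x' \<in> I \<Longrightarrow> dist x' y < d2 \<Longrightarrow> n (f x' - f y) < e/2"
      using cont_inD(2)[OF f n xy(3), of "e/2"] e by auto
    show "\<exists>d>0. \<forall>q\<in>I \<times> I. dist q p < d \<longrightarrow> dist (h q) (h p) < e"
    proof (intro exI[of _ "min d1 d2"] conjI ballI impI)
      fix q assume "q \<in> I \<times> I" "dist q p < min d1 d2"
      then obtain x' y' where q: "q = (x', y')" "x' \<in> I" "y' \<in> I"
        and d: "dist x' x < d1" "dist y' y < d2"
        using xy dist_fst_le[of q p] dist_snd_le[of q p] by fastforce
      have "\<bar>n (f x' - f y') - n (f x - f y)\<bar> \<le> n (f x' - f y' - (f x - f y))"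
        using fS xy q by (intro normed_on_abs_diff[OF n]) (auto intro: subspace_diff[OF S])
      also have "\<dots> \<le> n (f x' - f x) + n (f y - f y')"
        using fS xy q by (intro normed_on_le_add[OF n, of _ "f x' - f x" "f y - f y'"])
          (auto intro: subspace_diff[OF S])
      also have "\<dots> < e/2 + e/2"
        using d1(2)[of x'] d2(2)[of y'] q d fS xy normed_on_minus_commute[OF n, of "f y" "f y'"]
        by (intro add_strict_mono) auto
      finally show "dist (h q) (h p) < e" by (simp add: h_def q xy dist_real_def)
    qed (use d1 d2 in auto)
  qed
  then have "uniformly_continuous_on (I \<times> I) h"
    using I by (intro compact_uniformly_continuous compact_Times)
  then obtain d where d: "d > 0" "\<And>p q. p \<in> I \<times> I \<Longrightarrow> q \<in> I \<times> I \<Longrightarrow> dist q p < d \<Longrightarrow> dist (h q) (h p) < e"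
    using \<open>e > 0\<close> unfolding uniformly_continuous_on_def by metis
  have "n (f x - f y) < e" if "x \<in> I" "y \<in> I" "dist x y < d" for x y
    using d(2)[of "(y, y)" "(x, y)"] that fS
    by (auto simp: h_def dist_Pair_Pair normed_on_zero[OF n] dist_real_def)
  then show ?thesis using d(1) that by blast
qed

text \<open>The multiplied-out form has no quotient and includes the point \<open>r = t\<close>; all later estimates use
it.\<close>

lemma has_deriv_in_iff:
  assumes n: "normed_on S n" and f: "f \<in> I \<rightarrow> S" and t: "t \<in> I"
  shows "has_deriv_in S n f D t I \<longleftrightarrow> D \<in> S \<and>
    (\<forall>e>0. \<exists>d>0. \<forall>r\<in>I. \<bar>r - t\<bar> < d \<longrightarrow> n (f r - f t - (r - t) *\<^sub>R D) \<le> e * \<bar>r - t\<bar>)"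
    (is "?L \<longleftrightarrow> D \<in> S \<and> ?R")
proof -
  interpret Metric_space S "norm_dist S n" by (rule Metric_space_norm_dist[OF n])
  note S = normed_on_subspace[OF n]
  have memb: "(1 / (r - t)) *\<^sub>R (f r - f t) \<in> S" if "r \<in> I" for r
    using f t that by (intro subspace_scale[OF S] subspace_diff[OF S]) auto
  have quot: "n (f r - f t - (r - t) *\<^sub>R D) = \<bar>r - t\<bar> * n ((1 / (r - t)) *\<^sub>R (f r - f t) - D)"
    if "r \<in> I" "r \<noteq> t" "D \<in> S" for r
    using normed_on_scale[OF n subspace_diff[OF S memb[OF that(1)] that(3)], of "r - t"] that(2)
    by (simp add: scaleR_diff_right)
  have L: "?L \<longleftrightarrow> D \<in> S \<and> (\<forall>e>0. \<exists>d>0. \<forall>r\<in>I. r \<noteq> t \<and> \<bar>r - t\<bar> < d \<longrightarrow>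
      n ((1 / (r - t)) *\<^sub>R (f r - f t) - D) < e)"
    unfolding has_deriv_in_def norm_topology_def limitin_metric eventually_at
    using memb by (auto simp: norm_dist_def dist_real_def)
  show ?thesis unfolding L
  proof (intro conj_cong refl iffI allI impI)
    fix e :: real assume D: "D \<in> S" and "e > 0"
      and "\<forall>e>0. \<exists>d>0. \<forall>r\<in>I. r \<noteq> t \<and> \<bar>r - t\<bar> < d \<longrightarrow> n ((1 / (r - t)) *\<^sub>R (f r - f t) - D) < e"
    then obtain d where d: "d > 0"
      "\<And>r. r \<in> I \<Longrightarrow> r \<noteq> t \<Longrightarrow> \<bar>r - t\<bar> < d \<Longrightarrow> n ((1 / (r - t)) *\<^sub>R (f r - f t) - D) < e" by metis
    have "n (f r - f t - (r - t) *\<^sub>R D) \<le> e * \<bar>r - t\<bar>" if "r \<in> I" "\<bar>r - t\<bar> < d" for r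
    proof (cases "r = t")
      case True then show ?thesis by (simp add: normed_on_zero[OF n])
    next
      case False
      show ?thesis unfolding quot[OF that(1) False D]
        using mult_left_mono[OF less_imp_le[OF d(2)[OF that(1) False that(2)]], of "\<bar>r - t\<bar>"]
        by (simp add: mult.commute)
    qed
    then show "\<exists>d>0. \<forall>r\<in>I. \<bar>r - t\<bar> < d \<longrightarrow> n (f r - f t - (r - t) *\<^sub>R D) \<le> e * \<bar>r - t\<bar>"
      using d(1) by blast
  next
    fix e :: real assume D: "D \<in> S" and "e > 0" and ?R
    then obtain d where d: "d > 0"
      "\<And>r. r \<in> I \<Longrightarrow> \<bar>r - t\<bar> < d \<Longrightarrow> n (f r - f t - (r - t) *\<^sub>R D) \<le> e/2 * \<bar>r - t\<bar>"
      by (metis half_gt_zero)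
    have "n ((1 / (r - t)) *\<^sub>R (f r - f t) - D) < e" if "r \<in> I" "r \<noteq> t" "\<bar>r - t\<bar> < d" for r
    proof -
      have "\<bar>r - t\<bar> * n ((1 / (r - t)) *\<^sub>R (f r - f t) - D) \<le> \<bar>r - t\<bar> * (e/2)"
        using d(2)[OF that(1,3)] quot[OF that(1,2) D] by (simp add: mult.commute)
      then have "n ((1 / (r - t)) *\<^sub>R (f r - f t) - D) \<le> e/2" using that(2) by simp
      then show ?thesis using \<open>e > 0\<close> by linarith
    qed
    then show "\<exists>d>0. \<forall>r\<in>I. r \<noteq> t \<and> \<bar>r - t\<bar> < d \<longrightarrow> n ((1 / (r - t)) *\<^sub>R (f r - f t) - D) < e"
      using d(1) by blast
  qed
qed

lemma has_deriv_inD: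
  assumes "has_deriv_in S n f D t I" "normed_on S n" "f \<in> I \<rightarrow> S" "t \<in> I"
  shows "D \<in> S"
    and "e > 0 \<Longrightarrow> \<exists>d>0. \<forall>r\<in>I. \<bar>r - t\<bar> < d \<longrightarrow> n (f r - f t - (r - t) *\<^sub>R D) \<le> e * \<bar>r - t\<bar>"
  using assms(1) unfolding has_deriv_in_iff[OF assms(2-4)] by auto

text \<open>The increment over \<open>{x..y}\<close> may be compared with the derivative at whichever end point is
convenient, since \<open>D\<close> is continuous. Forward and backward evolution produce estimates based at
opposite ends of the interval.\<close>

lemma C1_with_derivI:
  assumes n: "normed_on S n" and f: "f \<in> I \<rightarrow> S" and D: "cont_in S n I D"
    and incr: "\<And>t e. t \<in> I \<Longrightarrow> e > 0 \<Longrightarrow> \<exists>d>0. \<forall>x\<in>I. \<forall>y\<in>I. \<bar>x - t\<bar> < d \<longrightarrow> \<bar>y - t\<bar> < d \<longrightarrow> x < y \<longrightarrow>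
      (\<exists>w\<in>{x, y}. n (f y - f x - (y - x) *\<^sub>R D w) \<le> e * (y - x))"
  shows "C1_with_deriv S n I f D"
  unfolding C1_with_deriv_def
proof (intro conjI ballI f D)
  note S = normed_on_subspace[OF n]
  fix t assume t: "t \<in> I"
  note DS = cont_inD(1)[OF D n]
  have fS: "f x \<in> S" if "x \<in> I" for x using f that by auto
  show "has_deriv_in S n f (D t) t I"
    unfolding has_deriv_in_iff[OF n f t]
  proof (intro conjI allI impI DS t)
    fix e :: real assume e: "e > 0"
    obtain d1 where d1: "d1 > 0" "\<And>x y. \<lbrakk>x \<in> I; y \<in> I; \<bar>x - t\<bar> < d1; \<bar>y - t\<bar> < d1; x < y\<rbrakk> \<Longrightarrow>
      \<exists>w\<in>{x, y}. n (f y - f x - (y - x) *\<^sub>R D w) \<le> e/2 * (y - x)"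
      using incr[OF t, of "e/2"] e by (metis half_gt_zero)
    obtain d2 where d2: "d2 > 0" "\<And>w. w \<in> I \<Longrightarrow> dist w t < d2 \<Longrightarrow> n (D w - D t) < e/2"
      using cont_inD(2)[OF D n t, of "e/2"] e by auto
    have est: "n (f y - f x - (y - x) *\<^sub>R D t) \<le> e * (y - x)"
      if xy: "x \<in> I" "y \<in> I" "\<bar>x - t\<bar> < min d1 d2" "\<bar>y - t\<bar> < min d1 d2" "x < y" for x y
    proof -
      obtain w where w: "w \<in> {x, y}" "n (f y - f x - (y - x) *\<^sub>R D w) \<le> e/2 * (y - x)"
        using d1(2)[of x y] xy by auto
      have wI: "w \<in> I" "dist w t < d2" using w(1) xy by (auto simp: dist_real_def)
      have "n ((y - x) *\<^sub>R (D w - D t)) = (y - x) * n (D w - D t)"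
        using normed_on_scale[OF n subspace_diff[OF S DS[OF wI(1)] DS[OF t]], of "y - x"] xy(5) by simp
      also have "\<dots> \<le> (y - x) * (e/2)"
        using d2(2)[OF wI] xy(5) by (intro mult_left_mono) auto
      finally have "n (f y - f x - (y - x) *\<^sub>R D t) \<le> e/2 * (y - x) + (y - x) * (e/2)"
        using w(2) xy fS DS wI t
        by (intro normed_on_le_add[OF n, of _ "f y - f x - (y - x) *\<^sub>R D w" "(y - x) *\<^sub>R (D w - D t)"])
          (auto simp: scaleR_diff_right intro!: subspace_diff[OF S] subspace_scale[OF S])
      then show ?thesis by (simp add: mult.commute)
    qed
    show "\<exists>d>0. \<forall>r\<in>I. \<bar>r - t\<bar> < d \<longrightarrow> n (f r - f t - (r - t) *\<^sub>R D t) \<le> e * \<bar>r - t\<bar>"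
    proof (intro exI[of _ "min d1 d2"] conjI ballI impI)
      fix r assume r: "r \<in> I" "\<bar>r - t\<bar> < min d1 d2"
      consider "r = t" | "t < r" | "r < t" by linarith
      then show "n (f r - f t - (r - t) *\<^sub>R D t) \<le> e * \<bar>r - t\<bar>"
      proof cases
        case 1 then show ?thesis by (simp add: normed_on_zero[OF n])
      next
        case 2 then show ?thesis using est[of t r] t r d1 d2 by auto
      next
        case 3
        have "n (f r - f t - (r - t) *\<^sub>R D t) = n (f t - f r - (t - r) *\<^sub>R D t)"
          using normed_on_minus[OF n, of "f t - f r - (t - r) *\<^sub>R D t"] fS[OF t] fS[OF r(1)] DS[OF t]
          by (simp add: algebra_simps subspace_diff[OF S] subspace_scale[OF S] subspace_add[OF S])
        then show ?thesis using est[of r t] t r d1 d2 3 by auto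
      qed
    qed (use d1 d2 in auto)
  qed
qed

text \<open>The mean value theorem for a vanishing derivative. By bisection (\<open>Bolzano\<close>), the estimate
\<open>n (g y - g x) \<le> e * (y - x)\<close> passes from small intervals to \<open>{a..b}\<close>, because it is additive
over adjacent intervals; then \<open>e\<close> tends to \<open>0\<close>.\<close>

lemma constant_if_locally_small_increments:
  assumes n: "normed_on S n" and "a \<le> b" and g: "g \<in> {a..b} \<rightarrow> S"
    and loc: "\<And>x e. x \<in> {a..b} \<Longrightarrow> e > 0 \<Longrightarrow>
      \<exists>d>0. \<forall>y\<in>{a..b}. \<bar>y - x\<bar> < d \<longrightarrow> n (g y - g x) \<le> e * \<bar>y - x\<bar>"
  shows "g b = g a"
proof -
  note S = normed_on_subspace[OF n]
  have gS: "g x \<in> S" if "x \<in> {a..b}" for x using g that by auto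
  have small: "n (g b - g a) \<le> e * (b - a)" if e: "e > 0" for e
  proof -
    define Q where "Q x y \<longleftrightarrow> (a \<le> x \<and> x \<le> y \<and> y \<le> b \<longrightarrow> n (g y - g x) \<le> e * (y - x))" for x y
    have "Q a b" using \<open>a \<le> b\<close>
    proof (induction rule: Bolzano)
      case (trans x y z)
      show ?case unfolding Q_def
      proof
        assume *: "a \<le> x \<and> x \<le> z \<and> z \<le> b"
        have "n (g z - g x) \<le> e * (z - y) + e * (y - x)"
          using trans * unfolding Q_def
          by (intro normed_on_le_add[OF n, of _ "g z - g y" "g y - g x"])
            (auto intro!: subspace_diff[OF S] gS)
        then show "n (g z - g x) \<le> e * (z - x)" by (simp add: algebra_simps)
      qed
    next
      case (local x)
      then obtain d where d: "d > 0" "\<And>y. y \<in> {a..b} \<Longrightarrow> \<bar>y - x\<bar> < d \<Longrightarrow> n (g y - g x) \<le> e * \<bar>y - x\<bar>"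
        using loc[of x e] e by auto
      show ?case
      proof (intro exI[of _ d] conjI allI impI)
        fix p q assume pq: "p \<le> x \<and> x \<le> q \<and> q - p < d"
        show "Q p q" unfolding Q_def
        proof
          assume *: "a \<le> p \<and> p \<le> q \<and> q \<le> b"
          have "n (g q - g p) \<le> e * \<bar>q - x\<bar> + e * \<bar>p - x\<bar>"
            using pq * d(2)[of p] d(2)[of q] local normed_on_minus_commute[OF n, of "g x" "g p"] gS[of x] gS[of p]
            by (intro normed_on_le_add[OF n, of _ "g q - g x" "g x - g p"])
              (auto intro!: subspace_diff[OF S] gS)
          then show "n (g q - g p) \<le> e * (q - p)" using pq by (simp add: algebra_simps)
        qed
      qed (rule d)
    qed
    then show ?thesis using \<open>a \<le> b\<close> by (simp add: Q_def)
  qed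
  have memb: "g b - g a \<in> S" using \<open>a \<le> b\<close> by (intro subspace_diff[OF S] gS) auto
  have "n (g b - g a) \<le> 0"
  proof (rule field_le_epsilon)
    fix e :: real assume "e > 0"
    have "n (g b - g a) \<le> e / (b - a + 1) * (b - a)" using \<open>e > 0\<close> \<open>a \<le> b\<close> by (intro small) auto
    also have "\<dots> \<le> e" using \<open>e > 0\<close> \<open>a \<le> b\<close> by (simp add: field_simps)
    finally show "n (g b - g a) \<le> 0 + e" by simp
  qed
  then show ?thesis using normed_on_nonneg[OF n memb] normed_on_eq_0[OF n memb] by simp
qed

section \<open>Riemann integrals\<close>

abbreviation riemann_sum :: "(real \<times> real set) set \<Rightarrow> (real \<Rightarrow> 'a::real_vector) \<Rightarrow> 'a" where
  "riemann_sum p f \<equiv> \<Sum>(x, J)\<in>p. measure lborel J *\<^sub>R f x"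

lemma riemann_sum_in:
  assumes "subspace S" "p tagged_division_of {a..b}" "\<And>x. x \<in> {a..b} \<Longrightarrow> f x \<in> S"
  shows "riemann_sum p f \<in> S"
proof -
  have "f x \<in> S" if "(x, J) \<in> p" for x J
    using tagged_division_ofD(2,3)[OF assms(2) that] assms(3) by blast
  then show ?thesis
    by (intro subspace_sum[OF assms(1)]) (auto intro!: subspace_scale[OF assms(1)])
qed

lemma riemann_sum_diff: "riemann_sum p (\<lambda>x. f x - g x) = riemann_sum p f - riemann_sum p g"
  by (simp add: split_def scaleR_diff_right sum_subtractf)

lemma riemann_sum_const:
  assumes "p tagged_division_of {a..b}" "a \<le> b"
  shows "riemann_sum p (\<lambda>_. c) = (b - a) *\<^sub>R c"
  using additive_content_tagged_division[of p a b] assms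
  by (simp add: split_def flip: scaleR_sum_left)

lemma riemann_sum_bound:
  assumes n: "normed_on S n" and p: "p tagged_division_of {a..b}" and "a \<le> b"
    and f: "\<And>x. x \<in> {a..b} \<Longrightarrow> f x \<in> S" "\<And>x. x \<in> {a..b} \<Longrightarrow> n (f x) \<le> c"
  shows "n (riemann_sum p f) \<le> c * (b - a)"
proof -
  note S = normed_on_subspace[OF n]
  have tag: "x \<in> {a..b}" if "(x, J) \<in> p" for x J
    using tagged_division_ofD(2,3)[OF p that] by blast
  have "n (riemann_sum p f) \<le> (\<Sum>z\<in>p. n (case z of (x, J) \<Rightarrow> measure lborel J *\<^sub>R f x))"
    using tag f(1) by (intro normed_on_sum[OF n]) (auto intro!: subspace_scale[OF S])
  also have "\<dots> \<le> (\<Sum>(x, J)\<in>p. measure lborel J *\<^sub>R c)"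
  proof (rule sum_mono, clarsimp)
    fix x J assume "(x, J) \<in> p"
    then show "n (measure lborel J *\<^sub>R f x) \<le> measure lborel J * c"
      using f tag by (simp add: normed_on_scale[OF n] mult_left_mono)
  qed
  also have "\<dots> = c * (b - a)"
    using riemann_sum_const[OF p \<open>a \<le> b\<close>, of c] by (simp add: mult.commute)
  finally show ?thesis .
qed

lemma has_integral_in_D:
  assumes "has_integral_in S n f y a b"
  shows "x \<in> {a..b} \<Longrightarrow> f x \<in> S" and "y \<in> S"
    and "e > 0 \<Longrightarrow> \<exists>d>0. \<forall>p. p tagged_division_of {a..b} \<and> (\<lambda>x. ball x d) fine p \<longrightarrow>
          n (riemann_sum p f - y) < e"
  using assms unfolding has_integral_in_def by auto

lemma has_integral_in_cong:
  assumes "\<And>x. x \<in> {a..b} \<Longrightarrow> f x = g x"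
  shows "has_integral_in S n f y a b \<longleftrightarrow> has_integral_in S n g y a b"
proof -
  have "riemann_sum p f = riemann_sum p g" if "p tagged_division_of {a..b}" for p
  proof (rule sum.cong[OF refl], clarify)
    fix x J assume "(x, J) \<in> p"
    then have "x \<in> {a..b}" using tagged_division_ofD(2,3)[OF that] by blast
    then show "measure lborel J *\<^sub>R f x = measure lborel J *\<^sub>R g x" by (simp add: assms)
  qed
  then have "(\<forall>p. p tagged_division_of {a..b} \<and> (\<lambda>x. ball x d) fine p \<longrightarrow>
        n (riemann_sum p f - y) < e) \<longleftrightarrow> (\<forall>p. p tagged_division_of {a..b} \<and> (\<lambda>x. ball x d) fine p \<longrightarrow>
        n (riemann_sum p g - y) < e)" for d e by auto
  moreover have "f \<in> {a..b} \<rightarrow> S \<longleftrightarrow> g \<in> {a..b} \<rightarrow> S" using assms by (simp add: Pi_iff)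
  ultimately show ?thesis unfolding has_integral_in_def by simp
qed

lemma has_integral_in_const:
  assumes n: "normed_on S n" and "c \<in> S" "a \<le> b"
  shows "has_integral_in S n (\<lambda>_. c) ((b - a) *\<^sub>R c) a b"
  unfolding has_integral_in_def
  using riemann_sum_const[OF _ \<open>a \<le> b\<close>, of _ c] assms
  by (auto simp: normed_on_zero[OF n] subspace_scale normed_on_subspace intro: exI[of _ 1])

lemma has_integral_in_bounded_linear:
  assumes n: "normed_on S n" and n': "normed_on S' n'"
    and f: "has_integral_in S n f y a b" and P: "bounded_linear_in S n S' n' P"
  shows "has_integral_in S' n' (\<lambda>x. P (f x)) (P y) a b"
  unfolding has_integral_in_def
proof (intro conjI allI impI)
  note S = normed_on_subspace[OF n]
  show "(\<lambda>x. P (f x)) \<in> {a..b} \<rightarrow> S'" "P y \<in> S'"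
    using has_integral_in_D(1,2)[OF f] bounded_linear_inD(1)[OF P] by auto
  fix e :: real assume e: "e > 0"
  obtain C where C: "C \<ge> 0" "\<And>x. x \<in> S \<Longrightarrow> n' (P x) \<le> C * n x"
    using bounded_linear_inD(4)[OF P n] by blast
  obtain d where d: "d > 0" "\<And>p. p tagged_division_of {a..b} \<Longrightarrow> (\<lambda>x. ball x d) fine p \<Longrightarrow>
      n (riemann_sum p f - y) < e / (C + 1)"
    using has_integral_in_D(3)[OF f, of "e / (C + 1)"] e C by auto
  show "\<exists>d>0. \<forall>p. p tagged_division_of {a..b} \<and> (\<lambda>x. ball x d) fine p \<longrightarrow>
      n' (riemann_sum p (\<lambda>x. P (f x)) - P y) < e"
  proof (intro exI[of _ d] conjI allI impI; (elim conjE)?)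
    fix p assume p: "p tagged_division_of {a..b}" "(\<lambda>x. ball x d) fine p"
    have tag: "x \<in> {a..b}" if "(x, J) \<in> p" for x J
      using tagged_division_ofD(2,3)[OF p(1) that] by blast
    have R: "riemann_sum p f \<in> S" by (rule riemann_sum_in[OF S p(1) has_integral_in_D(1)[OF f]])
    have diffS: "riemann_sum p f - y \<in> S" by (rule subspace_diff[OF S R has_integral_in_D(2)[OF f]])
    have "P (riemann_sum p f) = (\<Sum>z\<in>p. P (case z of (x, J) \<Rightarrow> measure lborel J *\<^sub>R f x))"
      using tag has_integral_in_D(1)[OF f]
      by (intro bounded_linear_in_sum[OF P S]) (auto intro!: subspace_scale[OF S])
    also have "\<dots> = riemann_sum p (\<lambda>x. P (f x))"
      using tag has_integral_in_D(1)[OF f] bounded_linear_inD(3)[OF P]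
      by (intro sum.cong) auto
    finally have "riemann_sum p (\<lambda>x. P (f x)) - P y = P (riemann_sum p f - y)"
      using bounded_linear_in_diff[OF P S R has_integral_in_D(2)[OF f]] by simp
    then have "n' (riemann_sum p (\<lambda>x. P (f x)) - P y) \<le> C * n (riemann_sum p f - y)"
      using C(2)[OF diffS] by simp
    also have "\<dots> \<le> (C + 1) * n (riemann_sum p f - y)"
      using normed_on_nonneg[OF n diffS] by (simp add: distrib_right)
    also have "\<dots> < e" using d(2)[OF p] C(1) by (simp add: field_simps)
    finally show "n' (riemann_sum p (\<lambda>x. P (f x)) - P y) < e" .
  qed (rule d)
qed

lemma has_integral_in_add:
  assumes n: "normed_on S n"
    and f: "has_integral_in S n f y a b" and g: "has_integral_in S n g z a b"
  shows "has_integral_in S n (\<lambda>x. f x + g x) (y + z) a b"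
  unfolding has_integral_in_def
proof (intro conjI allI impI)
  note S = normed_on_subspace[OF n]
  note fS = has_integral_in_D[OF f] and gS = has_integral_in_D[OF g]
  show "(\<lambda>x. f x + g x) \<in> {a..b} \<rightarrow> S" "y + z \<in> S"
    using fS(1,2) gS(1,2) by (auto intro: subspace_add[OF S])
  fix e :: real assume e: "e > 0"
  obtain d where d: "d > 0" "\<And>p. p tagged_division_of {a..b} \<Longrightarrow> (\<lambda>x. ball x d) fine p \<Longrightarrow>
      n (riemann_sum p f - y) < e/2"
    using fS(3)[of "e/2"] e by auto
  obtain d' where d': "d' > 0" "\<And>p. p tagged_division_of {a..b} \<Longrightarrow> (\<lambda>x. ball x d') fine p \<Longrightarrow>
      n (riemann_sum p g - z) < e/2"
    using gS(3)[of "e/2"] e by auto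
  show "\<exists>d>0. \<forall>p. p tagged_division_of {a..b} \<and> (\<lambda>x. ball x d) fine p \<longrightarrow>
      n (riemann_sum p (\<lambda>x. f x + g x) - (y + z)) < e"
  proof (intro exI[of _ "min d d'"] conjI allI impI; (elim conjE)?)
    fix p assume p: "p tagged_division_of {a..b}" "(\<lambda>x. ball x (min d d')) fine p"
    have fine: "(\<lambda>x. ball x d) fine p" "(\<lambda>x. ball x d') fine p"
      using p(2) unfolding fine_def by fastforce+
    have eq: "riemann_sum p (\<lambda>x. f x + g x) - (y + z) = (riemann_sum p f - y) + (riemann_sum p g - z)"
      by (simp add: split_def scaleR_add_right sum.distrib)
    have "n ((riemann_sum p f - y) + (riemann_sum p g - z)) \<le> n (riemann_sum p f - y) + n (riemann_sum p g - z)"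
      using fS(1,2) gS(1,2)
      by (intro normed_on_triangle[OF n] subspace_diff[OF S] riemann_sum_in[OF S p(1)])
    then show "n (riemann_sum p (\<lambda>x. f x + g x) - (y + z)) < e"
      unfolding eq using d(2)[OF p(1) fine(1)] d'(2)[OF p(1) fine(2)] by linarith
  qed (use d d' in auto)
qed

text \<open>The two divisions can only share degenerate pieces \<open>{b}\<close>, which have measure zero.\<close>

lemma riemann_sum_Un:
  assumes p: "p tagged_division_of {a..b}" and q: "q tagged_division_of {b..c}" and "a \<le> b" "b \<le> c"
  shows "p \<union> q tagged_division_of {a..c}" "riemann_sum (p \<union> q) f = riemann_sum p f + riemann_sum q f"
proof -
  have "p \<union> q tagged_division_of ({a..b} \<union> {b..c})"
    by (rule tagged_division_Un[OF p q]) (auto simp: interior_atLeastAtMost_real)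
  then show "p \<union> q tagged_division_of {a..c}"
    using assms(3,4) by (simp add: ivl_disj_un_two_touch(4))
  have "measure lborel J = 0" if J: "(x, J) \<in> p" "(x, J) \<in> q" for x J
  proof -
    have "J \<subseteq> {b}" using tagged_division_ofD(3)[OF p J(1)] tagged_division_ofD(3)[OF q J(2)] by force
    moreover obtain u v where uv: "J = {u..v}" using tagged_division_ofD(4)[OF p J(1)] by auto
    ultimately have "u = v" if "u \<le> v" using that by (metis atLeastAtMost_iff order_refl singletonD subsetD)
    then show ?thesis unfolding uv by (cases "u \<le> v") auto
  qed
  then show "riemann_sum (p \<union> q) f = riemann_sum p f + riemann_sum q f"
    using tagged_division_ofD(1)[OF p] tagged_division_ofD(1)[OF q]
    by (intro sum.union_inter_neutral) auto
qed

text \<open>The substitute for additivity of the integral and for Leibniz' rule. Joining fine divisions of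
\<open>{a..b}\<close> and \<open>{b..c}\<close> gives a fine division of \<open>{a..c}\<close>, so the three given integrals can be
approximated simultaneously and the integrands compared tag by tag.\<close>

lemma has_integral_in_split_estimate:
  assumes n: "normed_on S n" and "a \<le> b" "b \<le> c"
    and g: "has_integral_in S n g z a c"
    and f1: "has_integral_in S n f1 y1 a b" and f2: "has_integral_in S n f2 y2 b c"
    and e1: "\<And>x. x \<in> {a..b} \<Longrightarrow> n (g x - f1 x) \<le> e1"
    and e2: "\<And>x. x \<in> {b..c} \<Longrightarrow> n (g x - f2 x) \<le> e2"
  shows "n (z - (y1 + y2)) \<le> e1 * (b - a) + e2 * (c - b)"
proof (rule field_le_epsilon)
  note S = normed_on_subspace[OF n]
  note gS = has_integral_in_D[OF g] and f1S = has_integral_in_D[OF f1] and f2S = has_integral_in_D[OF f2]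
  fix e :: real assume e: "e > 0"
  obtain d where d: "d > 0" "\<And>p. p tagged_division_of {a..c} \<Longrightarrow> (\<lambda>x. ball x d) fine p \<Longrightarrow>
      n (riemann_sum p g - z) < e/3"
    using gS(3)[of "e/3"] e by auto
  obtain d1 where d1: "d1 > 0" "\<And>p. p tagged_division_of {a..b} \<Longrightarrow> (\<lambda>x. ball x d1) fine p \<Longrightarrow>
      n (riemann_sum p f1 - y1) < e/3"
    using f1S(3)[of "e/3"] e by auto
  obtain d2 where d2: "d2 > 0" "\<And>p. p tagged_division_of {b..c} \<Longrightarrow> (\<lambda>x. ball x d2) fine p \<Longrightarrow>
      n (riemann_sum p f2 - y2) < e/3"
    using f2S(3)[of "e/3"] e by auto
  define D where "D = min d (min d1 d2)"
  have "D > 0" using d d1 d2 by (simp add: D_def)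
  then have "gauge (\<lambda>x. ball x D)" for x :: real by auto
  then obtain p q where p: "p tagged_division_of {a..b}" "(\<lambda>x. ball x D) fine p"
    and q: "q tagged_division_of {b..c}" "(\<lambda>x. ball x D) fine q"
    by (metis fine_division_exists_real)
  have fine: "(\<lambda>x. ball x d) fine (p \<union> q)" "(\<lambda>x. ball x d1) fine p" "(\<lambda>x. ball x d2) fine q"
    using p(2) q(2) unfolding fine_def D_def by fastforce+
  note pq = riemann_sum_Un[OF p(1) q(1) \<open>a \<le> b\<close> \<open>b \<le> c\<close>]
  define P1 P2 Q1 Q2 where "P1 = riemann_sum p g" and "P2 = riemann_sum p f1"
    and "Q1 = riemann_sum q g" and "Q2 = riemann_sum q f2"
  have in_S: "P1 \<in> S" "P2 \<in> S" "Q1 \<in> S" "Q2 \<in> S"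
    unfolding P1_def P2_def Q1_def Q2_def using \<open>a \<le> b\<close> \<open>b \<le> c\<close>
    by (auto intro!: riemann_sum_in[OF S p(1)] riemann_sum_in[OF S q(1)] gS(1) f1S(1) f2S(1))
  note mem = subspace_diff[OF S] subspace_add[OF S] in_S gS(2) f1S(2) f2S(2)
  have 1: "n (P1 + Q1 - z) < e/3"
    using d(2)[OF pq(1) fine(1)] pq(2)[of g] by (simp add: P1_def Q1_def)
  have 2: "n (P2 - y1) < e/3" using d1(2)[OF p(1) fine(2)] by (simp add: P2_def)
  have 3: "n (Q2 - y2) < e/3" using d2(2)[OF q(1) fine(3)] by (simp add: Q2_def)
  have 4: "n (P1 - P2) \<le> e1 * (b - a)"
    unfolding P1_def P2_def riemann_sum_diff[symmetric] using \<open>b \<le> c\<close>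
    by (intro riemann_sum_bound[OF n p(1) \<open>a \<le> b\<close>] e1 subspace_diff[OF S] gS(1) f1S(1)) auto
  have 5: "n (Q1 - Q2) \<le> e2 * (c - b)"
    unfolding Q1_def Q2_def riemann_sum_diff[symmetric] using \<open>a \<le> b\<close>
    by (intro riemann_sum_bound[OF n q(1) \<open>b \<le> c\<close>] e2 subspace_diff[OF S] gS(1) f2S(1)) auto
  have "n ((P2 - y1) + (Q2 - y2)) \<le> e/3 + e/3"
    using 2 3 by (intro normed_on_le_add[OF n refl] mem) auto
  moreover have "n (z - (P1 + Q1)) \<le> e/3"
    using 1 normed_on_minus_commute[OF n, of z "P1 + Q1"] mem by simp
  ultimately have 6: "n ((P2 - y1) + (Q2 - y2) + (z - (P1 + Q1))) \<le> (e/3 + e/3) + e/3"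
    by (rule normed_on_le_add[OF n refl, rotated 2]) (intro mem)+
  have "n ((P1 - P2) + (Q1 - Q2)) \<le> e1 * (b - a) + e2 * (c - b)"
    using 4 5 by (intro normed_on_le_add[OF n refl] mem)
  moreover have "z - (y1 + y2) = ((P1 - P2) + (Q1 - Q2)) + ((P2 - y1) + (Q2 - y2) + (z - (P1 + Q1)))"
    by simp
  ultimately have "n (z - (y1 + y2)) \<le> (e1 * (b - a) + e2 * (c - b)) + ((e/3 + e/3) + e/3)"
    using 6 by (metis (no_types, lifting) normed_on_le_add[OF n] mem)
  then show "n (z - (y1 + y2)) \<le> e1 * (b - a) + e2 * (c - b) + e" by simp
qed

section \<open>Lifetimes\<close>

lemma lifetime_pos:
  assumes "0 < K" "0 \<le> M \<alpha>" "\<alpha>' < \<alpha>"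
  shows "0 < lifetime K M \<alpha>' \<alpha>"
  using assms by (auto simp: lifetime_def)

lemma lifetime_antimono:
  assumes "0 < K" "0 \<le> M \<alpha>" "\<alpha>' \<le> \<beta>"
  shows "lifetime K M \<beta> \<alpha> \<le> lifetime K M \<alpha>' \<alpha>"
  using assms by (auto simp: lifetime_def intro!: divide_right_mono)

text \<open>The hypothesis bounds \<open>\<tau>\<close> by what would be the lifetime from \<open>\<beta>\<close> to \<open>\<alpha>'\<close> if \<open>M \<beta>\<close> were as
large as \<open>M \<alpha>\<close>; it is multiplied out to cover \<open>M \<alpha> = 0\<close> as well.\<close>

lemma lifetime_lower_start:
  assumes K: "0 < K" and M: "0 \<le> M \<beta>" "M \<beta> \<le> M \<alpha>" and "\<alpha>' < \<beta>"
    and "\<tau> * (2 * K * exp 1 * M \<alpha>) < \<beta> - \<alpha>'" "0 \<le> \<tau>"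
  shows "ereal \<tau> < lifetime K M \<alpha>' \<beta>"
proof (cases "M \<beta> = 0")
  case False
  then have pos: "2 * K * exp 1 * M \<beta> > 0" using K M by auto
  have "\<tau> * (2 * K * exp 1 * M \<beta>) \<le> \<tau> * (2 * K * exp 1 * M \<alpha>)"
    using assms by (intro mult_left_mono) auto
  then have "\<tau> * (2 * K * exp 1 * M \<beta>) < \<beta> - \<alpha>'" using assms(5) by linarith
  then show ?thesis using pos False by (simp add: lifetime_def pos_less_divide_eq)
qed (simp add: lifetime_def)

text \<open>Because \<open>\<tau>\<close> is strictly below the lifetime, the inequality required by \<open>lifetime_lower_start\<close>
holds with room to spare at \<open>\<beta> = \<alpha>\<close>, hence also for \<open>\<beta>\<close> slightly below \<open>\<alpha>\<close>.\<close>

lemma lifetime_shrink_start: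
  assumes K: "0 < K" and M: "\<And>\<beta>. \<alpha>' < \<beta> \<Longrightarrow> 0 \<le> M \<beta>" "\<And>\<beta>. \<alpha>' < \<beta> \<Longrightarrow> \<beta> < \<alpha> \<Longrightarrow> M \<beta> \<le> M \<alpha>"
    and "\<alpha>' < \<alpha>" "0 \<le> \<tau>" "ereal \<tau> < lifetime K M \<alpha>' \<alpha>"
  obtains \<beta> where "\<alpha>' < \<beta>" "\<beta> < \<alpha>" "ereal \<tau> < lifetime K M \<alpha>' \<beta>"
proof -
  have less: "\<tau> * (2 * K * exp 1 * M \<alpha>) < \<alpha> - \<alpha>'"
  proof (cases "M \<alpha> = 0")
    case False
    then have "2 * K * exp 1 * M \<alpha> > 0" using K M(1)[OF \<open>\<alpha>' < \<alpha>\<close>] by auto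
    then show ?thesis using assms(6) False by (simp add: lifetime_def pos_less_divide_eq)
  qed (use assms in simp)
  have nn: "0 \<le> \<tau> * (2 * K * exp 1 * M \<alpha>)" using K M(1)[OF \<open>\<alpha>' < \<alpha>\<close>] assms(5) by simp
  obtain \<beta> where \<beta>: "\<alpha>' + \<tau> * (2 * K * exp 1 * M \<alpha>) < \<beta>" "\<beta> < \<alpha>"
    using dense[of "\<alpha>' + \<tau> * (2 * K * exp 1 * M \<alpha>)" \<alpha>] less by auto
  then have "\<alpha>' < \<beta>" using nn by linarith
  moreover have "ereal \<tau> < lifetime K M \<alpha>' \<beta>"
    using \<beta> \<open>\<alpha>' < \<beta>\<close> M K assms(5) by (intro lifetime_lower_start[of K M \<beta> \<alpha>]) auto
  ultimately show ?thesis using that \<beta>(2) by blast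
qed

section \<open>The evolution families\<close>

text \<open>The first component is the later time, as in the argument order of the propagators.\<close>

definition time_triangle :: "real \<Rightarrow> real \<Rightarrow> (real \<times> real) set" where
  "time_triangle a b = {p. a \<le> snd p \<and> snd p \<le> fst p \<and> fst p \<le> b}"

lemma compact_time_triangle: "compact (time_triangle a b)"
proof -
  have "closed (time_triangle a b)"
    unfolding time_triangle_def by (intro closed_Collect_conj closed_Collect_le continuous_intros)
  moreover have "time_triangle a b \<subseteq> cbox (a, a) (b, b)"
    by (auto simp: time_triangle_def mem_box Basis_prod_def)
  ultimately show ?thesis
    using bounded_subset[OF bounded_cbox] compact_eq_bounded_closed by blast
qed

locale perturbed_evolution =
  fixes astar :: real
    and E :: "real \<Rightarrow> 'a::real_vector set"
    and N :: "real \<Rightarrow> 'a \<Rightarrow> real"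
    and A B :: "real \<Rightarrow> 'a scale_op"
    and V W :: "real \<Rightarrow> real \<Rightarrow> 'a scale_op"
    and K :: real
    and M :: "real \<Rightarrow> real"
  assumes scale: "banach_scale astar E N"
    and A_ops: "0 \<le> t \<Longrightarrow> A t \<in> scale_ops astar E N"
    and A1: "condA1 astar E N A"
    and A2: "condA2 astar E N V"
    and A3: "condA3 astar E N A V"
    and A4: "condA4 astar E N V K"
    and B_ops: "0 \<le> t \<Longrightarrow> B t \<in> scale_ops astar E N"
    and B1: "condB1 astar E N B"
    and B2: "condB2 astar E N B M"
    and W: "perturbed_family astar E N V B K M W"
begin

abbreviation T :: "real \<Rightarrow> real \<Rightarrow> ereal" where "T \<equiv> lifetime K M"

lemma E_normed: "astar < \<alpha> \<Longrightarrow> normed_on (E \<alpha>) (N \<alpha>)"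
  using scale by (simp add: banach_scale_def banach_on_def)

lemma E_subspace: "astar < \<alpha> \<Longrightarrow> subspace (E \<alpha>)"
  by (rule normed_on_subspace[OF E_normed])

lemma E_mono: "astar < \<alpha>' \<Longrightarrow> \<alpha>' < \<alpha> \<Longrightarrow> k \<in> E \<alpha> \<Longrightarrow> k \<in> E \<alpha>'"
  using scale unfolding banach_scale_def by blast

lemma scale_op_linear:
  "P \<in> scale_ops astar E N \<Longrightarrow> astar < \<alpha>' \<Longrightarrow> \<alpha>' < \<alpha> \<Longrightarrow>
    bounded_linear_in (E \<alpha>) (N \<alpha>) (E \<alpha>') (N \<alpha>') (P \<alpha> \<alpha>')"
  unfolding scale_ops_def by blast

lemma scale_op_target:
  "P \<in> scale_ops astar E N \<Longrightarrow> astar < \<alpha>' \<Longrightarrow> \<alpha>' < \<beta> \<Longrightarrow> \<beta> < \<alpha> \<Longrightarrow> k \<in> E \<alpha> \<Longrightarrow>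
    P \<alpha> \<beta> k = P \<alpha> \<alpha>' k"
  unfolding scale_ops_def by auto

lemma scale_op_source:
  "P \<in> scale_ops astar E N \<Longrightarrow> astar < \<alpha>' \<Longrightarrow> \<alpha>' < \<beta> \<Longrightarrow> \<beta> < \<alpha> \<Longrightarrow> k \<in> E \<alpha> \<Longrightarrow>
    P \<beta> \<alpha>' k = P \<alpha> \<alpha>' k"
  unfolding scale_ops_def by (metis (mono_tags, lifting) mem_Collect_eq)

lemma V_ops: "0 \<le> s \<Longrightarrow> s \<le> t \<Longrightarrow> V t s \<in> scale_ops astar E N"
  using A2 by (simp add: condA2_def)

lemma V_refl: "astar < \<alpha>' \<Longrightarrow> \<alpha>' < \<alpha> \<Longrightarrow> k \<in> E \<alpha> \<Longrightarrow> 0 \<le> t \<Longrightarrow> V t t \<alpha> \<alpha>' k = k"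
  using A2 by (simp add: condA2_def)

lemma K_pos: "0 < K"
  using A4 by (simp add: condA4_def)

lemma M_nonneg: "astar < \<alpha> \<Longrightarrow> 0 \<le> M \<alpha>"
  using B2 by (simp add: condB2_def)

lemma M_mono: "astar < \<alpha>' \<Longrightarrow> \<alpha>' < \<alpha> \<Longrightarrow> M \<alpha>' \<le> M \<alpha>"
  using B2 by (auto simp: condB2_def intro: mono_onD)

lemma T_antimono: "astar < \<alpha> \<Longrightarrow> \<alpha>' \<le> \<beta> \<Longrightarrow> T \<beta> \<alpha> \<le> T \<alpha>' \<alpha>"
  using lifetime_antimono[of K M \<alpha>] K_pos M_nonneg by blast

lemma W_linear:
  assumes "astar < \<alpha>'" "\<alpha>' < \<alpha>" "0 \<le> s" "s \<le> t" "ereal (t - s) < T \<alpha>' \<alpha>"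
  shows "bounded_linear_in (E \<alpha>) (N \<alpha>) (E \<alpha>') (N \<alpha>') (W t s \<alpha> \<alpha>')"
  using W assms unfolding perturbed_family_def Let_def by blast

lemma W_refl: "astar < \<alpha>' \<Longrightarrow> \<alpha>' < \<alpha> \<Longrightarrow> k \<in> E \<alpha> \<Longrightarrow> 0 \<le> t \<Longrightarrow> W t t \<alpha> \<alpha>' k = k"
  using W unfolding perturbed_family_def Let_def by blast

lemmas W_identities = W[unfolded perturbed_family_def Let_def, THEN conjunct2, rule_format]

lemma W_target:
  assumes "astar < \<alpha>'" "\<alpha>' < \<alpha>''" "\<alpha>'' < \<alpha>" "0 \<le> s" "s \<le> t" "k \<in> E \<alpha>"
    and "ereal (t - s) < T \<alpha>'' \<alpha>"
  shows "W t s \<alpha> \<alpha>'' k = W t s \<alpha> \<alpha>' k"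
proof -
  have "ereal (t - s) < min (T \<alpha>' \<alpha>) (T \<alpha>'' \<alpha>)"
    using T_antimono[of \<alpha> \<alpha>' \<alpha>''] assms by (auto intro: less_le_trans)
  then show ?thesis
    using W_identities[of \<alpha>' \<alpha>'' \<alpha> s t k, THEN conjunct1, THEN mp, THEN conjunct1] assms(1-6) by simp
qed

lemma W_source:
  assumes "astar < \<alpha>'" "\<alpha>' < \<alpha>''" "\<alpha>'' < \<alpha>" "0 \<le> s" "s \<le> t" "k \<in> E \<alpha>"
    and "ereal (t - s) < T \<alpha>' \<alpha>" "ereal (t - s) < T \<alpha>' \<alpha>''"
  shows "W t s \<alpha>'' \<alpha>' k = W t s \<alpha> \<alpha>' k"
proof -
  have "ereal (t - s) < min (T \<alpha>' \<alpha>) (T \<alpha>' \<alpha>'')" using assms by simp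
  then show ?thesis
    using W_identities[of \<alpha>' \<alpha>'' \<alpha> s t k, THEN conjunct2, THEN mp, THEN conjunct1] assms(1-6) by simp
qed

text \<open>The product \<open>V(t,r)B(r)\<close> may be factored through any \<open>\<beta>\<close>. Only the lifetime at \<open>\<alpha>''\<close> is asked for
because the lifetime at the smaller index \<open>\<alpha>'\<close> is at least as long.\<close>

lemma W_forward_integral:
  assumes "astar < \<alpha>'" "\<alpha>' < \<beta>" "\<beta> < \<alpha>''" "\<alpha>'' < \<alpha>" "0 \<le> s" "s \<le> t" "k \<in> E \<alpha>"
    and "ereal (t - s) < T \<alpha>'' \<alpha>"
  shows "has_integral_in (E \<alpha>') (N \<alpha>') (\<lambda>r. V t r \<beta> \<alpha>' (B r \<alpha>'' \<beta> (W r s \<alpha> \<alpha>'' k)))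
    (W t s \<alpha> \<alpha>' k - V t s \<alpha> \<alpha>' k) s t"
proof -
  have "ereal (t - s) < min (T \<alpha>' \<alpha>) (T \<alpha>'' \<alpha>)"
    using T_antimono[of \<alpha> \<alpha>' \<alpha>''] assms by (auto intro: less_le_trans)
  then have int: "has_integral_in (E \<alpha>') (N \<alpha>') (\<lambda>r. scale_comp (V t r) (B r) \<alpha>'' \<alpha>' (W r s \<alpha> \<alpha>'' k))
    (W t s \<alpha> \<alpha>' k - V t s \<alpha> \<alpha>' k) s t"
    using W_identities[of \<alpha>' \<alpha>'' \<alpha> s t k, THEN conjunct1, THEN mp, THEN conjunct2] assms by simp
  have "scale_comp (V t r) (B r) \<alpha>'' \<alpha>' (W r s \<alpha> \<alpha>'' k) = V t r \<beta> \<alpha>' (B r \<alpha>'' \<beta> (W r s \<alpha> \<alpha>'' k))"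
    if "r \<in> {s..t}" for r
  proof (rule scale_comp_eq[OF V_ops B_ops])
    have "ereal (r - s) < T \<alpha>'' \<alpha>" using that assms(8) by (auto intro: le_less_trans[rotated])
    then show "W r s \<alpha> \<alpha>'' k \<in> E \<alpha>''"
      using assms that by (intro bounded_linear_inD(1)[OF W_linear]) auto
  qed (use assms that in auto)
  then show ?thesis by (rule iffD1[OF has_integral_in_cong int])
qed

lemma W_backward_integral:
  assumes "astar < \<alpha>'" "\<alpha>' < \<alpha>''" "\<alpha>'' < \<beta>" "\<beta> < \<alpha>" "0 \<le> s" "s \<le> t" "k \<in> E \<alpha>"
    and "ereal (t - s) < T \<alpha>' \<alpha>" "ereal (t - s) < T \<alpha>' \<alpha>''"
  shows "has_integral_in (E \<alpha>') (N \<alpha>') (\<lambda>r. W t r \<alpha>'' \<alpha>' (B r \<beta> \<alpha>'' (V r s \<alpha> \<beta> k)))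
    (W t s \<alpha> \<alpha>' k - V t s \<alpha> \<alpha>' k) s t"
proof -
  have "ereal (t - s) < min (T \<alpha>' \<alpha>) (T \<alpha>' \<alpha>'')" using assms by simp
  then have int: "has_integral_in (E \<alpha>') (N \<alpha>') (\<lambda>r. W t r \<alpha>'' \<alpha>' (scale_comp (B r) (V r s) \<alpha> \<alpha>'' k))
    (W t s \<alpha> \<alpha>' k - V t s \<alpha> \<alpha>' k) s t"
    using W_identities[of \<alpha>' \<alpha>'' \<alpha> s t k, THEN conjunct2, THEN mp, THEN conjunct2] assms by simp
  have "scale_comp (B r) (V r s) \<alpha> \<alpha>'' k = B r \<beta> \<alpha>'' (V r s \<alpha> \<beta> k)" if "r \<in> {s..t}" for r
    using assms that by (intro scale_comp_eq[OF B_ops V_ops]) auto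
  then have "W t r \<alpha>'' \<alpha>' (scale_comp (B r) (V r s) \<alpha> \<alpha>'' k) = W t r \<alpha>'' \<alpha>' (B r \<beta> \<alpha>'' (V r s \<alpha> \<beta> k))"
    if "r \<in> {s..t}" for r using that by simp
  then show ?thesis by (rule iffD1[OF has_integral_in_cong int])
qed

lemma A_linear: "0 \<le> t \<Longrightarrow> astar < \<alpha>' \<Longrightarrow> \<alpha>' < \<alpha> \<Longrightarrow>
    bounded_linear_in (E \<alpha>) (N \<alpha>) (E \<alpha>') (N \<alpha>') (A t \<alpha> \<alpha>')"
  by (rule scale_op_linear[OF A_ops])

lemma B_linear: "0 \<le> t \<Longrightarrow> astar < \<alpha>' \<Longrightarrow> \<alpha>' < \<alpha> \<Longrightarrow>
    bounded_linear_in (E \<alpha>) (N \<alpha>) (E \<alpha>') (N \<alpha>') (B t \<alpha> \<alpha>')"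
  by (rule scale_op_linear[OF B_ops])

lemma V_linear: "0 \<le> s \<Longrightarrow> s \<le> t \<Longrightarrow> astar < \<alpha>' \<Longrightarrow> \<alpha>' < \<alpha> \<Longrightarrow>
    bounded_linear_in (E \<alpha>) (N \<alpha>) (E \<alpha>') (N \<alpha>') (V t s \<alpha> \<alpha>')"
  by (rule scale_op_linear[OF V_ops])

lemmas A_in = bounded_linear_inD(1)[OF A_linear]
  and B_in = bounded_linear_inD(1)[OF B_linear]
  and V_in = bounded_linear_inD(1)[OF V_linear]
  and W_in = bounded_linear_inD(1)[OF W_linear]

lemma V_bound:
  assumes "astar < \<alpha>'" "\<alpha>' < \<alpha>" "0 \<le> s" "s \<le> t" "k \<in> E \<alpha>"
  shows "N \<alpha>' (V t s \<alpha> \<alpha>' k) \<le> K * N \<alpha> k"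
  using A4 assms E_normed unfolding condA4_def
  by (intro opnorm_in_le[OF scale_op_linear[OF V_ops]]) auto

lemma B_bound:
  assumes "astar < \<alpha>'" "\<alpha>' < \<alpha>" "0 \<le> t" "k \<in> E \<alpha>"
  shows "N \<alpha>' (B t \<alpha> \<alpha>' k) \<le> M \<alpha> / (\<alpha> - \<alpha>') * N \<alpha> k"
  using B2 assms E_normed unfolding condB2_def
  by (intro opnorm_in_le[OF scale_op_linear[OF B_ops]]) auto

text \<open>The growth bound of the perturbed family is monotone in \<open>t - s\<close> and finite before the lifetime,
so its value at \<open>\<tau>\<close> serves for all \<open>t - s \<le> \<tau>\<close>.\<close>

lemma W_bound:
  assumes "astar < \<alpha>'" "\<alpha>' < \<alpha>" "ereal \<tau> < T \<alpha>' \<alpha>" "0 \<le> \<tau>"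
  obtains C where "0 \<le> C" "\<And>s t k. 0 \<le> s \<Longrightarrow> s \<le> t \<Longrightarrow> t - s \<le> \<tau> \<Longrightarrow> k \<in> E \<alpha> \<Longrightarrow>
    N \<alpha>' (W t s \<alpha> \<alpha>' k) \<le> C * N \<alpha> k"
proof
  have tr: "ereal (t - s) < T \<alpha>' \<alpha>" if "t - s \<le> \<tau>" for s t
    using that assms(3) by (auto intro: le_less_trans[rotated])
  have grow: "0 \<le> growth_bound K (T \<alpha>' \<alpha>) \<tau> \<and> growth_bound K (T \<alpha>' \<alpha>) (t - s) \<le> growth_bound K (T \<alpha>' \<alpha>) \<tau>"
    if "t - s \<le> \<tau>" "s \<le> t" for s t
  proof (cases "T \<alpha>' \<alpha>")
    case (real R)
    then have "\<tau> < R" using assms(3) by simp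
    then have "R / (R - (t - s)) \<le> R / (R - \<tau>)" "0 \<le> R / (R - \<tau>)"
      using that assms(4) by (auto intro!: divide_left_mono mult_pos_pos)
    then have "R / (R - (t - s)) * K \<le> R / (R - \<tau>) * K" "0 \<le> R / (R - \<tau>) * K"
      using K_pos by (auto intro!: mult_right_mono mult_nonneg_nonneg simp del: times_divide_eq_left)
    then show ?thesis unfolding growth_bound_def real by simp
  qed (use K_pos assms(3) in \<open>auto simp: growth_bound_def\<close>)
  show "0 \<le> growth_bound K (T \<alpha>' \<alpha>) \<tau>" using grow[of 0 0] assms(4) by simp
  fix s t k assume *: "0 \<le> s" "s \<le> t" "t - s \<le> \<tau>" "k \<in> E \<alpha>"
  have "opnorm_in (E \<alpha>) (N \<alpha>) (N \<alpha>') (W t s \<alpha> \<alpha>') \<le> growth_bound K (T \<alpha>' \<alpha>) (t - s)"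
    using W assms * tr[OF *(3)] unfolding perturbed_family_def Let_def by blast
  then have "opnorm_in (E \<alpha>) (N \<alpha>) (N \<alpha>') (W t s \<alpha> \<alpha>') \<le> growth_bound K (T \<alpha>' \<alpha>) \<tau>"
    using grow[OF *(3,2)] by linarith
  then show "N \<alpha>' (W t s \<alpha> \<alpha>' k) \<le> growth_bound K (T \<alpha>' \<alpha>) \<tau> * N \<alpha> k"
    using assms * tr[OF *(3)] E_normed by (intro opnorm_in_le[OF W_linear]) auto
qed

lemma cont_in_const: "astar < \<alpha> \<Longrightarrow> k \<in> E \<alpha> \<Longrightarrow> cont_in (E \<alpha>) (N \<alpha>) (I :: 'b::metric_space set) (\<lambda>_. k)"
  using E_normed[of \<alpha>] by (auto simp: cont_in_iff normed_on_zero intro: exI[of _ 1])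

text \<open>Continuity in the operator norm gives both inputs of \<open>cont_in_apply\<close>: strong continuity, and a
bound near \<open>t\<close> that exceeds a bound of \<open>A(t)\<close> by at most \<open>1\<close>.\<close>

lemma cont_in_A_apply:
  fixes I :: "'b::metric_space set"
  assumes ind: "astar < \<alpha>'" "\<alpha>' < \<alpha>" and g: "continuous_on I g" "\<And>p. p \<in> I \<Longrightarrow> 0 \<le> g p"
    and f: "cont_in (E \<alpha>) (N \<alpha>) I f"
  shows "cont_in (E \<alpha>') (N \<alpha>') I (\<lambda>p. A (g p) \<alpha> \<alpha>' (f p))"
proof (rule cont_in_apply[where P = "\<lambda>t. A t \<alpha> \<alpha>'" and Q = "{0..}", OF _ _ _ _ _ g(1) _ f])
  show n: "normed_on (E \<alpha>) (N \<alpha>)" and n': "normed_on (E \<alpha>') (N \<alpha>')"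
    using ind by (auto intro: E_normed)
  show lin: "bounded_linear_in (E \<alpha>) (N \<alpha>) (E \<alpha>') (N \<alpha>') (A q \<alpha> \<alpha>')" if "q \<in> {0..}" for q
    using that ind by (auto intro: scale_op_linear[OF A_ops])
  have diff: "N \<alpha>' (A r \<alpha> \<alpha>' k - A t \<alpha> \<alpha>' k) \<le>
      opnorm_in (E \<alpha>) (N \<alpha>) (N \<alpha>') (\<lambda>k. A r \<alpha> \<alpha>' k - A t \<alpha> \<alpha>' k) * N \<alpha> k"
    if "r \<ge> 0" "t \<ge> 0" "k \<in> E \<alpha>" for r t k
    using opnorm_in_bound[OF bounded_linear_in_diff_op[OF lin lin n n'] n n'] that by simp
  have small: "\<exists>d>0. \<forall>r\<ge>0. dist r t < d \<longrightarrow> (\<forall>k\<in>E \<alpha>. N \<alpha>' (A r \<alpha> \<alpha>' k - A t \<alpha> \<alpha>' k) \<le> e * N \<alpha> k)"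
    if te: "t \<ge> 0" "e > 0" for t e
  proof -
    let ?o = "\<lambda>r. opnorm_in (E \<alpha>) (N \<alpha>) (N \<alpha>') (\<lambda>k. A r \<alpha> \<alpha>' k - A t \<alpha> \<alpha>' k)"
    have "(?o \<longlongrightarrow> 0) (at t within {0..})"
      using A1 ind that by (auto simp: condA1_def)
    then obtain d where d: "d > 0" "\<And>r. r \<ge> 0 \<Longrightarrow> r \<noteq> t \<Longrightarrow> dist r t < d \<Longrightarrow> dist (?o r) 0 < e"
      using te(2) unfolding tendsto_iff eventually_at by (metis atLeast_iff)
    have "N \<alpha>' (A r \<alpha> \<alpha>' k - A t \<alpha> \<alpha>' k) \<le> e * N \<alpha> k" if r: "r \<ge> 0" "dist r t < d" "k \<in> E \<alpha>" for r k
    proof (cases "r = t")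
      case True
      then show ?thesis using normed_on_nonneg[OF n r(3)] \<open>e > 0\<close> by (simp add: normed_on_zero[OF n'])
    next
      case False
      have "?o r * N \<alpha> k \<le> e * N \<alpha> k"
        using d(2)[OF r(1) False r(2)] normed_on_nonneg[OF n r(3)] by (intro mult_right_mono) auto
      then show ?thesis using diff[OF r(1) \<open>t \<ge> 0\<close> r(3)] by linarith
    qed
    then show ?thesis using d(1) by blast
  qed
  show "cont_in (E \<alpha>') (N \<alpha>') {0..} (\<lambda>t. A t \<alpha> \<alpha>' k)" if k: "k \<in> E \<alpha>" for k
    unfolding cont_in_iff[OF n']
  proof (intro conjI ballI allI impI)
    show "(\<lambda>t. A t \<alpha> \<alpha>' k) \<in> {0..} \<rightarrow> E \<alpha>'" using bounded_linear_inD(1)[OF lin k] by auto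
    fix t e :: real assume t: "t \<in> {0..}" "e > 0"
    have Nk: "0 \<le> N \<alpha> k" by (rule normed_on_nonneg[OF n k])
    then obtain d where d: "d > 0" "\<And>r. r \<ge> 0 \<Longrightarrow> dist r t < d \<Longrightarrow>
        N \<alpha>' (A r \<alpha> \<alpha>' k - A t \<alpha> \<alpha>' k) \<le> e / (N \<alpha> k + 1) * N \<alpha> k"
      using small[of t "e / (N \<alpha> k + 1)"] t k by auto
    have "e / (N \<alpha> k + 1) * N \<alpha> k < e" using t Nk by (simp add: field_simps)
    then show "\<exists>d>0. \<forall>r\<in>{0..}. dist r t < d \<longrightarrow> N \<alpha>' (A r \<alpha> \<alpha>' k - A t \<alpha> \<alpha>' k) < e"
      using d by (intro exI[of _ d]) (auto intro: le_less_trans)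
  qed
  show "\<exists>C. \<exists>d>0. \<forall>q\<in>{0..}. dist q t < d \<longrightarrow> (\<forall>k\<in>E \<alpha>. N \<alpha>' (A q \<alpha> \<alpha>' k) \<le> C * N \<alpha> k)"
    if t: "t \<in> {0..}" for t :: real
  proof -
    obtain C where C: "\<And>k. k \<in> E \<alpha> \<Longrightarrow> N \<alpha>' (A t \<alpha> \<alpha>' k) \<le> C * N \<alpha> k"
      using bounded_linear_inD(4)[OF lin[OF t] n] by blast
    obtain d where d: "d > 0" "\<And>r k. r \<ge> 0 \<Longrightarrow> dist r t < d \<Longrightarrow> k \<in> E \<alpha> \<Longrightarrow>
        N \<alpha>' (A r \<alpha> \<alpha>' k - A t \<alpha> \<alpha>' k) \<le> 1 * N \<alpha> k"
      using small[of t 1] t by (metis atLeast_iff zero_less_one)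
    have "N \<alpha>' (A r \<alpha> \<alpha>' k) \<le> (1 + C) * N \<alpha> k" if "r \<ge> 0" "dist r t < d" "k \<in> E \<alpha>" for r k
      unfolding distrib_right
      using d(2)[OF that] C[OF that(3)] that t bounded_linear_inD(1)[OF lin that(3)] ind
      by (intro normed_on_le_add[OF n', of _ "A r \<alpha> \<alpha>' k - A t \<alpha> \<alpha>' k" "A t \<alpha> \<alpha>' k"])
        (auto intro!: subspace_diff[OF E_subspace])
    then show ?thesis using d(1) by (intro exI[of _ "1 + C"] exI[of _ d]) auto
  qed
qed (use g in auto)

lemma cont_in_B_apply:
  fixes I :: "'b::metric_space set"
  assumes ind: "astar < \<alpha>'" "\<alpha>' < \<alpha>" and g: "continuous_on I g" "\<And>p. p \<in> I \<Longrightarrow> 0 \<le> g p"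
    and f: "cont_in (E \<alpha>) (N \<alpha>) I f"
  shows "cont_in (E \<alpha>') (N \<alpha>') I (\<lambda>p. B (g p) \<alpha> \<alpha>' (f p))"
proof (rule cont_in_apply[where P = "\<lambda>t. B t \<alpha> \<alpha>'" and Q = "{0..}", OF _ _ _ _ _ g(1) _ f])
  show "\<exists>C. \<exists>d>0. \<forall>q\<in>{0..}. dist q t < d \<longrightarrow> (\<forall>k\<in>E \<alpha>. N \<alpha>' (B q \<alpha> \<alpha>' k) \<le> C * N \<alpha> k)" for t :: real
    using B_bound[OF ind] by (intro exI[of _ "M \<alpha> / (\<alpha> - \<alpha>')"] exI[of _ 1]) auto
qed (use ind g B1 in \<open>auto simp: condB1_def intro: E_normed scale_op_linear[OF B_ops]\<close>)

lemma cont_in_V_apply: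
  fixes I :: "'b::metric_space set"
  assumes ind: "astar < \<alpha>'" "\<alpha>' < \<alpha>" and g: "continuous_on I g" "continuous_on I h"
      "\<And>p. p \<in> I \<Longrightarrow> 0 \<le> h p" "\<And>p. p \<in> I \<Longrightarrow> h p \<le> g p"
    and f: "cont_in (E \<alpha>) (N \<alpha>) I f"
  shows "cont_in (E \<alpha>') (N \<alpha>') I (\<lambda>p. V (g p) (h p) \<alpha> \<alpha>' (f p))"
proof -
  have "cont_in (E \<alpha>') (N \<alpha>') I (\<lambda>p. (\<lambda>q. V (fst q) (snd q) \<alpha> \<alpha>') (g p, h p) (f p))"
  proof (rule cont_in_apply[where Q = "{(t, s). 0 \<le> s \<and> s \<le> t}", OF _ _ _ _ _ _ _ f])
    show "\<exists>C. \<exists>d>0. \<forall>q\<in>{(t, s). 0 \<le> s \<and> s \<le> t}. dist q p < d \<longrightarrow>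
        (\<forall>k\<in>E \<alpha>. N \<alpha>' (V (fst q) (snd q) \<alpha> \<alpha>' k) \<le> C * N \<alpha> k)" for p :: "real \<times> real"
      using V_bound[OF ind] by (intro exI[of _ K] exI[of _ 1]) auto
    show "cont_in (E \<alpha>') (N \<alpha>') {(t, s). 0 \<le> s \<and> s \<le> t} (\<lambda>q. V (fst q) (snd q) \<alpha> \<alpha>' k)"
      if "k \<in> E \<alpha>" for k
      using A2 ind that by (simp add: condA2_def case_prod_beta')
  qed (use ind g in \<open>auto intro: E_normed scale_op_linear[OF V_ops] continuous_on_Pair\<close>)
  then show ?thesis by simp
qed

lemma cont_in_W_apply:
  fixes I :: "'b::metric_space set"
  assumes ind: "astar < \<alpha>'" "\<alpha>' < \<alpha>" and g: "continuous_on I g" "continuous_on I h"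
      "\<And>p. p \<in> I \<Longrightarrow> 0 \<le> h p" "\<And>p. p \<in> I \<Longrightarrow> h p \<le> g p" "\<And>p. p \<in> I \<Longrightarrow> ereal (g p - h p) < T \<alpha>' \<alpha>"
    and f: "cont_in (E \<alpha>) (N \<alpha>) I f"
  shows "cont_in (E \<alpha>') (N \<alpha>') I (\<lambda>p. W (g p) (h p) \<alpha> \<alpha>' (f p))"
proof -
  let ?Q = "{(t, s). 0 \<le> s \<and> s \<le> t \<and> ereal (t - s) < T \<alpha>' \<alpha>}"
  have "cont_in (E \<alpha>') (N \<alpha>') I (\<lambda>p. (\<lambda>q. W (fst q) (snd q) \<alpha> \<alpha>') (g p, h p) (f p))"
  proof (rule cont_in_apply[where Q = ?Q, OF _ _ _ _ _ _ _ f])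
    show "\<exists>C. \<exists>d>0. \<forall>q\<in>?Q. dist q p < d \<longrightarrow>
        (\<forall>k\<in>E \<alpha>. N \<alpha>' (W (fst q) (snd q) \<alpha> \<alpha>' k) \<le> C * N \<alpha> k)" if p_in: "p \<in> ?Q" for p :: "real \<times> real"
    proof -
      obtain t s where p: "p = (t, s)" "0 \<le> s" "s \<le> t" "ereal (t - s) < T \<alpha>' \<alpha>" using p_in by auto
      obtain \<tau> where \<tau>: "t - s < \<tau>" "ereal \<tau> < T \<alpha>' \<alpha>"
        using ereal_dense2[OF p(4)] by auto
      obtain C where C: "\<And>s t k. 0 \<le> s \<Longrightarrow> s \<le> t \<Longrightarrow> t - s \<le> \<tau> \<Longrightarrow> k \<in> E \<alpha> \<Longrightarrow>
          N \<alpha>' (W t s \<alpha> \<alpha>' k) \<le> C * N \<alpha> k"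
        using W_bound[OF ind \<tau>(2)] \<tau>(1) p(3) by (smt (verit))
      have close: "t' - s' \<le> \<tau>" if "dist (t', s') p < (\<tau> - (t - s)) / 2" for t' s'
        using dist_fst_le[of "(t', s')" p] dist_snd_le[of "(t', s')" p] that p(1)
        by (auto simp: dist_real_def abs_real_def split: if_splits)
      show ?thesis using \<tau>(1) C close
        by (intro exI[of _ C] exI[of _ "(\<tau> - (t - s)) / 2"]) auto
    qed
    show "cont_in (E \<alpha>') (N \<alpha>') ?Q (\<lambda>q. W (fst q) (snd q) \<alpha> \<alpha>' k)" if "k \<in> E \<alpha>" for k
      using W ind that unfolding perturbed_family_def Let_def case_prod_beta' by blast
  qed (use ind g in \<open>auto intro: E_normed W_linear continuous_on_Pair\<close>)
  then show ?thesis by simp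
qed

section \<open>Increments of the unperturbed propagator\<close>

text \<open>The forward integral equation at \<open>t\<close> and at \<open>t'\<close>, with the integrand on \<open>{t..t'}\<close> frozen at \<open>t\<close>.
The vector may depend on the initial time \<open>r\<close>, and \<open>d\<close> does not depend on \<open>r\<close>: in Duhamel's formula
the estimate is used under an integral over \<open>r\<close>.\<close>

lemma V_forward_increment:
  assumes ind: "astar < \<alpha>'" "\<alpha>' < \<gamma>" "\<gamma> < \<beta>" and a: "0 \<le> a"
    and x: "cont_in (E \<beta>) (N \<beta>) {a..b} x" and e: "e > 0"
  obtains d where "d > 0" "\<And>r t t'. a \<le> r \<Longrightarrow> r \<le> t \<Longrightarrow> t \<le> t' \<Longrightarrow> t' \<le> b \<Longrightarrow> t' - t < d \<Longrightarrow>
    N \<alpha>' (V t' r \<beta> \<alpha>' (x r) - V t r \<beta> \<alpha>' (x r) - (t' - t) *\<^sub>R A t \<gamma> \<alpha>' (V t r \<beta> \<gamma> (x r))) \<le> e * (t' - t)"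
proof -
  have n: "normed_on (E \<alpha>') (N \<alpha>')" and n\<beta>: "normed_on (E \<beta>) (N \<beta>)" using ind by (auto intro: E_normed)
  define \<Phi> where "\<Phi> = (\<lambda>p. A (fst p) \<gamma> \<alpha>' (V (fst p) (snd p) \<beta> \<gamma> (x (snd p))))"
  have "cont_in (E \<beta>) (N \<beta>) (time_triangle a b) (\<lambda>p. x (snd p))"
    by (rule cont_in_compose[OF x]) (auto simp: time_triangle_def intro!: continuous_intros)
  then have "cont_in (E \<alpha>') (N \<alpha>') (time_triangle a b) \<Phi>"
    unfolding \<Phi>_def using ind a
    by (intro cont_in_A_apply cont_in_V_apply) (auto simp: time_triangle_def intro!: continuous_intros)
  then obtain d where d: "d > 0" "\<And>p q. p \<in> time_triangle a b \<Longrightarrow> q \<in> time_triangle a b \<Longrightarrow> dist p q < d \<Longrightarrow>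
      N \<alpha>' (\<Phi> p - \<Phi> q) < e"
    by (rule cont_in_uniformly[OF n _ compact_time_triangle e]) blast
  have "N \<alpha>' (V t' r \<beta> \<alpha>' (x r) - V t r \<beta> \<alpha>' (x r) - (t' - t) *\<^sub>R A t \<gamma> \<alpha>' (V t r \<beta> \<gamma> (x r))) \<le> e * (t' - t)"
    if r: "a \<le> r" "r \<le> t" "t \<le> t'" "t' \<le> b" "t' - t < d" for r t t'
  proof -
    have xr: "x r \<in> E \<beta>" using cont_inD(1)[OF x n\<beta>, of r] r by auto
    have mem: "\<Phi> (t, r) \<in> E \<alpha>'" unfolding \<Phi>_def using xr r ind a by (auto intro!: A_in V_in)
    have int: "has_integral_in (E \<alpha>') (N \<alpha>') (\<lambda>\<tau>. \<Phi> (\<tau>, r)) (V u r \<beta> \<alpha>' (x r) - x r) r u" if "r \<le> u" for u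
      using A3 ind a r xr that unfolding condA3_def \<Phi>_def by auto
    have close: "N \<alpha>' (\<Phi> (\<tau>, r) - \<Phi> (t, r)) \<le> e" if "\<tau> \<in> {t..t'}" for \<tau>
    proof -
      have "dist (\<tau>, r) (t, r) < d" using that r by (simp add: dist_Pair_Pair dist_real_def)
      then show ?thesis using d(2)[of "(\<tau>, r)" "(t, r)"] that r by (auto simp: time_triangle_def)
    qed
    have "N \<alpha>' ((V t' r \<beta> \<alpha>' (x r) - x r) - ((V t r \<beta> \<alpha>' (x r) - x r) + (t' - t) *\<^sub>R \<Phi> (t, r)))
        \<le> 0 * (t - r) + e * (t' - t)"
    proof (rule has_integral_in_split_estimate[OF n r(2,3) int int])
      show "has_integral_in (E \<alpha>') (N \<alpha>') (\<lambda>_. \<Phi> (t, r)) ((t' - t) *\<^sub>R \<Phi> (t, r)) t t'"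
        by (rule has_integral_in_const[OF n mem r(3)])
    qed (use r close in \<open>auto simp: normed_on_zero[OF n]\<close>)
    then show ?thesis by (simp add: \<Phi>_def algebra_simps)
  qed
  then show ?thesis using d(1) that by blast
qed

text \<open>The mirror image, from the backward integral equation; the integrand is frozen at the upper
time \<open>\<sigma>\<close>, so the derivative is evaluated at the right end point.\<close>

lemma V_backward_increment:
  assumes ind: "astar < \<gamma>" "\<gamma> < \<alpha>''" "\<alpha>'' < \<alpha>" and a: "0 \<le> a" and k: "k \<in> E \<alpha>" and e: "e > 0"
  obtains d where "d > 0" "\<And>s \<sigma> r. a \<le> s \<Longrightarrow> s \<le> \<sigma> \<Longrightarrow> \<sigma> \<le> r \<Longrightarrow> r \<le> b \<Longrightarrow> \<sigma> - s < d \<Longrightarrow>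
    N \<gamma> (V r s \<alpha> \<gamma> k - V r \<sigma> \<alpha> \<gamma> k - (\<sigma> - s) *\<^sub>R V r \<sigma> \<alpha>'' \<gamma> (A \<sigma> \<alpha> \<alpha>'' k)) \<le> e * (\<sigma> - s)"
proof -
  have n: "normed_on (E \<gamma>) (N \<gamma>)" and n\<alpha>: "normed_on (E \<alpha>) (N \<alpha>)" using ind by (auto intro: E_normed)
  define \<Phi> where "\<Phi> = (\<lambda>p. V (fst p) (snd p) \<alpha>'' \<gamma> (A (snd p) \<alpha> \<alpha>'' k))"
  have "cont_in (E \<alpha>) (N \<alpha>) (time_triangle a b) (\<lambda>p. k)"
    using k by (auto simp: cont_in_iff[OF n\<alpha>] normed_on_zero[OF n\<alpha>] intro: exI[of _ 1])
  then have "cont_in (E \<gamma>) (N \<gamma>) (time_triangle a b) \<Phi>"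
    unfolding \<Phi>_def using ind a
    by (intro cont_in_A_apply cont_in_V_apply) (auto simp: time_triangle_def intro!: continuous_intros)
  then obtain d where d: "d > 0" "\<And>p q. p \<in> time_triangle a b \<Longrightarrow> q \<in> time_triangle a b \<Longrightarrow> dist p q < d \<Longrightarrow>
      N \<gamma> (\<Phi> p - \<Phi> q) < e"
    by (rule cont_in_uniformly[OF n _ compact_time_triangle e]) blast
  have "N \<gamma> (V r s \<alpha> \<gamma> k - V r \<sigma> \<alpha> \<gamma> k - (\<sigma> - s) *\<^sub>R V r \<sigma> \<alpha>'' \<gamma> (A \<sigma> \<alpha> \<alpha>'' k)) \<le> e * (\<sigma> - s)"
    if r: "a \<le> s" "s \<le> \<sigma>" "\<sigma> \<le> r" "r \<le> b" "\<sigma> - s < d" for s \<sigma> r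
  proof -
    have mem: "\<Phi> (r, \<sigma>) \<in> E \<gamma>" unfolding \<Phi>_def using k r ind a by (auto intro!: A_in V_in)
    have int: "has_integral_in (E \<gamma>) (N \<gamma>) (\<lambda>\<rho>. \<Phi> (r, \<rho>)) (V r u \<alpha> \<gamma> k - k) u r" if "a \<le> u" "u \<le> r" for u
      using A3 ind a r k that unfolding condA3_def \<Phi>_def by auto
    have close: "N \<gamma> (\<Phi> (r, \<rho>) - \<Phi> (r, \<sigma>)) \<le> e" if "\<rho> \<in> {s..\<sigma>}" for \<rho>
    proof -
      have "dist (r, \<rho>) (r, \<sigma>) < d" using that r by (simp add: dist_Pair_Pair dist_real_def)
      then show ?thesis using d(2)[of "(r, \<rho>)" "(r, \<sigma>)"] that r by (auto simp: time_triangle_def)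
    qed
    have "N \<gamma> ((V r s \<alpha> \<gamma> k - k) - ((\<sigma> - s) *\<^sub>R \<Phi> (r, \<sigma>) + (V r \<sigma> \<alpha> \<gamma> k - k)))
        \<le> e * (\<sigma> - s) + 0 * (r - \<sigma>)"
    proof (rule has_integral_in_split_estimate[OF n r(2,3) int _ int])
      show "has_integral_in (E \<gamma>) (N \<gamma>) (\<lambda>_. \<Phi> (r, \<sigma>)) ((\<sigma> - s) *\<^sub>R \<Phi> (r, \<sigma>)) s \<sigma>"
        by (rule has_integral_in_const[OF n mem r(2)])
    qed (use r close in \<open>auto simp: normed_on_zero[OF n]\<close>)
    then show ?thesis by (simp add: \<Phi>_def algebra_simps)
  qed
  then show ?thesis using d(1) that by blast
qed

section \<open>Differentiating the perturbed family\<close>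

text \<open>The time interval is that of part (a), as the lifetime at \<open>\<alpha>''\<close> is the smaller of the two.
Two auxiliary indices \<open>\<alpha>' < \<gamma> < \<beta> < \<alpha>''\<close> are needed: \<open>B(r)\<close> maps into \<open>E \<beta>\<close>, \<open>V(t,r)\<close> takes the
result to \<open>E \<gamma>\<close>, and \<open>A(t)\<close> from there to \<open>E \<alpha>'\<close>.\<close>

lemma W_forward_C1:
  assumes ind: "astar < \<alpha>'" "\<alpha>' < \<alpha>''" "\<alpha>'' < \<alpha>" and k: "k \<in> E \<alpha>" and s: "0 \<le> s"
  shows "C1_with_deriv (E \<alpha>') (N \<alpha>') {t. s \<le> t \<and> ereal (t - s) < T \<alpha>'' \<alpha>} (\<lambda>t. W t s \<alpha> \<alpha>' k)
    (\<lambda>t. A t \<alpha>'' \<alpha>' (W t s \<alpha> \<alpha>'' k) + B t \<alpha>'' \<alpha>' (W t s \<alpha> \<alpha>'' k))"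
    (is "C1_with_deriv _ _ ?I ?f ?D")
proof -
  obtain \<beta> where \<beta>: "\<alpha>' < \<beta>" "\<beta> < \<alpha>''" using dense ind by blast
  obtain \<gamma> where \<gamma>: "\<alpha>' < \<gamma>" "\<gamma> < \<beta>" using dense \<beta> by blast
  have ord: "\<alpha>' < \<gamma>" "\<gamma> < \<beta>" "\<beta> < \<alpha>''" "astar < \<gamma>" "astar < \<beta>" "astar < \<alpha>''" "astar < \<alpha>" "\<alpha>' < \<beta>"
    "\<gamma> < \<alpha>''" "\<gamma> < \<alpha>" "\<beta> < \<alpha>" "\<alpha>' < \<alpha>"
    using ind \<beta> \<gamma> by auto
  note n = E_normed[OF ind(1)] and S = E_subspace[OF ind(1)]
  define x where "x t = B t \<alpha>'' \<beta> (W t s \<alpha> \<alpha>'' k)" for t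
  have TI: "ereal (t - s) < T \<gamma> \<alpha>" "ereal (t - s) < T \<alpha>' \<alpha>" if "t \<in> ?I" for t
    using that T_antimono[of \<alpha> \<gamma> \<alpha>''] T_antimono[of \<alpha> \<alpha>' \<alpha>''] ord ind by (auto intro: less_le_trans)
  have contW: "cont_in (E \<alpha>'') (N \<alpha>'') ?I (\<lambda>t. W t s \<alpha> \<alpha>'' k)"
    using ind ord k s by (intro cont_in_W_apply cont_in_const) (auto intro!: continuous_intros)
  have contD: "cont_in (E \<alpha>') (N \<alpha>') ?I ?D"
    using ind ord s by (intro cont_in_add[OF n] cont_in_A_apply cont_in_B_apply contW) (auto intro!: continuous_intros)
  have W_mem: "W t s \<alpha> \<alpha>'' k \<in> E \<alpha>''" if "t \<in> ?I" for t using that ind ord k s by (auto intro!: W_in)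
  \<comment> \<open>The shape in which the derivative comes out of the estimate below: \<open>A(t)\<close> acts from \<open>E \<gamma>\<close>, and
    \<open>x t\<close> is the contribution of the moving end point.\<close>
  have D_eq: "?D t = A t \<gamma> \<alpha>' (W t s \<alpha> \<gamma> k) + x t" if t: "t \<in> ?I" for t
  proof -
    have "W t s \<alpha> \<gamma> k = W t s \<alpha> \<alpha>'' k" using t ind ord k s by (intro W_target[symmetric]) auto
    moreover have "A t \<gamma> \<alpha>' (W t s \<alpha> \<alpha>'' k) = A t \<alpha>'' \<alpha>' (W t s \<alpha> \<alpha>'' k)"
      using W_mem[OF t] t s ind ord by (intro scale_op_source[OF A_ops]) auto
    moreover have "x t = B t \<alpha>'' \<alpha>' (W t s \<alpha> \<alpha>'' k)"
      unfolding x_def using W_mem[OF t] t s ind ord by (intro scale_op_target[OF B_ops]) auto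
    ultimately show ?thesis by simp
  qed
  have contx: "cont_in (E \<beta>) (N \<beta>) ?I x"
    unfolding x_def using ind ord s by (intro cont_in_B_apply contW) (auto intro!: continuous_intros)
  show ?thesis
  proof (rule C1_with_derivI[OF n _ contD])
    show "?f \<in> ?I \<rightarrow> E \<alpha>'" using TI ind ord k s by (auto intro!: W_in)
    fix t0 e0 :: real assume t0: "t0 \<in> ?I" and e0: "e0 > 0"
    obtain \<tau> where \<tau>: "t0 - s < \<tau>" "ereal \<tau> < T \<alpha>'' \<alpha>" using t0 ereal_dense2[of "ereal (t0 - s)"] by auto
    define b where "b = s + \<tau>"
    have b: "t0 < b" "s \<le> b" "{s..b} \<subseteq> ?I"
      using \<tau> t0 by (auto simp: b_def intro: le_less_trans[rotated])
    \<comment> \<open>The change of the integrand costs \<open>e (t - s)\<close> per unit of increment; the moving end point and the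
      term \<open>V(t,s)k\<close> cost \<open>e\<close> each.\<close>
    define e where "e = e0 / (b - s + 2)"
    have e: "e > 0" "e * (b - s + 2) = e0" using e0 b by (auto simp: e_def)
    have xb: "cont_in (E \<beta>) (N \<beta>) {s..b} x" by (rule cont_in_subset[OF contx b(3)])
    obtain d1 where d1: "d1 > 0" "\<And>r t t'. s \<le> r \<Longrightarrow> r \<le> t \<Longrightarrow> t \<le> t' \<Longrightarrow> t' \<le> b \<Longrightarrow> t' - t < d1 \<Longrightarrow>
        N \<alpha>' (V t' r \<beta> \<alpha>' (x r) - V t r \<beta> \<alpha>' (x r) - (t' - t) *\<^sub>R A t \<gamma> \<alpha>' (V t r \<beta> \<gamma> (x r))) \<le> e * (t' - t)"
      using V_forward_increment[OF ind(1) ord(1,2) s xb e(1)] by blast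
    obtain d2 where d2: "d2 > 0" "\<And>r t t'. s \<le> r \<Longrightarrow> r \<le> t \<Longrightarrow> t \<le> t' \<Longrightarrow> t' \<le> b \<Longrightarrow> t' - t < d2 \<Longrightarrow>
        N \<alpha>' (V t' r \<alpha> \<alpha>' k - V t r \<alpha> \<alpha>' k - (t' - t) *\<^sub>R A t \<gamma> \<alpha>' (V t r \<alpha> \<gamma> k)) \<le> e * (t' - t)"
      using V_forward_increment[OF ind(1) ord(1,10) s cont_in_const[OF ord(7) k] e(1)] by blast
    have "cont_in (E \<alpha>') (N \<alpha>') (time_triangle s b) (\<lambda>p. V (fst p) (snd p) \<beta> \<alpha>' (x (snd p)))"
      using ind ord s by (intro cont_in_V_apply cont_in_compose[OF xb])
        (auto simp: time_triangle_def intro!: continuous_intros)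
    then obtain d3 where d3: "d3 > 0" "\<And>p q. p \<in> time_triangle s b \<Longrightarrow> q \<in> time_triangle s b \<Longrightarrow> dist p q < d3 \<Longrightarrow>
        N \<alpha>' (V (fst p) (snd p) \<beta> \<alpha>' (x (snd p)) - V (fst q) (snd q) \<beta> \<alpha>' (x (snd q))) < e"
      by (rule cont_in_uniformly[OF n _ compact_time_triangle e(1)]) blast
    have est: "N \<alpha>' (?f t' - ?f t - (t' - t) *\<^sub>R ?D t) \<le> e0 * (t' - t)"
      if t: "s \<le> t" "t < t'" "t' \<le> b" and h: "t' - t < d1" "t' - t < d2" "2 * (t' - t) < d3" for t t'
    proof -
      define F q where "F u = W u s \<alpha> \<alpha>' k - V u s \<alpha> \<alpha>' k" and "q = W t s \<alpha> \<gamma> k - V t s \<alpha> \<gamma> k" for u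
      have tI: "t \<in> ?I" "t' \<in> ?I" by (rule subsetD[OF b(3)], use t in simp)+
      have xE: "x r \<in> E \<beta>" if "r \<in> {s..b}" for r using cont_inD(1)[OF xb E_normed[OF ord(5)] that] .
      have F_int: "has_integral_in (E \<alpha>') (N \<alpha>') (\<lambda>r. V u r \<beta> \<alpha>' (x r)) (F u) s u" if "s \<le> u" "u \<in> ?I" for u
        unfolding F_def x_def using that ind ord k s by (intro W_forward_integral) auto
      \<comment> \<open>Duhamel's formula in the smaller space \<open>E \<gamma>\<close>, so that \<open>A(t)\<close> can be applied to it.\<close>
      have q_int: "has_integral_in (E \<gamma>) (N \<gamma>) (\<lambda>r. V t r \<beta> \<gamma> (x r)) q s t"
        unfolding q_def x_def using t tI ind ord k s by (intro W_forward_integral) auto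
      have "bounded_linear_in (E \<gamma>) (N \<gamma>) (E \<alpha>') (N \<alpha>') (\<lambda>y. (t' - t) *\<^sub>R A t \<gamma> \<alpha>' y)"
        using t s ind ord n E_normed by (intro bounded_linear_in_scaleR A_linear) auto
      then have Aq_int: "has_integral_in (E \<alpha>') (N \<alpha>') (\<lambda>r. (t' - t) *\<^sub>R A t \<gamma> \<alpha>' (V t r \<beta> \<gamma> (x r)))
          ((t' - t) *\<^sub>R A t \<gamma> \<alpha>' q) s t"
        by (rule has_integral_in_bounded_linear[OF E_normed[OF ord(4)] n q_int])
      have x_mem: "x t \<in> E \<alpha>'" using xE[of t] t E_mono[OF ind(1) ord(8)] by auto
      have Vx: "V t t \<beta> \<alpha>' (x t) = x t" using xE[of t] t s ind ord by (intro V_refl) auto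
      have "N \<alpha>' (F t' - ((F t + (t' - t) *\<^sub>R A t \<gamma> \<alpha>' q) + (t' - t) *\<^sub>R x t))
          \<le> e * (t' - t) * (t - s) + e * (t' - t)"
      proof (rule has_integral_in_split_estimate[OF n t(1) less_imp_le[OF t(2)] F_int
            has_integral_in_add[OF n F_int Aq_int] has_integral_in_const[OF n x_mem]])
        show "N \<alpha>' (V t' r \<beta> \<alpha>' (x r) - (V t r \<beta> \<alpha>' (x r) + (t' - t) *\<^sub>R A t \<gamma> \<alpha>' (V t r \<beta> \<gamma> (x r)))) \<le> e * (t' - t)"
          if "r \<in> {s..t}" for r
          using d1(2)[of r t t'] that t h(1) by (simp add: diff_diff_eq)
        show "N \<alpha>' (V t' r \<beta> \<alpha>' (x r) - x t) \<le> e" if r: "r \<in> {t..t'}" for r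
        proof -
          have "dist (t', r) (t, t) \<le> \<bar>t' - t\<bar> + \<bar>r - t\<bar>"
            unfolding dist_Pair_Pair dist_real_def by (rule order_trans[OF sqrt_sum_squares_le_sum_abs]) simp
          also have "\<dots> < d3" using r h(3) by auto
          finally show ?thesis using d3(2)[of "(t', r)" "(t, t)"] r t Vx by (auto simp: time_triangle_def)
        qed
      qed (use t tI in auto)
      moreover have "N \<alpha>' (V t' s \<alpha> \<alpha>' k - V t s \<alpha> \<alpha>' k - (t' - t) *\<^sub>R A t \<gamma> \<alpha>' (V t s \<alpha> \<gamma> k)) \<le> e * (t' - t)"
        using d2(2)[of s t t'] t h(2) by auto
      moreover have "?f t' - ?f t - (t' - t) *\<^sub>R ?D t =
          (F t' - ((F t + (t' - t) *\<^sub>R A t \<gamma> \<alpha>' q) + (t' - t) *\<^sub>R x t)) +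
          (V t' s \<alpha> \<alpha>' k - V t s \<alpha> \<alpha>' k - (t' - t) *\<^sub>R A t \<gamma> \<alpha>' (V t s \<alpha> \<gamma> k))"
      proof -
        have "A t \<gamma> \<alpha>' q = A t \<gamma> \<alpha>' (W t s \<alpha> \<gamma> k) - A t \<gamma> \<alpha>' (V t s \<alpha> \<gamma> k)"
          unfolding q_def using t tI TI ind ord k s
          by (intro bounded_linear_in_diff[OF A_linear E_subspace] W_in V_in) auto
        then have AW: "A t \<gamma> \<alpha>' (W t s \<alpha> \<gamma> k) = A t \<gamma> \<alpha>' q + A t \<gamma> \<alpha>' (V t s \<alpha> \<gamma> k)" by simp
        show ?thesis unfolding D_eq[OF tI(1)] F_def AW by (simp add: algebra_simps)
      qed
      moreover have "F t' - ((F t + (t' - t) *\<^sub>R A t \<gamma> \<alpha>' q) + (t' - t) *\<^sub>R x t) \<in> E \<alpha>'"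
        using has_integral_in_D(2)[OF F_int] has_integral_in_D(2)[OF Aq_int] x_mem t tI
        by (auto intro!: subspace_diff[OF S] subspace_add[OF S] subspace_scale[OF S])
      moreover have "V t' s \<alpha> \<alpha>' k - V t s \<alpha> \<alpha>' k - (t' - t) *\<^sub>R A t \<gamma> \<alpha>' (V t s \<alpha> \<gamma> k) \<in> E \<alpha>'"
        using t ind ord k s by (auto intro!: subspace_diff[OF S] subspace_scale[OF S] A_in V_in)
      ultimately have "N \<alpha>' (?f t' - ?f t - (t' - t) *\<^sub>R ?D t)
          \<le> (e * (t' - t) * (t - s) + e * (t' - t)) + e * (t' - t)"
        by (metis normed_on_le_add[OF n])
      also have "\<dots> = e * (t - s + 2) * (t' - t)" by (simp add: algebra_simps)
      also have "\<dots> \<le> e * (b - s + 2) * (t' - t)"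
        using e t by (intro mult_right_mono mult_left_mono) auto
      finally show ?thesis using e(2) by simp
    qed
    show "\<exists>d>0. \<forall>x\<in>?I. \<forall>y\<in>?I. \<bar>x - t0\<bar> < d \<longrightarrow> \<bar>y - t0\<bar> < d \<longrightarrow> x < y \<longrightarrow>
        (\<exists>w\<in>{x, y}. N \<alpha>' (?f y - ?f x - (y - x) *\<^sub>R ?D w) \<le> e0 * (y - x))"
    proof -
      define d where "d = Min {d1/2, d2/2, d3/4, b - t0}"
      have d: "0 < d" "2 * d \<le> d1" "2 * d \<le> d2" "4 * d \<le> d3" "d \<le> b - t0"
        using d1 d2 d3 b by (auto simp: d_def min_def)
      have "N \<alpha>' (?f t' - ?f t - (t' - t) *\<^sub>R ?D t) \<le> e0 * (t' - t)"
        if t: "t \<in> ?I" "\<bar>t - t0\<bar> < d" "\<bar>t' - t0\<bar> < d" "t < t'" for t t'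
      proof (rule est)
        have "t' - t < 2 * d" using t(2,3) by linarith
        then show "t' - t < d1" "t' - t < d2" "2 * (t' - t) < d3" using d by auto
        show "t' \<le> b" using t(3) d(5) by linarith
      qed (use t in auto)
      then show ?thesis using d(1) by blast
    qed
  qed
qed

text \<open>Here \<open>A(s)k\<close> and hence the correction term start in \<open>E \<alpha>''\<close>; \<open>V(r,s)\<close> takes it to \<open>E \<gamma>\<close>,
\<open>B(r)\<close> to \<open>E \<beta>\<close> and \<open>W(t,r)\<close> to \<open>E \<alpha>'\<close>, where \<open>\<alpha>' < \<beta> < \<gamma> < \<alpha>''\<close> and \<open>\<beta>\<close> is so close to \<open>\<alpha>''\<close>
that \<open>W(t,r)\<close> is still alive on \<open>E \<beta>\<close>.\<close>

lemma W_backward_C1: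
  assumes ind: "astar < \<alpha>'" "\<alpha>' < \<alpha>''" "\<alpha>'' < \<alpha>" and k: "k \<in> E \<alpha>" and t: "0 \<le> t"
  shows "C1_with_deriv (E \<alpha>') (N \<alpha>') {s. 0 \<le> s \<and> s \<le> t \<and> ereal (t - s) < min (T \<alpha>' \<alpha>) (T \<alpha>' \<alpha>'')}
    (\<lambda>s. W t s \<alpha> \<alpha>' k) (\<lambda>s. - W t s \<alpha>'' \<alpha>' (A s \<alpha> \<alpha>'' k + B s \<alpha> \<alpha>'' k))"
    (is "C1_with_deriv _ _ ?J ?f ?D")
proof -
  have ord: "astar < \<alpha>''" "astar < \<alpha>" "\<alpha>' < \<alpha>" using ind by auto
  note n = E_normed[OF ind(1)] and S = E_subspace[OF ind(1)]
  have AB_mem: "A s \<alpha> \<alpha>'' k \<in> E \<alpha>''" "B s \<alpha> \<alpha>'' k \<in> E \<alpha>''" if "0 \<le> s" for s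
    using that ind ord k by (auto intro: A_in B_in)
  have "cont_in (E \<alpha>') (N \<alpha>') ?J (\<lambda>s. W t s \<alpha>'' \<alpha>' (A s \<alpha> \<alpha>'' k + B s \<alpha> \<alpha>'' k))"
    using ind ord k t
    by (intro cont_in_W_apply cont_in_add cont_in_A_apply cont_in_B_apply cont_in_const E_normed)
      (auto intro!: continuous_intros)
  from cont_in_scaleR[OF n this, of "-1"] have contD: "cont_in (E \<alpha>') (N \<alpha>') ?J ?D" by simp
  show ?thesis
  proof (rule C1_with_derivI[OF n _ contD])
    show "?f \<in> ?J \<rightarrow> E \<alpha>'" using ind ord k t by (auto intro!: W_in)
    fix s0 e0 :: real assume s0: "s0 \<in> ?J" and e0: "e0 > 0"
    obtain \<tau> where \<tau>: "t - s0 < \<tau>" "ereal \<tau> < min (T \<alpha>' \<alpha>) (T \<alpha>' \<alpha>'')"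
      using s0 ereal_dense2[of "ereal (t - s0)" "min (T \<alpha>' \<alpha>) (T \<alpha>' \<alpha>'')"] by auto
    \<comment> \<open>\<open>{a..t}\<close> is a neighbourhood of \<open>s0\<close> in the time interval on which \<open>t - s\<close> stays below
      both lifetimes.\<close>
    define a where "a = max 0 (t - \<tau>)"
    have a: "0 \<le> a" "a \<le> t" "t - a \<le> \<tau>" using \<tau> s0 t by (auto simp: a_def)
    have T_a: "ereal (t - s) < T \<alpha>' \<alpha>" "ereal (t - s) < T \<alpha>' \<alpha>''" if "a \<le> s" for s
      using that a \<tau>(2) by (auto intro: le_less_trans[rotated])
    obtain \<beta> where \<beta>: "\<alpha>' < \<beta>" "\<beta> < \<alpha>''" "ereal (t - a) < T \<alpha>' \<beta>"
    proof (rule lifetime_shrink_start[OF K_pos _ _ ind(2) _ T_a(2)[OF order_refl]])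
      show "0 \<le> M \<delta>" if "\<alpha>' < \<delta>" for \<delta> using that ind by (auto intro: M_nonneg)
      show "M \<delta> \<le> M \<alpha>''" if "\<alpha>' < \<delta>" "\<delta> < \<alpha>''" for \<delta> using that ind by (auto intro: M_mono)
    qed (use a in auto)
    obtain \<gamma> where \<gamma>: "\<beta> < \<gamma>" "\<gamma> < \<alpha>''" using dense \<beta> by blast
    have ord2: "astar < \<beta>" "astar < \<gamma>" "\<beta> < \<alpha>" "\<gamma> < \<alpha>" using ind \<beta> \<gamma> by auto
    have T_\<beta>: "ereal (t - s) < T \<alpha>' \<beta>" if "a \<le> s" for s
      using that \<beta>(3) by (auto intro: le_less_trans[rotated])
    obtain C1 where C1: "0 \<le> C1" "\<And>r y. a \<le> r \<Longrightarrow> r \<le> t \<Longrightarrow> y \<in> E \<beta> \<Longrightarrow> N \<alpha>' (W t r \<beta> \<alpha>' y) \<le> C1 * N \<beta> y"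
    proof (rule W_bound[OF ind(1) \<beta>(1,3)])
      show "0 \<le> t - a" using a by simp
      fix C assume "0 \<le> C" "\<And>s t' k. 0 \<le> s \<Longrightarrow> s \<le> t' \<Longrightarrow> t' - s \<le> t - a \<Longrightarrow> k \<in> E \<beta> \<Longrightarrow>
        N \<alpha>' (W t' s \<beta> \<alpha>' k) \<le> C * N \<beta> k"
      then show ?thesis using that[of C] a by auto
    qed
    define C where "C = C1 * (M \<gamma> / (\<gamma> - \<beta>))"
    have C: "0 \<le> C" unfolding C_def using C1(1) M_nonneg[OF ord2(2)] \<gamma> by auto
    \<comment> \<open>As in the forward case, with the change of the integrand amplified by \<open>C\<close>, a bound for
      \<open>W(t,r)B(r)\<close>.\<close>
    define e where "e = e0 / (2 + C * (t - a))"
    have den: "0 < 2 + C * (t - a)" using C a by (simp add: add_pos_nonneg)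
    have e: "e > 0" "e * (2 + C * (t - a)) = e0" using e0 den by (auto simp: e_def)
    \<comment> \<open>\<open>W(t,r)B(r)\<close> as a bounded operator from \<open>E \<gamma>\<close> to \<open>E \<alpha>'\<close>, uniformly in \<open>r\<close>; through it an
      increment of \<open>V(r,s)k\<close> enters the integrand.\<close>
    define \<Psi> where "\<Psi> r y = W t r \<beta> \<alpha>' (B r \<gamma> \<beta> y)" for r y
    have \<Psi>_lin: "\<Psi> r (y - z) = \<Psi> r y - \<Psi> r z" "\<Psi> r (c *\<^sub>R y) = c *\<^sub>R \<Psi> r y" "\<Psi> r y \<in> E \<alpha>'"
      "N \<alpha>' (\<Psi> r y) \<le> C * N \<gamma> y"
      if r: "a \<le> r" "r \<le> t" and y: "y \<in> E \<gamma>" "z \<in> E \<gamma>" for r y z c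
    proof -
      have r0: "0 \<le> r" using r a by simp
      note BL = B_linear[OF r0 ord2(1) \<gamma>(1)] and WL = W_linear[OF ind(1) \<beta>(1) r0 r(2) T_\<beta>[OF r(1)]]
      note Bin = bounded_linear_inD(1)[OF BL]
      show "\<Psi> r (y - z) = \<Psi> r y - \<Psi> r z"
        unfolding \<Psi>_def using y ord2 Bin
        by (simp add: bounded_linear_in_diff[OF BL E_subspace] bounded_linear_in_diff[OF WL E_subspace])
      show "\<Psi> r (c *\<^sub>R y) = c *\<^sub>R \<Psi> r y"
        unfolding \<Psi>_def using y Bin by (simp add: bounded_linear_inD(3)[OF BL] bounded_linear_inD(3)[OF WL])
      show "\<Psi> r y \<in> E \<alpha>'" unfolding \<Psi>_def by (intro bounded_linear_inD(1)[OF WL] Bin y)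
      have "N \<alpha>' (\<Psi> r y) \<le> C1 * N \<beta> (B r \<gamma> \<beta> y)"
        unfolding \<Psi>_def using C1(2)[OF r Bin[OF y(1)]] .
      also have "\<dots> \<le> C1 * (M \<gamma> / (\<gamma> - \<beta>) * N \<gamma> y)"
        using B_bound[OF ord2(1) \<gamma>(1) r0 y(1)] C1(1) by (rule mult_left_mono)
      finally show "N \<alpha>' (\<Psi> r y) \<le> C * N \<gamma> y" by (simp add: C_def)
    qed
    obtain d1 where d1: "d1 > 0" "\<And>s \<sigma> r. a \<le> s \<Longrightarrow> s \<le> \<sigma> \<Longrightarrow> \<sigma> \<le> r \<Longrightarrow> r \<le> t \<Longrightarrow> \<sigma> - s < d1 \<Longrightarrow>
        N \<gamma> (V r s \<alpha> \<gamma> k - V r \<sigma> \<alpha> \<gamma> k - (\<sigma> - s) *\<^sub>R V r \<sigma> \<alpha>'' \<gamma> (A \<sigma> \<alpha> \<alpha>'' k)) \<le> e * (\<sigma> - s)"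
      using V_backward_increment[OF ord2(2) \<gamma>(2) ind(3) a(1) k e(1)] by blast
    obtain d2 where d2: "d2 > 0" "\<And>s \<sigma> r. a \<le> s \<Longrightarrow> s \<le> \<sigma> \<Longrightarrow> \<sigma> \<le> r \<Longrightarrow> r \<le> t \<Longrightarrow> \<sigma> - s < d2 \<Longrightarrow>
        N \<alpha>' (V r s \<alpha> \<alpha>' k - V r \<sigma> \<alpha> \<alpha>' k - (\<sigma> - s) *\<^sub>R V r \<sigma> \<alpha>'' \<alpha>' (A \<sigma> \<alpha> \<alpha>'' k)) \<le> e * (\<sigma> - s)"
      using V_backward_increment[OF ind a(1) k e(1)] by blast
    have "cont_in (E \<alpha>') (N \<alpha>') (time_triangle a t) (\<lambda>p. \<Psi> (fst p) (V (fst p) (snd p) \<alpha> \<gamma> k))"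
      unfolding \<Psi>_def using ind ord ord2 \<beta> \<gamma> k a T_\<beta>
      by (intro cont_in_W_apply cont_in_B_apply cont_in_V_apply cont_in_const)
        (auto simp: time_triangle_def intro!: continuous_intros)
    then obtain d3 where d3: "d3 > 0" "\<And>p q. p \<in> time_triangle a t \<Longrightarrow> q \<in> time_triangle a t \<Longrightarrow> dist p q < d3 \<Longrightarrow>
        N \<alpha>' (\<Psi> (fst p) (V (fst p) (snd p) \<alpha> \<gamma> k) - \<Psi> (fst q) (V (fst q) (snd q) \<alpha> \<gamma> k)) < e"
      by (rule cont_in_uniformly[OF n _ compact_time_triangle e(1)]) blast
    have est: "N \<alpha>' (?f \<sigma> - ?f s - (\<sigma> - s) *\<^sub>R ?D \<sigma>) \<le> e0 * (\<sigma> - s)"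
      if s: "a \<le> s" "s < \<sigma>" "\<sigma> \<le> t" and h: "\<sigma> - s < d1" "\<sigma> - s < d2" "2 * (\<sigma> - s) < d3" for s \<sigma>
    proof -
      have \<sigma>0: "0 \<le> \<sigma>" "a \<le> \<sigma>" using s a by auto
      define z where "z = A \<sigma> \<alpha> \<alpha>'' k"
      have z: "z \<in> E \<alpha>''" unfolding z_def by (rule AB_mem[OF \<sigma>0(1)])
      define G q where "G u = W t u \<alpha> \<alpha>' k - V t u \<alpha> \<alpha>' k" and "q = W t \<sigma> \<alpha>'' \<alpha>' z - V t \<sigma> \<alpha>'' \<alpha>' z" for u
      have G_int: "has_integral_in (E \<alpha>') (N \<alpha>') (\<lambda>r. \<Psi> r (V r u \<alpha> \<gamma> k)) (G u) u t" if "a \<le> u" "u \<le> t" for u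
        unfolding G_def \<Psi>_def using that a ind \<beta> \<gamma> ord2 k T_a T_\<beta> by (intro W_backward_integral) auto
      have q_int: "has_integral_in (E \<alpha>') (N \<alpha>') (\<lambda>r. \<Psi> r (V r \<sigma> \<alpha>'' \<gamma> z)) q \<sigma> t"
        unfolding q_def \<Psi>_def using \<sigma>0 s ind \<beta> \<gamma> z T_a T_\<beta> by (intro W_backward_integral) auto
      \<comment> \<open>The first-order correction of the integrand, with its integral given by Duhamel's formula for
        \<open>z\<close>.\<close>
      have hq_int: "has_integral_in (E \<alpha>') (N \<alpha>') (\<lambda>r. (\<sigma> - s) *\<^sub>R \<Psi> r (V r \<sigma> \<alpha>'' \<gamma> z)) ((\<sigma> - s) *\<^sub>R q) \<sigma> t"
        by (rule has_integral_in_bounded_linear[OF n n q_int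
              bounded_linear_in_scaleR[OF bounded_linear_in_id[OF n] n n]])
      have kE: "k \<in> E \<gamma>" using E_mono[OF ord2(2,4) k] .
      have x_mem: "\<Psi> \<sigma> k \<in> E \<alpha>'" using \<Psi>_lin(3)[OF \<sigma>0(2) s(3) kE kE] .
      have Vk: "V \<sigma> \<sigma> \<alpha> \<gamma> k = k" using \<sigma>0 k ord2 by (intro V_refl)
      have V_mem: "V r u \<alpha> \<gamma> k \<in> E \<gamma>" if "a \<le> u" "u \<le> r" for u r using that a ord2 k by (intro V_in) auto
      have V_mem2: "V r \<sigma> \<alpha>'' \<gamma> z \<in> E \<gamma>" if "\<sigma> \<le> r" for r using that \<sigma>0 ord2 \<gamma> z by (intro V_in) auto
      have "N \<alpha>' (G s - ((\<sigma> - s) *\<^sub>R \<Psi> \<sigma> k + (G \<sigma> + (\<sigma> - s) *\<^sub>R q)))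
          \<le> e * (\<sigma> - s) + C * (e * (\<sigma> - s)) * (t - \<sigma>)"
      proof (rule has_integral_in_split_estimate[OF n less_imp_le[OF s(2)] s(3) G_int
            has_integral_in_const[OF n x_mem] has_integral_in_add[OF n G_int hq_int]])
        show "N \<alpha>' (\<Psi> r (V r s \<alpha> \<gamma> k) - \<Psi> \<sigma> k) \<le> e" if r: "r \<in> {s..\<sigma>}" for r
        proof -
          have "dist (r, s) (\<sigma>, \<sigma>) \<le> \<bar>r - \<sigma>\<bar> + \<bar>s - \<sigma>\<bar>"
            unfolding dist_Pair_Pair dist_real_def by (rule order_trans[OF sqrt_sum_squares_le_sum_abs]) simp
          also have "\<dots> < d3" using r h(3) by auto
          finally show ?thesis using d3(2)[of "(r, s)" "(\<sigma>, \<sigma>)"] r s \<sigma>0 Vk by (auto simp: time_triangle_def)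
        qed
        show "N \<alpha>' (\<Psi> r (V r s \<alpha> \<gamma> k) - (\<Psi> r (V r \<sigma> \<alpha> \<gamma> k) + (\<sigma> - s) *\<^sub>R \<Psi> r (V r \<sigma> \<alpha>'' \<gamma> z)))
            \<le> C * (e * (\<sigma> - s))" if r: "r \<in> {\<sigma>..t}" for r
        proof -
          have rt: "a \<le> r" "r \<le> t" "\<sigma> \<le> r" "s \<le> r" using r \<sigma>0 s by auto
          note m1 = V_mem[OF s(1) rt(4)] and m2 = V_mem[OF \<sigma>0(2) rt(3)] and m3 = V_mem2[OF rt(3)]
          note S\<gamma> = E_subspace[OF ord2(2)]
          let ?w = "V r s \<alpha> \<gamma> k - V r \<sigma> \<alpha> \<gamma> k - (\<sigma> - s) *\<^sub>R V r \<sigma> \<alpha>'' \<gamma> z"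
          have m4: "V r s \<alpha> \<gamma> k - V r \<sigma> \<alpha> \<gamma> k \<in> E \<gamma>" "(\<sigma> - s) *\<^sub>R V r \<sigma> \<alpha>'' \<gamma> z \<in> E \<gamma>" "?w \<in> E \<gamma>"
            using m1 m2 m3 by (auto intro!: subspace_diff[OF S\<gamma>] subspace_scale[OF S\<gamma>])
          have "\<Psi> r ?w = \<Psi> r (V r s \<alpha> \<gamma> k) - (\<Psi> r (V r \<sigma> \<alpha> \<gamma> k) + (\<sigma> - s) *\<^sub>R \<Psi> r (V r \<sigma> \<alpha>'' \<gamma> z))"
            using \<Psi>_lin(1)[OF rt(1,2) m4(1,2)] \<Psi>_lin(1)[OF rt(1,2) m1 m2] \<Psi>_lin(2)[OF rt(1,2) m3 m3]
            by (simp add: diff_diff_eq)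
          moreover have "N \<alpha>' (\<Psi> r ?w) \<le> C * N \<gamma> ?w" by (rule \<Psi>_lin(4)[OF rt(1,2) m4(3,3)])
          moreover have "C * N \<gamma> ?w \<le> C * (e * (\<sigma> - s))"
            unfolding z_def using d1(2)[of s \<sigma> r] s rt h(1) C by (intro mult_left_mono) auto
          ultimately show ?thesis by simp
        qed
      qed (use s \<sigma>0 in auto)
      moreover have "N \<alpha>' (V t s \<alpha> \<alpha>' k - V t \<sigma> \<alpha> \<alpha>' k - (\<sigma> - s) *\<^sub>R V t \<sigma> \<alpha>'' \<alpha>' z) \<le> e * (\<sigma> - s)"
        unfolding z_def using d2(2)[of s \<sigma> t] s h(2) by auto
      moreover have "- (?f \<sigma> - ?f s - (\<sigma> - s) *\<^sub>R ?D \<sigma>) =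
          (G s - ((\<sigma> - s) *\<^sub>R \<Psi> \<sigma> k + (G \<sigma> + (\<sigma> - s) *\<^sub>R q))) +
          (V t s \<alpha> \<alpha>' k - V t \<sigma> \<alpha> \<alpha>' k - (\<sigma> - s) *\<^sub>R V t \<sigma> \<alpha>'' \<alpha>' z)"
      proof -
        have "W t \<sigma> \<alpha>'' \<alpha>' (A \<sigma> \<alpha> \<alpha>'' k + B \<sigma> \<alpha> \<alpha>'' k) = W t \<sigma> \<alpha>'' \<alpha>' z + W t \<sigma> \<alpha>'' \<alpha>' (B \<sigma> \<alpha> \<alpha>'' k)"
          unfolding z_def
          by (rule bounded_linear_inD(2)[OF W_linear[OF ind(1,2) \<sigma>0(1) s(3) T_a(2)[OF \<sigma>0(2)]] AB_mem[OF \<sigma>0(1)]])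
        moreover have "W t \<sigma> \<alpha>'' \<alpha>' (B \<sigma> \<alpha> \<alpha>'' k) = \<Psi> \<sigma> k"
        proof -
          have "B \<sigma> \<gamma> \<beta> k = B \<sigma> \<alpha> \<beta> k" "B \<sigma> \<alpha> \<alpha>'' k = B \<sigma> \<alpha> \<beta> k"
            using scale_op_source[OF B_ops[OF \<sigma>0(1)] ord2(1) \<gamma>(1) ord2(4) k]
              scale_op_target[OF B_ops[OF \<sigma>0(1)] ord2(1) \<beta>(2) ind(3) k] by auto
          moreover have "W t \<sigma> \<beta> \<alpha>' (B \<sigma> \<alpha> \<alpha>'' k) = W t \<sigma> \<alpha>'' \<alpha>' (B \<sigma> \<alpha> \<alpha>'' k)"
            by (rule W_source[OF ind(1) \<beta>(1,2) \<sigma>0(1) s(3) AB_mem(2)[OF \<sigma>0(1)] T_a(2)[OF \<sigma>0(2)] T_\<beta>[OF \<sigma>0(2)]])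
          ultimately show ?thesis by (simp add: \<Psi>_def)
        qed
        ultimately show ?thesis unfolding G_def q_def by (simp add: algebra_simps)
      qed
      moreover have "G s - ((\<sigma> - s) *\<^sub>R \<Psi> \<sigma> k + (G \<sigma> + (\<sigma> - s) *\<^sub>R q)) \<in> E \<alpha>'"
        using has_integral_in_D(2)[OF G_int] has_integral_in_D(2)[OF q_int] x_mem s \<sigma>0
        by (auto intro!: subspace_diff[OF S] subspace_add[OF S] subspace_scale[OF S])
      moreover have "V t s \<alpha> \<alpha>' k - V t \<sigma> \<alpha> \<alpha>' k - (\<sigma> - s) *\<^sub>R V t \<sigma> \<alpha>'' \<alpha>' z \<in> E \<alpha>'"
        using s \<sigma>0 a ind ord k z by (auto intro!: subspace_diff[OF S] subspace_scale[OF S] V_in)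
      ultimately have "N \<alpha>' (- (?f \<sigma> - ?f s - (\<sigma> - s) *\<^sub>R ?D \<sigma>))
          \<le> (e * (\<sigma> - s) + C * (e * (\<sigma> - s)) * (t - \<sigma>)) + e * (\<sigma> - s)"
        by (metis normed_on_le_add[OF n])
      also have "\<dots> = e * (2 + C * (t - \<sigma>)) * (\<sigma> - s)" by (simp add: algebra_simps)
      also have "\<dots> \<le> e * (2 + C * (t - a)) * (\<sigma> - s)"
        using e C s by (intro mult_right_mono mult_left_mono add_left_mono) auto
      finally have "N \<alpha>' (- (?f \<sigma> - ?f s - (\<sigma> - s) *\<^sub>R ?D \<sigma>)) \<le> e0 * (\<sigma> - s)" using e(2) by simp
      moreover have "?f \<sigma> - ?f s - (\<sigma> - s) *\<^sub>R ?D \<sigma> \<in> E \<alpha>'"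
        using s \<sigma>0 a ind ord k T_a AB_mem
        by (intro subspace_diff[OF S] subspace_scale[OF S] subspace_neg[OF S] W_in subspace_add[OF E_subspace]) auto
      ultimately show ?thesis using normed_on_minus[OF n] by metis
    qed
    show "\<exists>d>0. \<forall>x\<in>?J. \<forall>y\<in>?J. \<bar>x - s0\<bar> < d \<longrightarrow> \<bar>y - s0\<bar> < d \<longrightarrow> x < y \<longrightarrow>
        (\<exists>w\<in>{x, y}. N \<alpha>' (?f y - ?f x - (y - x) *\<^sub>R ?D w) \<le> e0 * (y - x))"
    proof -
      define d where "d = Min {d1/2, d2/2, d3/4, \<tau> - (t - s0)}"
      have d: "0 < d" "2 * d \<le> d1" "2 * d \<le> d2" "4 * d \<le> d3" "d \<le> \<tau> - (t - s0)"
        using d1 d2 d3 \<tau> by (auto simp: d_def min_def)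
      have "N \<alpha>' (?f \<sigma> - ?f s - (\<sigma> - s) *\<^sub>R ?D \<sigma>) \<le> e0 * (\<sigma> - s)"
        if s: "s \<in> ?J" "\<sigma> \<in> ?J" "\<bar>s - s0\<bar> < d" "\<bar>\<sigma> - s0\<bar> < d" "s < \<sigma>" for s \<sigma>
      proof (rule est)
        have "t - \<tau> \<le> s" "0 \<le> s" using s(1,3) d(5) by auto
        then show "a \<le> s" by (simp add: a_def)
        have "\<sigma> - s < 2 * d" using s(3,4) by linarith
        then show "\<sigma> - s < d1" "\<sigma> - s < d2" "2 * (\<sigma> - s) < d3" using d by auto
      qed (use s in auto)
      then show ?thesis using d(1) by blast
    qed
  qed
qed

section \<open>Uniqueness of forward solutions\<close>

text \<open>The function \<open>g r = W(t,r)v(r)\<close> into \<open>E \<gamma>\<close> has vanishing derivative. Its increment is split into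
\<open>W(t,y)\<close> applied to the first-order error of \<open>v\<close>, the change of \<open>W(t,\<cdot>)\<close> on the fixed vector
\<open>D = v'(x)\<close>, and the first-order error of \<open>W(t,\<cdot>)v(x)\<close>, whose derivative is \<open>- W(t,x)D\<close> by
\<open>W_backward_C1\<close>.\<close>

lemma homogeneous_step:
  assumes ind: "astar < \<gamma>" "\<gamma> < \<beta>" "\<beta> < \<alpha>'"
    and v: "\<And>r. r \<in> {r0..t} \<Longrightarrow> v r \<in> E \<alpha>'"
    and deriv: "\<And>r e. r \<in> {r0..t} \<Longrightarrow> e > 0 \<Longrightarrow> \<exists>d>0. \<forall>y\<in>{r0..t}. \<bar>y - r\<bar> < d \<longrightarrow>
      N \<beta> (v y - v r - (y - r) *\<^sub>R (A r \<alpha>' \<beta> (v r) + B r \<alpha>' \<beta> (v r))) \<le> e * \<bar>y - r\<bar>"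
    and r0: "0 \<le> r0" "r0 \<le> t" and zero: "v r0 = 0"
    and T: "ereal (t - r0) < min (T \<gamma> \<alpha>') (T \<gamma> \<beta>)"
  shows "v t = 0"
proof -
  have ord: "astar < \<beta>" "astar < \<alpha>'" "\<gamma> < \<alpha>'" using ind by auto
  note n = E_normed[OF ind(1)] and S = E_subspace[OF ind(1)] and S\<beta> = E_subspace[OF ord(1)]
  define g where "g r = W t r \<beta> \<gamma> (v r)" for r
  have T': "ereal (t - r) < T \<gamma> \<alpha>'" "ereal (t - r) < T \<gamma> \<beta>" if "r0 \<le> r" for r
    using that T by (auto intro: le_less_trans[rotated])
  have WL: "bounded_linear_in (E \<beta>) (N \<beta>) (E \<gamma>) (N \<gamma>) (W t r \<beta> \<gamma>)" if "r \<in> {r0..t}" for r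
    using that r0 T' ind by (intro W_linear) auto
  note Win = bounded_linear_inD(1)[OF WL]
  have v\<beta>: "v r \<in> E \<beta>" if "r \<in> {r0..t}" for r using E_mono[OF ord(1) ind(3) v[OF that]] .
  have "g t = g r0"
  proof (rule constant_if_locally_small_increments[OF n r0(2)])
    show "g \<in> {r0..t} \<rightarrow> E \<gamma>" unfolding g_def using Win v\<beta> by auto
    fix x e :: real assume x: "x \<in> {r0..t}" and e: "e > 0"
    define D where "D = A x \<alpha>' \<beta> (v x) + B x \<alpha>' \<beta> (v x)"
    have D: "D \<in> E \<beta>" unfolding D_def using x r0 ind ord v by (intro subspace_add[OF S\<beta>] A_in B_in) auto
    obtain C where C: "0 \<le> C" "\<And>r y. r \<in> {r0..t} \<Longrightarrow> y \<in> E \<beta> \<Longrightarrow> N \<gamma> (W t r \<beta> \<gamma> y) \<le> C * N \<beta> y"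
    proof (rule W_bound[OF ind(1,2) T'(2)[OF order_refl]])
      show "0 \<le> t - r0" using r0 by simp
      fix C assume "0 \<le> C" "\<And>s t' k. 0 \<le> s \<Longrightarrow> s \<le> t' \<Longrightarrow> t' - s \<le> t - r0 \<Longrightarrow> k \<in> E \<beta> \<Longrightarrow>
        N \<gamma> (W t' s \<beta> \<gamma> k) \<le> C * N \<beta> k"
      then show ?thesis using that[of C] r0 by auto
    qed
    obtain d1 where d1: "d1 > 0" "\<And>y. y \<in> {r0..t} \<Longrightarrow> \<bar>y - x\<bar> < d1 \<Longrightarrow>
        N \<beta> (v y - v x - (y - x) *\<^sub>R D) \<le> e / 3 / (C + 1) * \<bar>y - x\<bar>"
      using deriv[OF x, of "e / 3 / (C + 1)"] e C(1) unfolding D_def by auto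
    have "cont_in (E \<gamma>) (N \<gamma>) {r0..t} (\<lambda>y. W t y \<beta> \<gamma> D)"
      using ind ord r0 D T' by (intro cont_in_W_apply cont_in_const) (auto intro!: continuous_intros)
    from cont_inD(2)[OF this n x, of "e / 3"] e
    obtain d2 where d2: "d2 > 0" "\<And>y. y \<in> {r0..t} \<Longrightarrow> \<bar>y - x\<bar> < d2 \<Longrightarrow>
        N \<gamma> (W t y \<beta> \<gamma> D - W t x \<beta> \<gamma> D) < e / 3"
      unfolding dist_real_def by auto
    let ?J = "{s. 0 \<le> s \<and> s \<le> t \<and> ereal (t - s) < min (T \<gamma> \<alpha>') (T \<gamma> \<beta>)}"
    have J: "y \<in> ?J" if "y \<in> {r0..t}" for y using that T' r0 by auto
    have "C1_with_deriv (E \<gamma>) (N \<gamma>) ?J (\<lambda>s. W t s \<alpha>' \<gamma> (v x))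
        (\<lambda>s. - W t s \<beta> \<gamma> (A s \<alpha>' \<beta> (v x) + B s \<alpha>' \<beta> (v x)))"
      using r0 by (intro W_backward_C1[OF ind v[OF x]]) simp
    then have "(\<lambda>s. W t s \<alpha>' \<gamma> (v x)) \<in> ?J \<rightarrow> E \<gamma>"
      "has_deriv_in (E \<gamma>) (N \<gamma>) (\<lambda>s. W t s \<alpha>' \<gamma> (v x)) (- W t x \<beta> \<gamma> D) x ?J"
      using J[OF x] unfolding C1_with_deriv_def D_def by blast+
    moreover have "0 < e / 3" using e by simp
    ultimately obtain d3 where d3: "d3 > 0" "\<And>y. y \<in> ?J \<Longrightarrow> \<bar>y - x\<bar> < d3 \<Longrightarrow>
        N \<gamma> (W t y \<alpha>' \<gamma> (v x) - W t x \<alpha>' \<gamma> (v x) - (y - x) *\<^sub>R (- W t x \<beta> \<gamma> D)) \<le> e / 3 * \<bar>y - x\<bar>"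
      using has_deriv_inD(2)[OF _ n _ J[OF x]] by blast
    have W_eq: "W t y \<beta> \<gamma> (v x) = W t y \<alpha>' \<gamma> (v x)" if "y \<in> {r0..t}" for y
      using that ind r0 T' v[OF x] by (intro W_source) auto
    show "\<exists>d>0. \<forall>y\<in>{r0..t}. \<bar>y - x\<bar> < d \<longrightarrow> N \<gamma> (g y - g x) \<le> e * \<bar>y - x\<bar>"
    proof (intro exI[of _ "Min {d1, d2, d3}"] conjI ballI impI)
      fix y assume y: "y \<in> {r0..t}" and d: "\<bar>y - x\<bar> < Min {d1, d2, d3}"
      let ?w = "v y - v x - (y - x) *\<^sub>R D"
      have w: "v y - v x \<in> E \<beta>" "(y - x) *\<^sub>R D \<in> E \<beta>" "?w \<in> E \<beta>"
        using v\<beta>[OF x] v\<beta>[OF y] D by (auto intro!: subspace_diff[OF S\<beta>] subspace_scale[OF S\<beta>])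
      define a1 a2 a3 where "a1 = W t y \<beta> \<gamma> ?w" and "a2 = (y - x) *\<^sub>R (W t y \<beta> \<gamma> D - W t x \<beta> \<gamma> D)"
        and "a3 = W t y \<beta> \<gamma> (v x) - W t x \<beta> \<gamma> (v x) - (y - x) *\<^sub>R (- W t x \<beta> \<gamma> D)"
      have mem: "a1 \<in> E \<gamma>" "a2 \<in> E \<gamma>" "a3 \<in> E \<gamma>" "a1 + a2 \<in> E \<gamma>"
        unfolding a1_def a2_def a3_def using x y w D v\<beta>
        by (auto intro!: subspace_diff[OF S] subspace_scale[OF S] subspace_add[OF S] subspace_neg[OF S] Win)
      have "a1 = W t y \<beta> \<gamma> (v y) - W t y \<beta> \<gamma> (v x) - (y - x) *\<^sub>R W t y \<beta> \<gamma> D"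
        unfolding a1_def using bounded_linear_in_diff[OF WL[OF y] S\<beta> w(1,2)]
          bounded_linear_in_diff[OF WL[OF y] S\<beta> v\<beta>[OF y] v\<beta>[OF x]] bounded_linear_inD(3)[OF WL[OF y] D]
        by simp
      then have eq: "g y - g x = (a1 + a2) + a3"
        unfolding g_def a2_def a3_def by (simp add: algebra_simps)
      have "N \<gamma> a1 \<le> C * N \<beta> ?w" unfolding a1_def by (rule C(2)[OF y w(3)])
      also have "\<dots> \<le> C * (e / 3 / (C + 1) * \<bar>y - x\<bar>)"
        using d1(2)[OF y] d C(1) by (intro mult_left_mono) auto
      also have "\<dots> = (C / (C + 1)) * (e / 3 * \<bar>y - x\<bar>)" by simp
      also have "\<dots> \<le> 1 * (e / 3 * \<bar>y - x\<bar>)"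
        using C(1) e by (intro mult_right_mono) auto
      finally have 1: "N \<gamma> a1 \<le> e / 3 * \<bar>y - x\<bar>" by simp
      have "N \<gamma> a2 = \<bar>y - x\<bar> * N \<gamma> (W t y \<beta> \<gamma> D - W t x \<beta> \<gamma> D)"
        unfolding a2_def using x y D by (intro normed_on_scale[OF n] subspace_diff[OF S] Win)
      also have "\<dots> \<le> \<bar>y - x\<bar> * (e / 3)" using d2(2)[OF y] d by (intro mult_left_mono) auto
      finally have 2: "N \<gamma> a2 \<le> e / 3 * \<bar>y - x\<bar>" by (simp add: mult.commute)
      have 3: "N \<gamma> a3 \<le> e / 3 * \<bar>y - x\<bar>"
        unfolding a3_def W_eq[OF x] W_eq[OF y] using d3(2)[OF J[OF y]] d by simp
      have "N \<gamma> (g y - g x) \<le> (e / 3 * \<bar>y - x\<bar> + e / 3 * \<bar>y - x\<bar>) + e / 3 * \<bar>y - x\<bar>"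
        by (rule normed_on_le_add[OF n eq mem(4,3) normed_on_le_add[OF n refl mem(1,2) 1 2] 3])
      then show "N \<gamma> (g y - g x) \<le> e * \<bar>y - x\<bar>" by simp
    qed (use d1 d2 d3 in auto)
  qed
  moreover have "g t = v t" unfolding g_def using r0 ind v\<beta>[of t] by (intro W_refl) auto
  moreover have "g r0 = 0"
    unfolding g_def zero using r0 by (intro bounded_linear_in_zero[OF WL S\<beta>]) auto
  ultimately show ?thesis by simp
qed

text \<open>The difference \<open>v\<close> of the two solutions takes values in \<open>E \<alpha>'\<close>, whereas both of them are
differentiable in the larger space \<open>E \<beta>\<close> only, with derivatives computed from their values in
\<open>E \<alpha>'\<close>. So \<open>v\<close> satisfies the hypotheses of \<open>homogeneous_step\<close>, which is then iterated.\<close>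

lemma forward_solution_unique:
  assumes s: "0 \<le> s" and ind: "astar < \<alpha>'" "\<alpha>' < \<alpha>" and k: "k \<in> E \<alpha>"
    and u: "forward_solution astar E N A B \<alpha>' s L k u"
    and t: "s \<le> t" "ereal (t - s) < min (ereal L) (T \<alpha>' \<alpha>)"
  shows "u t = W t s \<alpha> \<alpha>' k"
proof -
  define I where "I = {r. s \<le> r \<and> r \<le> s + L \<and> ereal (r - s) < T \<alpha>' \<alpha>}"
  define v where "v r = u r - W r s \<alpha> \<alpha>' k" for r
  have S: "subspace (E \<alpha>')" by (rule E_subspace[OF ind(1)])
  have I_down: "r' \<in> I" if "r \<in> I" "s \<le> r'" "r' \<le> r" for r r'
    using that unfolding I_def by (auto intro: le_less_trans[rotated])
  have W_mem: "W r s \<alpha> \<alpha>' k \<in> E \<alpha>'" if "r \<in> I" for r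
    using that s ind k unfolding I_def by (intro W_in) auto
  have u_mem: "u r \<in> E \<alpha>'" if "r \<in> I" for r
  proof (rule cont_inD(1)[OF _ E_normed[OF ind(1)]])
    show "cont_in (E \<alpha>') (N \<alpha>') {s..s + L} u" using u unfolding forward_solution_def by blast
  qed (use that in \<open>simp add: I_def\<close>)
  have v_mem: "v r \<in> E \<alpha>'" if "r \<in> I" for r
    unfolding v_def by (rule subspace_diff[OF S u_mem[OF that] W_mem[OF that]])
  obtain \<beta> where \<beta>: "astar < \<beta>" "\<beta> < \<alpha>'" using dense[OF ind(1)] by blast
  obtain \<gamma> where \<gamma>: "astar < \<gamma>" "\<gamma> < \<beta>" using dense[OF \<beta>(1)] by blast
  note n\<beta> = E_normed[OF \<beta>(1)] and S\<beta> = E_subspace[OF \<beta>(1)]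
  have deriv: "\<exists>d>0. \<forall>y\<in>I. \<bar>y - r\<bar> < d \<longrightarrow>
      N \<beta> (v y - v r - (y - r) *\<^sub>R (A r \<alpha>' \<beta> (v r) + B r \<alpha>' \<beta> (v r))) \<le> e * \<bar>y - r\<bar>"
    if r: "r \<in> I" and e: "e > 0" for r e
  proof -
    let ?Q = "{t. s \<le> t \<and> ereal (t - s) < T \<alpha>' \<alpha>}"
    have r': "r \<in> {s..s + L}" "r \<in> ?Q" "0 \<le> r" using r s unfolding I_def by auto
    define Du where "Du = A r \<alpha>' \<beta> (u r) + B r \<alpha>' \<beta> (u r)"
    define Dw where "Dw = A r \<alpha>' \<beta> (W r s \<alpha> \<alpha>' k) + B r \<alpha>' \<beta> (W r s \<alpha> \<alpha>' k)"
    have "C1_with_deriv (E \<beta>) (N \<beta>) {s..s + L} u (\<lambda>t. A t \<alpha>' \<beta> (u t) + B t \<alpha>' \<beta> (u t))"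
      using u \<beta> unfolding forward_solution_def by blast
    then have Du: "u \<in> {s..s + L} \<rightarrow> E \<beta>" "has_deriv_in (E \<beta>) (N \<beta>) u Du r {s..s + L}"
      using r'(1) unfolding C1_with_deriv_def Du_def by blast+
    have e2: "0 < e / 2" using e by simp
    obtain d1 where d1: "d1 > 0" "\<And>y. y \<in> {s..s + L} \<Longrightarrow> \<bar>y - r\<bar> < d1 \<Longrightarrow>
        N \<beta> (u y - u r - (y - r) *\<^sub>R Du) \<le> e / 2 * \<bar>y - r\<bar>"
      using has_deriv_inD(2)[OF Du(2) n\<beta> Du(1) r'(1) e2] by blast
    have "C1_with_deriv (E \<beta>) (N \<beta>) ?Q (\<lambda>t. W t s \<alpha> \<beta> k)
        (\<lambda>t. A t \<alpha>' \<beta> (W t s \<alpha> \<alpha>' k) + B t \<alpha>' \<beta> (W t s \<alpha> \<alpha>' k))"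
      by (rule W_forward_C1[OF \<beta> ind(2) k s])
    then have Dw: "(\<lambda>t. W t s \<alpha> \<beta> k) \<in> ?Q \<rightarrow> E \<beta>" "has_deriv_in (E \<beta>) (N \<beta>) (\<lambda>t. W t s \<alpha> \<beta> k) Dw r ?Q"
      using r'(2) unfolding C1_with_deriv_def Dw_def by blast+
    obtain d2 where d2: "d2 > 0" "\<And>y. y \<in> ?Q \<Longrightarrow> \<bar>y - r\<bar> < d2 \<Longrightarrow>
        N \<beta> (W y s \<alpha> \<beta> k - W r s \<alpha> \<beta> k - (y - r) *\<^sub>R Dw) \<le> e / 2 * \<bar>y - r\<bar>"
      using has_deriv_inD(2)[OF Dw(2) n\<beta> Dw(1) r'(2) e2] by blast
    note D_mem = has_deriv_inD(1)[OF Du(2) n\<beta> Du(1) r'(1)] has_deriv_inD(1)[OF Dw(2) n\<beta> Dw(1) r'(2)]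
    have W_eq: "W y s \<alpha> \<beta> k = W y s \<alpha> \<alpha>' k" if "y \<in> I" for y
      using that \<beta> ind k s unfolding I_def by (intro W_target[symmetric]) auto
    have "A r \<alpha>' \<beta> (v r) = A r \<alpha>' \<beta> (u r) - A r \<alpha>' \<beta> (W r s \<alpha> \<alpha>' k)"
      unfolding v_def by (rule bounded_linear_in_diff[OF A_linear[OF r'(3) \<beta>] S u_mem[OF r] W_mem[OF r]])
    moreover have "B r \<alpha>' \<beta> (v r) = B r \<alpha>' \<beta> (u r) - B r \<alpha>' \<beta> (W r s \<alpha> \<alpha>' k)"
      unfolding v_def by (rule bounded_linear_in_diff[OF B_linear[OF r'(3) \<beta>] S u_mem[OF r] W_mem[OF r]])
    ultimately have D: "A r \<alpha>' \<beta> (v r) + B r \<alpha>' \<beta> (v r) = Du - Dw" by (simp add: Du_def Dw_def)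
    have est: "N \<beta> (v y - v r - (y - r) *\<^sub>R (Du - Dw)) \<le> e * \<bar>y - r\<bar>"
      if y: "y \<in> I" "\<bar>y - r\<bar> < min d1 d2" for y
    proof -
      have yI: "y \<in> {s..s + L}" "y \<in> ?Q" using y(1) unfolding I_def by auto
      let ?a = "u y - u r - (y - r) *\<^sub>R Du" and ?b = "W y s \<alpha> \<beta> k - W r s \<alpha> \<beta> k - (y - r) *\<^sub>R Dw"
      have a: "?a \<in> E \<beta>" and b: "?b \<in> E \<beta>"
        unfolding W_eq[OF r] W_eq[OF y(1)]
        by (intro subspace_diff[OF S\<beta>] subspace_scale[OF S\<beta>] D_mem E_mono[OF \<beta>] u_mem W_mem r y(1))+
      have "N \<beta> (- ?b) \<le> e / 2 * \<bar>y - r\<bar>"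
        using d2(2)[OF yI(2)] y(2) unfolding normed_on_minus[OF n\<beta> b] by simp
      moreover have "v y - v r - (y - r) *\<^sub>R (Du - Dw) = ?a + - ?b"
        unfolding v_def W_eq[OF r] W_eq[OF y(1)] by (simp add: algebra_simps)
      moreover have "N \<beta> ?a \<le> e / 2 * \<bar>y - r\<bar>" using d1(2)[OF yI(1)] y(2) by simp
      ultimately have "N \<beta> (v y - v r - (y - r) *\<^sub>R (Du - Dw)) \<le> e / 2 * \<bar>y - r\<bar> + e / 2 * \<bar>y - r\<bar>"
        using normed_on_le_add[OF n\<beta>] a subspace_neg[OF S\<beta> b] by blast
      then show ?thesis by simp
    qed
    then show ?thesis unfolding D using d1(1) d2(1) by (intro exI[of _ "min d1 d2"]) auto
  qed
  have "0 < min (T \<gamma> \<alpha>') (T \<gamma> \<beta>)"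
    using \<beta> \<gamma> ind K_pos M_nonneg by (auto intro!: lifetime_pos)
  then obtain \<tau> where \<tau>: "0 < \<tau>" "ereal \<tau> < min (T \<gamma> \<alpha>') (T \<gamma> \<beta>)"
    using ereal_dense2[of "ereal 0" "min (T \<gamma> \<alpha>') (T \<gamma> \<beta>)"] by (auto simp: zero_ereal_def)
  have step: "v r = 0" if "r0 \<in> I" "r \<in> I" "r0 \<le> r" "r - r0 \<le> \<tau>" "v r0 = 0" for r0 r
  proof (rule homogeneous_step[where v = v and ?r0.0 = r0 and t = r, OF \<gamma> \<beta>(2) _ _ _ that(3,5)])
    have sub: "{r0..r} \<subseteq> I" using I_down[OF that(2)] that(1) unfolding I_def by auto
    show "v r' \<in> E \<alpha>'" if "r' \<in> {r0..r}" for r' using v_mem sub that by blast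
    show "\<exists>d>0. \<forall>y\<in>{r0..r}. \<bar>y - r'\<bar> < d \<longrightarrow>
      N \<beta> (v y - v r' - (y - r') *\<^sub>R (A r' \<alpha>' \<beta> (v r') + B r' \<alpha>' \<beta> (v r'))) \<le> e * \<bar>y - r'\<bar>"
      if "r' \<in> {r0..r}" "e > 0" for r' e using deriv[of r' e] that sub by (meson subsetD)
    show "0 \<le> r0" using that(1) s unfolding I_def by simp
    show "ereal (r - r0) < min (T \<gamma> \<alpha>') (T \<gamma> \<beta>)"
      using that(4) \<tau>(2) by (auto intro: le_less_trans[rotated])
  qed
  \<comment> \<open>\<open>\<tau>\<close> is independent of the starting time, so \<open>m\<close> steps cover \<open>{s..s + m * \<tau>}\<close>.\<close>
  have all: "v r = 0" if "r \<in> I" "r \<le> s + real m * \<tau>" for m r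
    using that
  proof (induction m arbitrary: r)
    case 0
    then have "r = s" unfolding I_def by simp
    moreover have "W s s \<alpha> \<alpha>' k = k" using W_refl[OF ind k s] .
    ultimately show ?case using u unfolding v_def forward_solution_def by simp
  next
    case (Suc m)
    define r0 where "r0 = max s (r - \<tau>)"
    have r: "s \<le> r" using Suc.prems unfolding I_def by simp
    have r0: "r0 \<in> I" using I_down[OF Suc.prems(1), of r0] \<tau>(1) r unfolding r0_def by simp
    have "r0 \<le> s + real m * \<tau>" using Suc.prems(2) \<tau>(1) unfolding r0_def by (simp add: algebra_simps)
    then have "v r0 = 0" by (rule Suc.IH[OF r0])
    then show ?case by (intro step[OF r0 Suc.prems(1)]) (use \<tau>(1) r in \<open>auto simp: r0_def\<close>)
  qed
  obtain m where "t - s < real m * \<tau>" using ex_less_of_nat_mult[OF \<tau>(1)] by blast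
  moreover have "t \<in> I" using t unfolding I_def by auto
  ultimately have "v t = 0" using all[of t m] by simp
  then show ?thesis by (simp add: v_def)
qed

end

theorem corollary3p3:
  fixes astar :: real
    and E :: "real \<Rightarrow> 'a::real_vector set"
    and N :: "real \<Rightarrow> 'a \<Rightarrow> real"
    and A B :: "real \<Rightarrow> 'a scale_op"
    and V W :: "real \<Rightarrow> real \<Rightarrow> 'a scale_op"
    and K :: real
    and M :: "real \<Rightarrow> real"
  assumes "banach_scale astar E N"
    and "\<forall>t\<ge>0. A t \<in> scale_ops astar E N"
    and "condA1 astar E N A"
    and "condA2 astar E N V"
    and "condA3 astar E N A V"
    and "condA4 astar E N V K"
    and "\<forall>t\<ge>0. B t \<in> scale_ops astar E N"
    and "condB1 astar E N B"
    and "condB2 astar E N B M"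
    and "perturbed_family astar E N V B K M W"
  shows "(\<forall>\<alpha>' \<alpha>'' \<alpha> k s.
            astar < \<alpha>' \<and> \<alpha>' < \<alpha>'' \<and> \<alpha>'' < \<alpha> \<and> k \<in> E \<alpha> \<and> 0 \<le> s \<longrightarrow>
            C1_with_deriv (E \<alpha>') (N \<alpha>')
              {t. s \<le> t \<and> ereal (t - s) < min (lifetime K M \<alpha>' \<alpha>) (lifetime K M \<alpha>'' \<alpha>)}
              (\<lambda>t. W t s \<alpha> \<alpha>' k)
              (\<lambda>t. A t \<alpha>'' \<alpha>' (W t s \<alpha> \<alpha>'' k) + B t \<alpha>'' \<alpha>' (W t s \<alpha> \<alpha>'' k))) \<and>
         (\<forall>\<alpha>' \<alpha>'' \<alpha> k t.
            astar < \<alpha>' \<and> \<alpha>' < \<alpha>'' \<and> \<alpha>'' < \<alpha> \<and> k \<in> E \<alpha> \<and> 0 \<le> t \<longrightarrow>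
            C1_with_deriv (E \<alpha>') (N \<alpha>')
              {s. 0 \<le> s \<and> s \<le> t \<and> ereal (t - s) < min (lifetime K M \<alpha>' \<alpha>) (lifetime K M \<alpha>' \<alpha>'')}
              (\<lambda>s. W t s \<alpha> \<alpha>' k)
              (\<lambda>s. - W t s \<alpha>'' \<alpha>' (A s \<alpha> \<alpha>'' k + B s \<alpha> \<alpha>'' k))) \<and>
         (\<forall>s \<alpha>' \<alpha> k T u.
            0 \<le> s \<and> astar < \<alpha>' \<and> \<alpha>' < \<alpha> \<and> k \<in> E \<alpha> \<and> 0 < T \<and>
            forward_solution astar E N A B \<alpha>' s T k u \<longrightarrow>
            (\<forall>t. s \<le> t \<and> ereal (t - s) < min (ereal T) (lifetime K M \<alpha>' \<alpha>) \<longrightarrow>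
               u t = W t s \<alpha> \<alpha>' k))"
proof -
  interpret perturbed_evolution astar E N A B V W K M
    using assms by unfold_locales auto
  show ?thesis
  proof (intro conjI allI impI; elim conjE)
    fix \<alpha>' \<alpha>'' \<alpha> k and s :: real
    assume *: "astar < \<alpha>'" "\<alpha>' < \<alpha>''" "\<alpha>'' < \<alpha>" "k \<in> E \<alpha>" "0 \<le> s"
    have "min (T \<alpha>' \<alpha>) (T \<alpha>'' \<alpha>) = T \<alpha>'' \<alpha>" using * by (intro min_absorb2 T_antimono) auto
    then show "C1_with_deriv (E \<alpha>') (N \<alpha>') {t. s \<le> t \<and> ereal (t - s) < min (T \<alpha>' \<alpha>) (T \<alpha>'' \<alpha>)}
        (\<lambda>t. W t s \<alpha> \<alpha>' k) (\<lambda>t. A t \<alpha>'' \<alpha>' (W t s \<alpha> \<alpha>'' k) + B t \<alpha>'' \<alpha>' (W t s \<alpha> \<alpha>'' k))"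
      using W_forward_C1[OF *] by simp
  next
    fix \<alpha>' \<alpha>'' \<alpha> k and t :: real
    assume "astar < \<alpha>'" "\<alpha>' < \<alpha>''" "\<alpha>'' < \<alpha>" "k \<in> E \<alpha>" "0 \<le> t"
    then show "C1_with_deriv (E \<alpha>') (N \<alpha>')
        {s. 0 \<le> s \<and> s \<le> t \<and> ereal (t - s) < min (T \<alpha>' \<alpha>) (T \<alpha>' \<alpha>'')}
        (\<lambda>s. W t s \<alpha> \<alpha>' k) (\<lambda>s. - W t s \<alpha>'' \<alpha>' (A s \<alpha> \<alpha>'' k + B s \<alpha> \<alpha>'' k))"
      by (rule W_backward_C1)
  next
    fix s \<alpha>' \<alpha> k L u t
    assume "0 \<le> s" "astar < \<alpha>'" "\<alpha>' < \<alpha>" "k \<in> E \<alpha>" "0 < L"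
      "forward_solution astar E N A B \<alpha>' s L k u" "s \<le> t" "ereal (t - s) < min (ereal L) (T \<alpha>' \<alpha>)"
    then show "u t = W t s \<alpha> \<alpha>' k" by (intro forward_solution_unique)
  qed
qed

end
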